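(* There is a constant $C$ such that for every Schwartz function $f:\mathbb{R}^3\to\mathbb{C}$, $$\|P^{\perp}(H+1)^{-1}f\|_{L^6(\mathbb{R}^3)}\le C\,\|f\|_{L^{2}(\mathbb{R}^3)}.$$
   Context: $H=-\Delta-\frac{1}{4|x|^2}$ on $\mathbb{R}^3$ denotes the non-negative self-adjoint operator on $L^2(\mathbb{R}^3)$ which is the Friedrichs extension associated with the symmetric non-negative sesquilinear form $Q(u,v)=\int_{\mathbb{R}^3}\nabla u\cdot\overline{\nabla v}-\frac{1}{4|x|^2}u\bar v\,dx$, $u,v\in C_0^\infty(\mathbb{R}^3)$. Explicitly: $\bar Q$ is the closure of $Q$, with domain $D(\bar Q)$ the completion of $C_0^\infty(\mathbb{R}^3)$ in the norm $(\|u\|_{L^2}^2+Q(u,u))^{1/2}$; $D(H)$ is the set of $u\in D(\bar Q)$ for which there is $C_u$ with $|\bar Q(u,v)|\le C_u\|v\|_{L^2}$ for all $v\in D(\bar Q)$; and $Hu$ is the unique element of $L^2$ with $\bar Q(u,v)=\langle Hu,v\rangle$ for all $v\in D(\bar Q)$. $P$ is the orthogonal projection of $L^2(\mathbb{R}^3)$ onto radial functions, $Pf(x)=\frac{1}{4\pi}\int_{\mathbb{S}^2}f(|x|\omega)\,d\sigma(\omega)$ with $\sigma$ the surface measure on the unit sphere $\mathbb{S}^2$, and $P^\perp=I-P$. These projections commute with $\Delta$ and $H$. *)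

theory Defs
  imports "HOL-Analysis.Analysis"
begin

section \<open>Lebesgue spaces on \<open>\<real>\<^sup>3\<close>\<close>

text \<open>
  Elements of \<open>L\<^sup>p(\<real>\<^sup>3)\<close> are represented by Borel functions; two representatives are identified
  when they agree almost everywhere. A Bochner integral of a non-integrable function is \<open>0\<close>, so
  \<open>Lp_norm\<close> is meaningful only together with \<open>in_Lp\<close>.
\<close>

definition in_Lp :: "real \<Rightarrow> (real^3 \<Rightarrow> complex) \<Rightarrow> bool" where
  "in_Lp p f \<longleftrightarrow> f \<in> borel_measurable lborel \<and> integrable lborel (\<lambda>x. cmod (f x) powr p)"

definition Lp_norm :: "real \<Rightarrow> (real^3 \<Rightarrow> complex) \<Rightarrow> real" where
  "Lp_norm p f = (LINT x|lborel. cmod (f x) powr p) powr (1 / p)"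

definition L2_inner :: "(real^3 \<Rightarrow> complex) \<Rightarrow> (real^3 \<Rightarrow> complex) \<Rightarrow> complex" where
  "L2_inner f g = (LINT x|lborel. f x * cnj (g x))"


section \<open>Smooth, compactly supported and Schwartz functions\<close>

definition pderiv3 :: "3 \<Rightarrow> (real^3 \<Rightarrow> complex) \<Rightarrow> real^3 \<Rightarrow> complex" where
  "pderiv3 i f x = frechet_derivative f (at x) (axis i 1)"

primrec iter_pderiv3 :: "3 list \<Rightarrow> (real^3 \<Rightarrow> complex) \<Rightarrow> real^3 \<Rightarrow> complex" where
  "iter_pderiv3 [] f = f"
| "iter_pderiv3 (i # is) f = pderiv3 i (iter_pderiv3 is f)"

text \<open>
  If all iterated partial derivatives are (totally) differentiable, they are all continuous;
  hence this is \<open>C\<^sup>\<infinity>\<close>.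
\<close>

definition smooth3 :: "(real^3 \<Rightarrow> complex) \<Rightarrow> bool" where
  "smooth3 f \<longleftrightarrow> (\<forall>is. iter_pderiv3 is f differentiable_on UNIV)"

definition test_fun :: "(real^3 \<Rightarrow> complex) \<Rightarrow> bool" where
  "test_fun f \<longleftrightarrow> smooth3 f \<and> compact (closure {x. f x \<noteq> 0})"

definition schwartz :: "(real^3 \<Rightarrow> complex) \<Rightarrow> bool" where
  "schwartz f \<longleftrightarrow> smooth3 f \<and>
     (\<forall>k is. \<exists>B. \<forall>x. (1 + norm x) ^ k * cmod (iter_pderiv3 is f x) \<le> B)"


section \<open>The Friedrichs extension \<open>H\<close> of \<open>-\<Delta> - 1 / (4|x|\<^sup>2)\<close>\<close>

text \<open>The form \<open>Q\<close> on test functions; the integrand is set to a finite value at \<open>x = 0\<close>.\<close>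

definition Qform :: "(real^3 \<Rightarrow> complex) \<Rightarrow> (real^3 \<Rightarrow> complex) \<Rightarrow> complex" where
  "Qform u v = (LINT x|lborel.
     (\<Sum>i\<in>UNIV. pderiv3 i u x * cnj (pderiv3 i v x))
     - complex_of_real (1 / (4 * (norm x)\<^sup>2)) * (u x * cnj (v x)))"

text \<open>The norm whose completion is taken; \<open>Q(u,u)\<close> is real and non-negative by Hardy's inequality.\<close>

definition Qnorm :: "(real^3 \<Rightarrow> complex) \<Rightarrow> real" where
  "Qnorm u = sqrt ((Lp_norm 2 u)\<^sup>2 + Re (Qform u u))"

text \<open>
  Since \<open>Q\<close> is closable, the completion of the test functions in \<open>Qnorm\<close> embeds into
  \<open>L\<^sup>2\<close>: its elements are the \<open>L\<^sup>2\<close>-limits of the \<open>Qnorm\<close>-Cauchy sequences of test functions.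
\<close>

definition Q_approx :: "(nat \<Rightarrow> real^3 \<Rightarrow> complex) \<Rightarrow> (real^3 \<Rightarrow> complex) \<Rightarrow> bool" where
  "Q_approx us u \<longleftrightarrow>
     (\<forall>n. test_fun (us n)) \<and>
     (\<forall>e>0. \<exists>N. \<forall>m\<ge>N. \<forall>n\<ge>N. Qnorm (\<lambda>x. us m x - us n x) < e) \<and>
     in_Lp 2 u \<and> (\<lambda>n. Lp_norm 2 (\<lambda>x. us n x - u x)) \<longlonglongrightarrow> 0"

definition Qbar_dom :: "(real^3 \<Rightarrow> complex) set" where
  "Qbar_dom = {u. \<exists>us. Q_approx us u}"

text \<open>The value does not depend on the approximating sequences, again by closability.\<close>

definition Qbar :: "(real^3 \<Rightarrow> complex) \<Rightarrow> (real^3 \<Rightarrow> complex) \<Rightarrow> complex" where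
  "Qbar u v = (THE q. \<forall>us vs. Q_approx us u \<longrightarrow> Q_approx vs v \<longrightarrow>
     (\<lambda>n. Qform (us n) (vs n)) \<longlonglongrightarrow> q)"

definition H_dom :: "(real^3 \<Rightarrow> complex) set" where
  "H_dom = {u \<in> Qbar_dom. \<exists>C. \<forall>v\<in>Qbar_dom. cmod (Qbar u v) \<le> C * Lp_norm 2 v}"

text \<open>
  \<open>H u\<close> and \<open>(H + 1)\<^sup>-\<^sup>1 f\<close> are unique as elements of \<open>L\<^sup>2\<close>, that is, up to null sets; the choice
  operator picks an arbitrary representative.
\<close>

definition H_op :: "(real^3 \<Rightarrow> complex) \<Rightarrow> real^3 \<Rightarrow> complex" where
  "H_op u = (SOME g. in_Lp 2 g \<and> (\<forall>v\<in>Qbar_dom. Qbar u v = L2_inner g v))"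

definition H_plus_1_inv :: "(real^3 \<Rightarrow> complex) \<Rightarrow> real^3 \<Rightarrow> complex" where
  "H_plus_1_inv f = (SOME u. u \<in> H_dom \<and> (AE x in lborel. H_op u x + u x = f x))"


section \<open>The projection onto radial functions\<close>

text \<open>
  Surface measure on the unit sphere \<open>S\<^sup>2\<close> via polar coordinates:
  \<open>\<sigma>(A) = 3 \<cdot> vol {r \<omega> | 0 < r \<le> 1, \<omega> \<in> A}\<close>. It is a Borel measure on \<open>\<real>\<^sup>3\<close> carried by the sphere
  (\<open>sgn x = x / |x|\<close>, and the exceptional value \<open>sgn 0 = 0\<close> concerns a null set), of total mass
  \<open>4\<pi>\<close>.
\<close>

definition sphere_measure :: "(real^3) measure" where
  "sphere_measure = distr (density lborel (\<lambda>x. 3 * indicator (cball 0 1) x)) borel sgn"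

definition radial_proj :: "(real^3 \<Rightarrow> complex) \<Rightarrow> real^3 \<Rightarrow> complex" where
  "radial_proj f x =
     complex_of_real (1 / (4 * pi)) * (LINT \<omega>|sphere_measure. f (norm x *\<^sub>R \<omega>))"

definition radial_proj_perp :: "(real^3 \<Rightarrow> complex) \<Rightarrow> real^3 \<Rightarrow> complex" where
  "radial_proj_perp f x = f x - radial_proj f x"

end

theory Submission
  imports Defs
begin

text \<open>
  Why the estimate holds. Put \<open>T u = \<nabla>u + x u / (2 |x|\<^sup>2)\<close>. Since \<open>|x|\<^sup>-\<^sup>1\<^sup>/\<^sup>2\<close> solves
  \<open>-\<Delta>w = w / (4 |x|\<^sup>2)\<close>, the form is a square, \<open>Q(u, v) = \<langle>T u, T v\<rangle>\<close> (\<open>Qform_eq_T\<close>). The form does not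
  control \<open>\<nabla>u\<close>, because the constant in Hardy's inequality is critical; but the correction
  \<open>x u / (2 |x|\<^sup>2)\<close> points in the radial direction, so \<open>T\<close> and \<open>\<nabla>\<close> agree on vectors tangent to
  spheres, and \<open>Q(u, u)\<close> does control the angular part of the gradient.
  
  Let \<open>R\<close> be a rotation. It is the end of a flow that moves every point along its sphere, so
  integrating the angular derivative along the flow gives
  \<open>\<parallel>(u \<circ> R - u) / |x|\<parallel>\<^sup>2 \<le> C Q(u, u)\<close> (\<open>rotation_difference_hardy\<close>): on differences of this kind the
  critical Hardy inequality is recovered. As \<open>Q\<close> is invariant under rotations,
  \<open>Q(u \<circ> R - u, u \<circ> R - u) \<le> 4 Q(u, u)\<close>, and together the two bounds control the full gradient of
  \<open>u \<circ> R - u\<close> (\<open>rotation_difference_gradient\<close>). Sobolev's inequality (\<open>Sobolev_L6\<close>) then yields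
  \<open>\<parallel>u \<circ> R - u\<parallel>\<^sub>6\<^sup>2 \<le> C Q(u, u)\<close> uniformly in \<open>R\<close>. Finally \<open>P\<^sup>\<bottom> u\<close> is the average of
  \<open>u - u \<circ> R\<close> over all rotations, so by convexity it satisfies the same bound
  (\<open>radial_proj_perp_L6\<close>). No spherical harmonics are involved: averaging over rotations replaces the
  spectral gap on the sphere.
  
  For \<open>u = (H + 1)\<^sup>-\<^sup>1 f\<close> the weak equation tested with \<open>u\<close> reads \<open>Q(u, u) + \<parallel>u\<parallel>\<^sup>2 = \<langle>f, u\<rangle>\<close>, whence
  \<open>Q(u, u) \<le> \<parallel>f\<parallel>\<^sup>2 / 4\<close> (\<open>resolvent_energy\<close>). The bound for test functions passes to \<open>u\<close> along an
  approximating sequence by Fatou's lemma (\<open>radial_proj_perp_L6_limit\<close>).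
  
  It remains to see that the operators are what they should be. The closed form is well defined because
  \<open>T\<close> is closable: its adjoint is defined on the functions \<open>|x|\<^sup>2 \<psi>\<close>, whose factor \<open>|x|\<^sup>2\<close> cancels
  the singularity (\<open>T_adjoint\<close>, \<open>T_limit_unique\<close>). The value \<open>H u\<close> is determined up to null sets because
  test functions are dense (\<open>AE_zero_if_orthogonal_to_test_fun\<close>). Existence, of \<open>H u\<close> for \<open>u\<close> in the domain
  and of \<open>(H + 1)\<^sup>-\<^sup>1 f\<close>, comes from minimising a quadratic functional over test functions
  (\<open>weak_representer\<close>) and from the completeness of \<open>L\<^sup>2\<close> (\<open>L2_complete\<close>).
\<close>

section \<open>Semi-inner products and weak representers\<close>

locale semi_inner_product =
  fixes V :: "('a \<Rightarrow> complex) set" and B :: "('a \<Rightarrow> complex) \<Rightarrow> ('a \<Rightarrow> complex) \<Rightarrow> complex"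
  assumes nonempty: "V \<noteq> {}"
    and lin_closed: "\<And>u v c. u \<in> V \<Longrightarrow> v \<in> V \<Longrightarrow> (\<lambda>x. u x + c * v x) \<in> V"
    and lin_left: "\<And>u v w c. u \<in> V \<Longrightarrow> v \<in> V \<Longrightarrow> w \<in> V \<Longrightarrow>
        B (\<lambda>x. u x + c * v x) w = B u w + c * B v w"
    and hermitian: "\<And>u v. u \<in> V \<Longrightarrow> v \<in> V \<Longrightarrow> B v u = cnj (B u v)"
    and nonneg: "\<And>u. u \<in> V \<Longrightarrow> 0 \<le> Re (B u u)"
begin

definition N :: "('a \<Rightarrow> complex) \<Rightarrow> real" where "N u = sqrt (Re (B u u))"

lemma N_nonneg: "u \<in> V \<Longrightarrow> 0 \<le> N u"
  by (simp add: N_def nonneg)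

lemma N_power2: "u \<in> V \<Longrightarrow> (N u)^2 = Re (B u u)"
  by (simp add: N_def nonneg)

lemma lin_right:
  assumes "u \<in> V" "v \<in> V" "w \<in> V"
  shows "B w (\<lambda>x. u x + c * v x) = B w u + cnj c * B w v"
  unfolding hermitian[OF lin_closed[OF assms(1,2), of c] assms(3)] lin_left[OF assms]
    hermitian[OF assms(1) assms(3)] hermitian[OF assms(2) assms(3)] by simp

lemma N_expand:
  assumes "u \<in> V" "v \<in> V"
  shows "(N (\<lambda>x. u x + c * v x))^2 = (N u)^2 + 2 * Re (cnj c * B u v) + (cmod c)^2 * (N v)^2"
proof -
  have "B (\<lambda>x. u x + c * v x) (\<lambda>x. u x + c * v x)
      = B u u + cnj c * B u v + c * cnj (B u v) + c * cnj c * B v v"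
    unfolding lin_left[OF assms lin_closed[OF assms]] lin_right[OF assms assms(1)]
      lin_right[OF assms assms(2)] hermitian[OF assms] by (simp add: distrib_left)
  moreover have "c * cnj c = complex_of_real ((cmod c)^2)"
    by (simp add: complex_mult_cnj cmod_def)
  moreover have "Re (c * cnj (B u v)) = Re (cnj c * B u v)"
    by simp
  ultimately show ?thesis
    unfolding N_power2[OF lin_closed[OF assms]] N_power2[OF assms(1)] N_power2[OF assms(2)] by simp
qed

lemma Cauchy_Schwarz:
  assumes "u \<in> V" "v \<in> V"
  shows "cmod (B u v) \<le> N u * N v"
proof -
  have q: "0 \<le> (N u)^2 - 2 * t * (cmod (B u v))^2 + t^2 * (cmod (B u v))^2 * (N v)^2" for t :: real
  proof -
    let ?c = "- complex_of_real t * B u v"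
    have "Re (cnj ?c * B u v) = - t * (cmod (B u v))^2"
      by (simp add: cmod_power2) (simp add: power2_eq_square algebra_simps)
    moreover have "(cmod ?c)^2 = t^2 * (cmod (B u v))^2"
      by (simp add: norm_mult power_mult_distrib)
    ultimately have "(N (\<lambda>x. u x + ?c * v x))^2
        = (N u)^2 + 2 * (- t * (cmod (B u v))^2) + t^2 * (cmod (B u v))^2 * (N v)^2"
      using N_expand[OF assms, of ?c] by (simp only:)
    then show ?thesis
      using zero_le_power2[of "N (\<lambda>x. u x + ?c * v x)"] by linarith
  qed
  have "(cmod (B u v))^2 \<le> (N u)^2 * (N v)^2"
  proof (cases "N v = 0")
    case True
    have "cmod (B u v) = 0"
    proof (rule ccontr)
      assume "cmod (B u v) \<noteq> 0"
      then have "2 * (((N u)^2 + 1) / (cmod (B u v))^2) * (cmod (B u v))^2 = 2 * ((N u)^2 + 1)"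
        by simp
      then show False
        using q[of "((N u)^2 + 1) / (cmod (B u v))^2"] True zero_le_power2[of "N u"]
        by simp
    qed
    then show ?thesis by simp
  next
    case False
    show ?thesis
    proof -
      have pos: "0 < (N v)^2" using False by simp
      define p where "p = (N v)^2"
      have "0 \<le> (N u)^2 - (cmod (B u v))^2 / p"
        using q[of "1 / p"] pos unfolding p_def[symmetric] by (simp add: power2_eq_square)
      then show ?thesis
        using pos unfolding p_def[symmetric] by (simp add: divide_simps)
    qed
  qed
  then show ?thesis
    using N_nonneg assms by (metis mult_nonneg_nonneg power2_le_imp_le power_mult_distrib)
qed

text \<open>
  A minimising sequence of the functional \<open>J v = (N v)\<^sup>2 - 2 Re (l v)\<close> does it: by the parallelogram
  identity it is a Cauchy sequence, and the first variation of \<open>J\<close> at its members tends to \<open>0\<close>. The limit itself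
  need not lie in \<open>V\<close>; this form of the Riesz representation theorem lets one and the same
  lemma serve the \<open>L\<^sup>2\<close> product and the form, both on test functions.
\<close>

lemma weak_representer:
  assumes anti: "\<And>u v c. u \<in> V \<Longrightarrow> v \<in> V \<Longrightarrow> l (\<lambda>x. u x + c * v x) = l u + cnj c * l v"
    and bound: "\<And>v. v \<in> V \<Longrightarrow> cmod (l v) \<le> C * N v"
  obtains us where "\<And>n. us n \<in> V"
    "\<And>e. e > 0 \<Longrightarrow> \<exists>K. \<forall>m\<ge>K. \<forall>n\<ge>K. N (\<lambda>x. us m x - us n x) < e"
    "\<And>w. w \<in> V \<Longrightarrow> (\<lambda>n. B (us n) w) \<longlonglongrightarrow> l w"
proof -
  define J where "J v = (N v)^2 - 2 * Re (l v)" for v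
  have J_lower: "- (C^2) \<le> J v" if "v \<in> V" for v
  proof -
    have "Re (l v) \<le> C * N v"
      using complex_Re_le_cmod[of "l v"] bound[OF that] by linarith
    then show ?thesis
      using zero_le_power2[of "N v - C"] by (simp add: J_def power2_diff algebra_simps)
  qed
  have J_expand: "J (\<lambda>x. u x + c * v x) = J u + 2 * Re (cnj c * (B u v - l v)) + (cmod c)^2 * (N v)^2"
    if "u \<in> V" "v \<in> V" for u v c
    by (simp add: J_def N_expand that anti algebra_simps)
  define m where "m = Inf (J ` V)"
  have bdd: "bdd_below (J ` V)"
    using J_lower by (auto simp: bdd_below_def)
  have m_le: "m \<le> J v" if "v \<in> V" for v
    unfolding m_def using that bdd by (simp add: cInf_lower)
  have "\<exists>v\<in>V. J v < m + 1 / real (Suc n)" for n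
    using cInf_less_iff[OF _ bdd, of "m + 1 / real (Suc n)"] nonempty
    unfolding m_def[symmetric] by simp
  then obtain us where us: "\<And>n. us n \<in> V" and J_us: "\<And>n. J (us n) < m + 1 / real (Suc n)"
    by metis
  have gap: "(N (\<lambda>x. u x - v x))^2 \<le> 2 * (J u - m) + 2 * (J v - m)" if "u \<in> V" "v \<in> V" for u v
  proof -
    have d: "(\<lambda>x. v x - u x) \<in> V"
      using lin_closed[OF that(2,1), of "-1"] by simp
    have mid: "(\<lambda>x. u x + (1/2) * (v x - u x)) \<in> V"
      using lin_closed[OF that(1) d, of "1/2"] by simp
\<comment> \<open>The midpoint of \<open>u\<close> and \<open>v\<close> is compared with both end points.\<close>
    have e1: "J (\<lambda>x. u x + (1/2) * (v x - u x))
        = J u + Re (B u (\<lambda>x. v x - u x) - l (\<lambda>x. v x - u x)) + (1/4) * (N (\<lambda>x. v x - u x))^2"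
      using J_expand[OF that(1) d, of "1/2"] by (simp add: power2_eq_square)
    have e2: "J v = J u + 2 * Re (B u (\<lambda>x. v x - u x) - l (\<lambda>x. v x - u x)) + (N (\<lambda>x. v x - u x))^2"
      using J_expand[OF that(1) d, of "1"] by simp
    have sym: "(N (\<lambda>x. u x - v x))^2 = (N (\<lambda>x. v x - u x))^2"
      using N_expand[OF that, of "-1"] N_expand[OF that(2,1), of "-1"] hermitian[OF that] by simp
    have "m \<le> J (\<lambda>x. u x + (1/2) * (v x - u x))"
      using m_le[OF mid] .
    with e1 have "m \<le> J u + Re (B u (\<lambda>x. v x - u x) - l (\<lambda>x. v x - u x)) + (1/4) * (N (\<lambda>x. v x - u x))^2"
      by (simp only:)
    moreover have lin: "n \<le> 2 * (j - m) + 2 * (k - m)"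
      if "k = j + 2 * d + n" "m \<le> j + d + 1/4 * n" for j k d n :: real
      using that by (simp add: field_simps)
    ultimately show ?thesis unfolding sym using lin[OF e2] by blast
  qed
  have cauchy: "\<exists>K. \<forall>m\<ge>K. \<forall>n\<ge>K. N (\<lambda>x. us m x - us n x) < e" if "e > 0" for e
  proof -
    obtain K where K: "1 / real (Suc K) < e^2 / 4"
      using nat_approx_posE[of "e^2 / 4"] \<open>e > 0\<close> by (metis divide_pos_pos zero_less_numeral zero_less_power)
    have "N (\<lambda>x. us i x - us j x) < e" if "i \<ge> K" "j \<ge> K" for i j
    proof -
      have le: "1 / real (Suc k) \<le> 1 / real (Suc K)" if "k \<ge> K" for k
        using that by (simp add: frac_le)
      have "(N (\<lambda>x. us i x - us j x))^2 < e^2"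
        using gap[OF us us, of i j] less_le_trans[OF J_us add_left_mono[OF le[OF that(1)]]]
          less_le_trans[OF J_us add_left_mono[OF le[OF that(2)]]] K
        by argo
      then show ?thesis
        using \<open>e > 0\<close> by (meson less_eq_real_def power2_less_imp_less)
    qed
    then show ?thesis by blast
  qed
  have conv: "(\<lambda>n. B (us n) w) \<longlonglongrightarrow> l w" if w: "w \<in> V" for w
  proof -
    have est: "(cmod (B (us n) w - l w))^2 \<le> ((N w)^2 + 1) / real (Suc n)" for n
    proof -
      define e where "e = B (us n) w - l w"
\<comment> \<open>The variation in direction \<open>-e w\<close>; this step size absorbs the quadratic term even if \<open>N w = 0\<close>.\<close>
      define t where "t = 1 / ((N w)^2 + 1)"
      have pos: "(N w)^2 + 1 > 0" by (smt (verit) zero_le_power2)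
      let ?c = "- complex_of_real t * e"
      have r: "Re (cnj ?c * e) = - t * (cmod e)^2"
        by (simp add: cmod_power2) (simp add: power2_eq_square algebra_simps)
      have c2: "(cmod ?c)^2 = t^2 * (cmod e)^2"
        by (simp add: norm_mult power_mult_distrib)
      have "m \<le> J (us n) + 2 * (- t * (cmod e)^2) + t^2 * (cmod e)^2 * (N w)^2"
        using m_le[OF lin_closed[OF us w, of n ?c]] J_expand[OF us w, of n ?c, folded e_def]
        unfolding r c2 by simp
      then have "2 * t * (cmod e)^2 - t^2 * (cmod e)^2 * (N w)^2 \<le> 1 / real (Suc n)"
        using J_us[of n] by linarith
      moreover have "t^2 * (cmod e)^2 * (N w)^2 \<le> t * (cmod e)^2"
      proof -
        have "t * (N w)^2 \<le> 1" using pos by (simp add: t_def)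
        then have "(t * (cmod e)^2) * (t * (N w)^2) \<le> (t * (cmod e)^2) * 1"
          by (intro mult_left_mono) (auto simp: t_def)
        then show ?thesis by (simp add: power2_eq_square algebra_simps)
      qed
      ultimately have "t * (cmod e)^2 \<le> 1 / real (Suc n)" by linarith
      then show ?thesis
        unfolding t_def e_def[symmetric] using pos by (simp add: field_simps)
    qed
    have "(\<lambda>n. ((N w)^2 + 1) / real (Suc n)) \<longlonglongrightarrow> 0"
      by (rule LIMSEQ_Suc[OF lim_const_over_n])
    then have "(\<lambda>n. (cmod (B (us n) w - l w))^2) \<longlonglongrightarrow> 0"
      by (rule Lim_null_comparison[rotated]) (use est in \<open>auto intro: always_eventually\<close>)
    from tendsto_real_sqrt[OF this] have "(\<lambda>n. B (us n) w - l w) \<longlonglongrightarrow> 0"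
      unfolding real_sqrt_zero real_sqrt_abs abs_norm_cancel by (rule tendsto_norm_zero_cancel)
    then show ?thesis
      by (rule LIM_zero_cancel)
  qed
  show thesis using that us cauchy conv by blast
qed

lemma inner_tendsto:
  assumes u: "\<And>n. us n \<in> V" "u \<in> V" "(\<lambda>n. N (\<lambda>x. us n x - u x)) \<longlonglongrightarrow> 0"
    and v: "\<And>n. vs n \<in> V" "v \<in> V" "(\<lambda>n. N (\<lambda>x. vs n x - v x)) \<longlonglongrightarrow> 0"
  shows "(\<lambda>n. B (us n) (vs n)) \<longlonglongrightarrow> B u v"
proof -
  have du: "(\<lambda>x. us n x - u x) \<in> V" and dv: "(\<lambda>x. vs n x - v x) \<in> V" for n
    using lin_closed[OF u(1) u(2), of n "-1"] lin_closed[OF v(1) v(2), of n "-1"] by simp_all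
  have split: "B (us n) (vs n) - B u v = B (\<lambda>x. us n x - u x) v + B (\<lambda>x. us n x - u x) (\<lambda>x. vs n x - v x)
      + B u (\<lambda>x. vs n x - v x)" for n
    using lin_left[OF u(2) du[of n] v(2), of 1] lin_left[OF u(2) du[of n] dv[of n], of 1]
      lin_right[OF v(2) dv[of n] u(1)[of n], of 1]  lin_right[OF v(2) dv[of n] u(2), of 1] by simp
  have est: "cmod (B (us n) (vs n) - B u v)
      \<le> N (\<lambda>x. us n x - u x) * N v + N (\<lambda>x. us n x - u x) * N (\<lambda>x. vs n x - v x)
        + N u * N (\<lambda>x. vs n x - v x)" for n
    unfolding split
    by (intro order_trans[OF norm_triangle_ineq] add_mono order_refl
        Cauchy_Schwarz[OF du v(2)] Cauchy_Schwarz[OF du dv] Cauchy_Schwarz[OF u(2) dv])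
  have "(\<lambda>n. N (\<lambda>x. us n x - u x) * N v + N (\<lambda>x. us n x - u x) * N (\<lambda>x. vs n x - v x)
        + N u * N (\<lambda>x. vs n x - v x)) \<longlonglongrightarrow> 0 * N v + 0 * 0 + N u * 0"
    by (intro tendsto_intros u v)
  then have "(\<lambda>n. N (\<lambda>x. us n x - u x) * N v + N (\<lambda>x. us n x - u x) * N (\<lambda>x. vs n x - v x)
        + N u * N (\<lambda>x. vs n x - v x)) \<longlonglongrightarrow> 0"
    by simp
  then have "(\<lambda>n. B (us n) (vs n) - B u v) \<longlonglongrightarrow> 0"
    by (rule Lim_null_comparison[rotated]) (use est in \<open>auto intro: always_eventually\<close>)
  then show ?thesis
    by (rule LIM_zero_cancel)
qed

end

section \<open>The space \<open>L\<^sup>2\<close>\<close>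

abbreviation nn_lebesgue :: "('a::euclidean_space \<Rightarrow> ennreal) \<Rightarrow> ennreal" (binder "\<integral>\<^sub>+" 10)
  where "nn_lebesgue f \<equiv> nn_integral lborel f"

text \<open>
  Fatou's lemma in the form in which a bound survives a limit.
\<close>

lemma nn_integral_le_of_AE_tendsto:
  fixes u :: "nat \<Rightarrow> 'a \<Rightarrow> ennreal"
  assumes [measurable]: "\<And>k. u k \<in> borel_measurable M"
    and lim: "AE x in M. (\<lambda>k. u k x) \<longlonglongrightarrow> v x"
    and le: "\<And>k. (\<integral>\<^sup>+ x. u k x \<partial>M) \<le> c k" and c: "c \<longlonglongrightarrow> C"
  shows "(\<integral>\<^sup>+ x. v x \<partial>M) \<le> C"
proof -
  have "(\<integral>\<^sup>+ x. v x \<partial>M) = (\<integral>\<^sup>+ x. liminf (\<lambda>k. u k x) \<partial>M)"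
    by (rule nn_integral_cong_AE)
      (use lim in eventually_elim, simp add: lim_imp_Liminf)
  also have "\<dots> \<le> liminf (\<lambda>k. \<integral>\<^sup>+ x. u k x \<partial>M)"
    by (rule nn_integral_liminf) simp
  also have "\<dots> \<le> liminf c"
    by (rule Liminf_mono) (simp add: le)
  also have "\<dots> = C"
    by (rule lim_imp_Liminf[OF _ c]) simp
  finally show ?thesis .
qed

definition square_integrable :: "'a measure \<Rightarrow> ('a \<Rightarrow> complex) \<Rightarrow> bool" where
  "square_integrable M f \<longleftrightarrow> f \<in> borel_measurable M \<and> integrable M (\<lambda>x. (cmod (f x))^2)"

definition inner_L2 :: "'a measure \<Rightarrow> ('a \<Rightarrow> complex) \<Rightarrow> ('a \<Rightarrow> complex) \<Rightarrow> complex" where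
  "inner_L2 M f g = (LINT x|M. f x * cnj (g x))"

definition norm_L2 :: "'a measure \<Rightarrow> ('a \<Rightarrow> complex) \<Rightarrow> real" where
  "norm_L2 M f = sqrt (LINT x|M. (cmod (f x))^2)"

lemma square_integrable_measurable: "square_integrable M f \<Longrightarrow> f \<in> borel_measurable M"
  by (simp add: square_integrable_def)

lemma square_integrable_bound:
  assumes "g \<in> borel_measurable M" "integrable M h" "\<And>x. (cmod (g x))^2 \<le> h x"
  shows "square_integrable M g"
proof -
  have "integrable M (\<lambda>x. (cmod (g x))^2)"
  proof (rule Bochner_Integration.integrable_bound[OF assms(2)])
    show "(\<lambda>x. (cmod (g x))^2) \<in> borel_measurable M"
      using assms(1) by measurable
    show "AE x in M. norm ((cmod (g x))^2) \<le> norm (h x)"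
      by (rule always_eventually) (use assms(3) in \<open>auto intro: order_trans[OF _ abs_ge_self]\<close>)
  qed
  then show ?thesis
    using assms(1) by (simp add: square_integrable_def)
qed

lemma square_integrable_mult:
  assumes "square_integrable M f" "square_integrable M g"
  shows "integrable M (\<lambda>x. f x * g x)"
proof (rule Bochner_Integration.integrable_bound)
  show "integrable M (\<lambda>x. (cmod (f x))^2 + (cmod (g x))^2)"
    using assms by (auto simp: square_integrable_def)
  show "(\<lambda>x. f x * g x) \<in> borel_measurable M"
    using assms by (auto simp: square_integrable_def)
  have le: "a * b \<le> a^2 + b^2" for a b :: real
    using sum_squares_bound[of a b] zero_le_power2[of a] zero_le_power2[of b]
      zero_le_power2[of "a - b"] zero_le_power2[of "a + b"]
    unfolding power2_sum power2_diff by linarith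
  show "AE x in M. norm (f x * g x) \<le> norm ((cmod (f x))^2 + (cmod (g x))^2)"
    by (rule always_eventually) (use le in \<open>simp add: norm_mult\<close>)
qed

lemma borel_measurable_cnj [measurable (raw)]:
  assumes "f \<in> borel_measurable M"
  shows "(\<lambda>x. cnj (f x)) \<in> borel_measurable M"
proof -
  have "continuous_on UNIV cnj" by (intro continuous_intros)
  from measurable_compose[OF assms borel_measurable_continuous_onI[OF this]] show ?thesis .
qed

lemma square_integrable_cnj: "square_integrable M f \<Longrightarrow> square_integrable M (\<lambda>x. cnj (f x))"
  by (simp add: square_integrable_def borel_measurable_cnj)

lemma square_integrable_inner:
  "square_integrable M f \<Longrightarrow> square_integrable M g \<Longrightarrow> integrable M (\<lambda>x. f x * cnj (g x))"
  by (intro square_integrable_mult square_integrable_cnj)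

lemma square_integrable_dominated:
  assumes f: "square_integrable M f" and g: "g \<in> borel_measurable M"
    and le: "\<And>x. cmod (g x) \<le> c * cmod (f x)"
  shows "square_integrable M g"
proof (rule square_integrable_bound[OF g])
  show "integrable M (\<lambda>x. c^2 * (cmod (f x))^2)"
    using f by (simp add: square_integrable_def)
  show "(cmod (g x))^2 \<le> c^2 * (cmod (f x))^2" for x
    using power_mono[OF le[of x], of 2] by (simp add: power_mult_distrib)
qed

lemma cmod_add_power2_le: "(cmod (a + b))^2 \<le> 2 * (cmod a)^2 + 2 * (cmod b)^2"
proof -
  have "(cmod (a + b))^2 \<le> (cmod a + cmod b)^2"
    by (rule power_mono) (simp_all add: norm_triangle_ineq)
  also have "\<dots> \<le> 2 * (cmod a)^2 + 2 * (cmod b)^2"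
    using sum_squares_bound[of "cmod a" "cmod b"] by (simp add: power2_sum)
  finally show ?thesis .
qed

lemma square_integrable_lin:
  assumes "square_integrable M f" "square_integrable M g"
  shows "square_integrable M (\<lambda>x. f x + c * g x)"
proof (rule square_integrable_bound)
  show "integrable M (\<lambda>x. 2 * (cmod (f x))^2 + 2 * ((cmod c)^2 * (cmod (g x))^2))"
    using assms by (auto simp: square_integrable_def)
  show "(\<lambda>x. f x + c * g x) \<in> borel_measurable M"
    using assms by (auto simp: square_integrable_def)
  show "(cmod (f x + c * g x))^2 \<le> 2 * (cmod (f x))^2 + 2 * ((cmod c)^2 * (cmod (g x))^2)" for x
    using cmod_add_power2_le[of "f x" "c * g x"] by (simp add: norm_mult power_mult_distrib)
qed

lemma square_integrable_diff:
  "square_integrable M f \<Longrightarrow> square_integrable M g \<Longrightarrow> square_integrable M (\<lambda>x. f x - g x)"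
  using square_integrable_lin[of M f g "-1"] by simp

lemma square_integrable_zero: "square_integrable M (\<lambda>x. 0)"
  by (simp add: square_integrable_def)

lemma inner_L2_self: "inner_L2 M f f = complex_of_real (LINT x|M. (cmod (f x))^2)"
proof -
  have "f x * cnj (f x) = complex_of_real ((cmod (f x))^2)" for x
    by (metis complex_norm_square)
  then show ?thesis
    by (simp add: inner_L2_def del: of_real_power)
qed

lemma semi_inner_product_L2: "semi_inner_product {f. square_integrable M f} (inner_L2 M)"
proof
  show "{f. square_integrable M f} \<noteq> {}"
    using square_integrable_zero by blast
  show "(\<lambda>x. u x + c * v x) \<in> {f. square_integrable M f}"
    if "u \<in> {f. square_integrable M f}" "v \<in> {f. square_integrable M f}" for u v c
    using that by (simp add: square_integrable_lin)
  show "inner_L2 M (\<lambda>x. u x + c * v x) w = inner_L2 M u w + c * inner_L2 M v w"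
    if "u \<in> {f. square_integrable M f}" "v \<in> {f. square_integrable M f}" "w \<in> {f. square_integrable M f}"
    for u v w c
  proof -
    have "(LINT x|M. (u x + c * v x) * cnj (w x)) = (LINT x|M. u x * cnj (w x) + c * (v x * cnj (w x)))"
      by (simp add: algebra_simps)
    also have "\<dots> = (LINT x|M. u x * cnj (w x)) + c * (LINT x|M. v x * cnj (w x))"
      using that by (simp add: square_integrable_inner)
    finally show ?thesis by (simp add: inner_L2_def)
  qed
  show "inner_L2 M v u = cnj (inner_L2 M u v)" for u v
    using Bochner_Integration.integral_cnj[of M "\<lambda>x. u x * cnj (v x)"] by (simp add: inner_L2_def mult.commute)
  show "0 \<le> Re (inner_L2 M u u)" for u
    by (simp add: inner_L2_self)
qed

lemma N_L2: "semi_inner_product.N (inner_L2 M) = norm_L2 M"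
  by (rule ext) (simp add: semi_inner_product.N_def[OF semi_inner_product_L2] norm_L2_def inner_L2_self)

lemmas L2_lin_left = semi_inner_product.lin_left[OF semi_inner_product_L2, unfolded mem_Collect_eq]
  and L2_lin_right = semi_inner_product.lin_right[OF semi_inner_product_L2, unfolded mem_Collect_eq]
  and L2_hermitian = semi_inner_product.hermitian[OF semi_inner_product_L2, unfolded mem_Collect_eq]
  and L2_Cauchy_Schwarz = semi_inner_product.Cauchy_Schwarz[OF semi_inner_product_L2, unfolded N_L2 mem_Collect_eq]
  and L2_inner_tendsto = semi_inner_product.inner_tendsto[OF semi_inner_product_L2, unfolded N_L2 mem_Collect_eq]

lemma nn_integral_norm_L2:
  "square_integrable M f \<Longrightarrow> (\<integral>\<^sup>+ x. ennreal ((cmod (f x))^2) \<partial>M) = ennreal ((norm_L2 M f)^2)"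
  by (subst nn_integral_eq_integral) (auto simp: square_integrable_def norm_L2_def)

lemma square_integrableI_nn_integral:
  assumes "f \<in> borel_measurable M" "(\<integral>\<^sup>+ x. ennreal ((cmod (f x))^2) \<partial>M) \<le> ennreal (c^2)" "0 \<le> c"
  shows "square_integrable M f" "norm_L2 M f \<le> c"
proof -
  have "integrable M (\<lambda>x. (cmod (f x))^2)"
  proof (rule integrableI_bounded)
    show "(\<lambda>x. (cmod (f x))^2) \<in> borel_measurable M"
      using assms(1) by measurable
    show "(\<integral>\<^sup>+ x. ennreal (norm ((cmod (f x))^2)) \<partial>M) < \<infinity>"
      using le_less_trans[OF assms(2) ennreal_less_top] by simp
  qed
  then show s: "square_integrable M f"
    using assms(1) by (simp add: square_integrable_def)
  show "norm_L2 M f \<le> c"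
    using assms(2,3) unfolding nn_integral_norm_L2[OF s] by (auto intro: power2_le_imp_le)
qed

text \<open>
  A subsequence whose consecutive distances decay geometrically converges almost everywhere; Fatou's
  lemma then identifies its pointwise limit as the limit in norm.
\<close>

proposition L2_complete:
  assumes sq: "\<And>n. square_integrable M (f n)"
    and cauchy: "\<And>e. e > 0 \<Longrightarrow> \<exists>K. \<forall>m\<ge>K. \<forall>n\<ge>K. norm_L2 M (\<lambda>x. f m x - f n x) < e"
  obtains g where "square_integrable M g" "(\<lambda>n. norm_L2 M (\<lambda>x. f n x - g x)) \<longlonglongrightarrow> 0"
proof -
  note [measurable] = square_integrable_measurable[OF sq]
  have sqd: "square_integrable M (\<lambda>x. f m x - f n x)" for m n
    by (intro square_integrable_diff sq)
  obtain K where K: "\<And>k m n. m \<ge> K k \<Longrightarrow> n \<ge> K k \<Longrightarrow> norm_L2 M (\<lambda>x. f m x - f n x) < (1/2)^k"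
    using cauchy[of "(1/2)^k" for k] by (simp, metis)
\<comment> \<open>Partial sums turn the thresholds \<open>K\<close> into a monotone sequence above them.\<close>
  define r where "r k = (\<Sum>j\<le>k. K j)" for k
  have r_ge: "K k \<le> r k" for k
    unfolding r_def by (simp add: member_le_sum)
  have r_mono: "r k \<le> r (Suc k)" for k
    by (simp add: r_def)
  have K_r: "K j \<le> r k" if "j \<le> k" for j k
    using lift_Suc_mono_le[of r, OF r_mono that] r_ge[of j] by linarith
  define d where "d k x = cmod (f (r (Suc k)) x - f (r k) x)" for k x
  have [measurable]: "d k \<in> borel_measurable M" for k
    unfolding d_def by measurable
  have d_nonneg: "0 \<le> d k x" for k x by (simp add: d_def)
\<comment> \<open>The weights \<open>2^k\<close> are small enough for the sum to be integrable and large enough for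
  its finiteness to imply that \<open>d k x\<close> is summable.\<close>
  have "(\<integral>\<^sup>+ x. (\<Sum>k. ennreal (2^k * (d k x)^2)) \<partial>M) = (\<Sum>k. \<integral>\<^sup>+ x. ennreal (2^k * (d k x)^2) \<partial>M)"
    by (rule nn_integral_suminf) measurable
  also have "\<dots> \<le> (\<Sum>k. ennreal ((1/2)^k))"
  proof (intro suminf_le)
    fix k
    have "norm_L2 M (\<lambda>x. f (r (Suc k)) x - f (r k) x) < (1/2)^k"
      by (rule K) (auto intro: K_r)
    then have "(norm_L2 M (\<lambda>x. f (r (Suc k)) x - f (r k) x))^2 \<le> ((1/2)^k)^2"
      by (intro power_mono) (auto simp: norm_L2_def)
    then have b: "2^k * (norm_L2 M (\<lambda>x. f (r (Suc k)) x - f (r k) x))^2 \<le> 2^k * ((1/2)^k)^2"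
      by simp
    have e: "2^k * ((1/2)^k)^2 = (1/2 :: real)^k"
      by (simp add: power2_eq_square power_divide field_simps)
    have "(\<integral>\<^sup>+ x. ennreal (2^k * (d k x)^2) \<partial>M) = ennreal (2^k) * (\<integral>\<^sup>+ x. ennreal ((d k x)^2) \<partial>M)"
      by (subst nn_integral_cmult[symmetric]) (auto simp: ennreal_mult)
    also have "\<dots> = ennreal (2^k * (norm_L2 M (\<lambda>x. f (r (Suc k)) x - f (r k) x))^2)"
      unfolding d_def nn_integral_norm_L2[OF sqd] by (simp add: ennreal_mult)
    finally show "(\<integral>\<^sup>+ x. ennreal (2^k * (d k x)^2) \<partial>M) \<le> ennreal ((1/2)^k)"
      using b unfolding e by (simp add: ennreal_leI)
  qed auto
  also have "\<dots> = ennreal (\<Sum>k. (1/2)^k)"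
    by (rule suminf_ennreal2) (auto intro: summable_geometric)
  finally have fin: "(\<integral>\<^sup>+ x. (\<Sum>k. ennreal (2^k * (d k x)^2)) \<partial>M) \<noteq> \<infinity>"
    by (auto simp: top_unique)
  have "AE x in M. (\<Sum>k. ennreal (2^k * (d k x)^2)) \<noteq> \<infinity>"
    by (rule nn_integral_noteq_infinite[OF _ fin]) measurable
  then have conv: "AE x in M. convergent (\<lambda>k. f (r k) x)"
  proof eventually_elim
    case (elim x)
    then have "summable (\<lambda>k. 2^k * (d k x)^2)"
      using summable_iff_suminf_neq_top[of "\<lambda>k. 2^k * (d k x)^2"] by auto
    then have s: "summable (\<lambda>k. 2^k * (d k x)^2 + (1/2)^k)"
      by (intro summable_add summable_geometric) auto
    have "norm (f (r (Suc k)) x - f (r k) x) \<le> 2^k * (d k x)^2 + (1/2)^k" for k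
    proof -
      have "0 \<le> (2^k * d k x - 1)^2" by simp
      then have "2 * (2^k * d k x) \<le> 2^k * (2^k * (d k x)^2) + 1"
        by (simp add: power2_diff power2_eq_square algebra_simps)
      then have "2 * d k x \<le> 2^k * (d k x)^2 + (1/2)^k"
        by (simp add: power_divide field_simps)
      then show ?thesis
        using d_nonneg[of k x] unfolding d_def by linarith
    qed
    then have "summable (\<lambda>k. f (r (Suc k)) x - f (r k) x)"
      by (intro summable_comparison_test'[OF s]) auto
    then obtain L where "(\<lambda>n. \<Sum>k<n. f (r (Suc k)) x - f (r k) x) \<longlonglongrightarrow> L"
      by (auto simp: summable_def sums_def)
    then have "(\<lambda>n. f (r n) x - f (r 0) x) \<longlonglongrightarrow> L"
      unfolding sum_lessThan_telescope[of "\<lambda>k. f (r k) x"] .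
    from tendsto_add[OF this tendsto_const[of "f (r 0) x"]] show ?case
      by (auto simp: convergent_def)
  qed
  define g where "g x = lim (\<lambda>k. f (r k) x)" for x
  have [measurable]: "g \<in> borel_measurable M"
    unfolding g_def by measurable
  have lim: "AE x in M. (\<lambda>k. f (r k) x) \<longlonglongrightarrow> g x"
    using conv by eventually_elim (simp add: g_def convergent_LIMSEQ_iff)
  have est: "square_integrable M (\<lambda>x. f n x - g x) \<and> norm_L2 M (\<lambda>x. f n x - g x) \<le> (1/2)^j" if "n \<ge> K j" for n j
  proof -
    have "(\<integral>\<^sup>+ x. ennreal ((cmod (f n x - g x))^2) \<partial>M) \<le> ennreal (((1/2)^j)^2)"
    proof (rule nn_integral_le_of_AE_tendsto[OF _ _ _ tendsto_const])
      show "AE x in M. (\<lambda>k. ennreal ((cmod (f n x - f (r (k + j)) x))^2)) \<longlonglongrightarrow> ennreal ((cmod (f n x - g x))^2)"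
        using lim by eventually_elim (intro tendsto_intros LIMSEQ_ignore_initial_segment)
      show "(\<integral>\<^sup>+ x. ennreal ((cmod (f n x - f (r (k + j)) x))^2) \<partial>M) \<le> ennreal (((1/2)^j)^2)" for k
      proof -
        have "norm_L2 M (\<lambda>x. f n x - f (r (k + j)) x) < (1/2)^j"
          using K[OF \<open>n \<ge> K j\<close>] K_r[of j "k + j"] by simp
        then have "(norm_L2 M (\<lambda>x. f n x - f (r (k + j)) x))^2 \<le> ((1/2)^j)^2"
          by (intro power_mono) (auto simp: norm_L2_def)
        then show ?thesis
          unfolding nn_integral_norm_L2[OF sqd] by (rule ennreal_leI)
      qed
    qed measurable
    then show ?thesis
      by (intro conjI square_integrableI_nn_integral) auto
  qed
  have "square_integrable M g"
    using square_integrable_diff[OF sq conjunct1[OF est[OF order_refl]], of 0 0 ] 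
      square_integrable_diff[OF sq[of "K 0"] conjunct1[OF est[OF order_refl, of 0]]] by simp
  moreover have "(\<lambda>n. norm_L2 M (\<lambda>x. f n x - g x)) \<longlonglongrightarrow> 0"
  proof (rule LIMSEQ_I)
    fix e :: real assume "e > 0"
    then obtain j where j: "(1/2)^j < e"
      using real_arch_pow_inv[of e "1/2"] by auto
    have "norm (norm_L2 M (\<lambda>x. f n x - g x) - 0) < e" if "n \<ge> K j" for n
      using est[OF that] j by (simp add: norm_L2_def)
    then show "\<exists>no. \<forall>n\<ge>no. norm (norm_L2 M (\<lambda>x. f n x - g x) - 0) < e" by blast
  qed
  ultimately show thesis by (rule that)
qed

lemma in_Lp_2: "in_Lp 2 f \<longleftrightarrow> square_integrable lborel f"
  by (simp add: in_Lp_def square_integrable_def)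

lemma Lp_norm_2: "Lp_norm 2 f = norm_L2 lborel f"
  by (simp add: Lp_norm_def norm_L2_def powr_half_sqrt)

lemma L2_inner_eq: "L2_inner = inner_L2 lborel"
  by (intro ext) (simp add: L2_inner_def inner_L2_def)

section \<open>Continuously differentiable functions\<close>

definition C1 :: "(real^3 \<Rightarrow> complex) \<Rightarrow> bool" where
  "C1 f \<longleftrightarrow> (\<forall>x. f differentiable at x) \<and> (\<forall>i. continuous_on UNIV (pderiv3 i f))"

definition C1c :: "(real^3 \<Rightarrow> complex) \<Rightarrow> bool" where
  "C1c f \<longleftrightarrow> C1 f \<and> bounded {x. f x \<noteq> 0}"

text \<open>
  The total derivative of \<open>f\<close> at \<open>x\<close> in direction \<open>h\<close>, written through the partial derivatives so that
  its continuity is evident.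
\<close>

definition ddir :: "(real^3 \<Rightarrow> complex) \<Rightarrow> real^3 \<Rightarrow> real^3 \<Rightarrow> complex" where
  "ddir f x h = (\<Sum>i\<in>UNIV. h $ i *\<^sub>R pderiv3 i f x)"

lemma has_derivative_ddir:
  assumes "f differentiable at x"
  shows "(f has_derivative ddir f x) (at x)"
proof -
  have D: "(f has_derivative frechet_derivative f (at x)) (at x)"
    using assms by (simp add: frechet_derivative_works)
  interpret bounded_linear "frechet_derivative f (at x)"
    using D by (rule has_derivative_bounded_linear)
  have "frechet_derivative f (at x) h = ddir f x h" for h
  proof -
    have "frechet_derivative f (at x) h = frechet_derivative f (at x) (\<Sum>i\<in>UNIV. h $ i *\<^sub>R axis i 1)"
      using basis_expansion[of h] by (simp add: scalar_mult_eq_scaleR)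
    then show ?thesis
      by (simp add: sum scaleR ddir_def pderiv3_def)
  qed
  then show ?thesis
    using D by (metis ext)
qed

lemma pderiv3_eqI: "(f has_derivative F) (at x) \<Longrightarrow> pderiv3 i f x = F (axis i 1)"
  unfolding pderiv3_def by (metis frechet_derivative_at)

lemma C1_has_derivative: "C1 f \<Longrightarrow> (f has_derivative ddir f x) (at x)"
  by (simp add: C1_def has_derivative_ddir)

lemma C1_continuous: "C1 f \<Longrightarrow> continuous_on UNIV f"
  by (meson C1_def differentiable_imp_continuous_within continuous_at_imp_continuous_on)

lemma C1_continuous_pderiv3: "C1 f \<Longrightarrow> continuous_on UNIV (pderiv3 i f)"
  by (simp add: C1_def)

lemma C1_measurable: "C1 f \<Longrightarrow> f \<in> borel_measurable borel"
  by (intro borel_measurable_continuous_onI C1_continuous)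

lemma C1_measurable_pderiv3: "C1 f \<Longrightarrow> pderiv3 i f \<in> borel_measurable borel"
  by (intro borel_measurable_continuous_onI C1_continuous_pderiv3)

lemma C1I:
  assumes "\<And>x. (f has_derivative F x) (at x)" "\<And>i. continuous_on UNIV (\<lambda>x. F x (axis i 1))"
  shows "C1 f"
proof -
  have "pderiv3 i f = (\<lambda>x. F x (axis i 1))" for i
    using assms(1) by (intro ext pderiv3_eqI)
  then show ?thesis
    using assms by (auto simp: C1_def differentiable_def)
qed

lemma ddir_axis: "ddir f x (axis i 1) = pderiv3 i f x"
  by (simp add: ddir_def axis_def if_distrib[where f="\<lambda>c. c *\<^sub>R _"] cong: if_cong)

lemma
  assumes "C1 f" "C1 g"
  shows C1_lin: "C1 (\<lambda>x. f x + c * g x)"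
    and pderiv3_lin: "pderiv3 i (\<lambda>x. f x + c * g x) x = pderiv3 i f x + c * pderiv3 i g x"
proof -
  have D: "((\<lambda>x. f x + c * g x) has_derivative (\<lambda>h. ddir f x h + c * ddir g x h)) (at x)" for x
    by (intro has_derivative_add has_derivative_mult_right C1_has_derivative assms)
  show "C1 (\<lambda>x. f x + c * g x)"
    by (rule C1I[OF D]) (intro continuous_intros, simp_all add: ddir_axis C1_continuous_pderiv3 assms)
  show "pderiv3 i (\<lambda>x. f x + c * g x) x = pderiv3 i f x + c * pderiv3 i g x"
    using pderiv3_eqI[OF D] by (simp add: ddir_axis)
qed

lemma
  assumes "C1 f" "C1 g"
  shows C1_mult: "C1 (\<lambda>x. f x * g x)"
    and pderiv3_mult: "pderiv3 i (\<lambda>x. f x * g x) x = f x * pderiv3 i g x + pderiv3 i f x * g x"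
proof -
  have D: "((\<lambda>x. f x * g x) has_derivative (\<lambda>h. f x * ddir g x h + ddir f x h * g x)) (at x)" for x
    by (intro has_derivative_mult C1_has_derivative assms)
  show "C1 (\<lambda>x. f x * g x)"
    by (rule C1I[OF D]) (intro continuous_intros, simp_all add: ddir_axis C1_continuous_pderiv3 C1_continuous assms)
  show "pderiv3 i (\<lambda>x. f x * g x) x = f x * pderiv3 i g x + pderiv3 i f x * g x"
    using pderiv3_eqI[OF D] by (simp add: ddir_axis)
qed

lemma
  assumes "C1 f"
  shows C1_cnj: "C1 (\<lambda>x. cnj (f x))"
    and pderiv3_cnj: "pderiv3 i (\<lambda>x. cnj (f x)) x = cnj (pderiv3 i f x)"
proof -
  have D: "((\<lambda>x. cnj (f x)) has_derivative (\<lambda>h. cnj (ddir f x h))) (at x)" for x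
    by (intro has_derivative_cnj C1_has_derivative assms)
  show "C1 (\<lambda>x. cnj (f x))"
    by (rule C1I[OF D]) (intro continuous_intros, simp_all add: ddir_axis C1_continuous_pderiv3 assms)
  show "pderiv3 i (\<lambda>x. cnj (f x)) x = cnj (pderiv3 i f x)"
    using pderiv3_eqI[OF D] by (simp add: ddir_axis)
qed

lemma
  assumes "C1 f" "linear L"
  shows C1_comp_linear: "C1 (\<lambda>x. f (L x))"
    and ddir_comp_linear: "ddir (\<lambda>x. f (L x)) x h = ddir f (L x) (L h)"
proof -
  have bl: "bounded_linear L" using assms(2) linear_conv_bounded_linear by blast
  have D: "((\<lambda>x. f (L x)) has_derivative (\<lambda>h. ddir f (L x) (L h))) (at x)" for x
    by (intro has_derivative_compose[OF bounded_linear_imp_has_derivative[OF bl] C1_has_derivative] assms)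
  have cont: "continuous_on UNIV (\<lambda>x. pderiv3 i f (L x))" for i
    by (rule continuous_on_compose2[OF C1_continuous_pderiv3 linear_continuous_on[OF bl]]) (simp_all add: assms)
  show "C1 (\<lambda>x. f (L x))"
    by (rule C1I[OF D]) (unfold ddir_def, intro continuous_intros cont)
  have "((\<lambda>x. f (L x)) has_derivative ddir (\<lambda>x. f (L x)) x) (at x)"
    by (rule C1_has_derivative) fact
  then show "ddir (\<lambda>x. f (L x)) x h = ddir f (L x) (L h)"
    using has_derivative_unique[OF D] by metis
qed

lemma C1_norm_power2: "C1 (\<lambda>x. complex_of_real ((norm x)^2))"
proof -
  have D: "((\<lambda>x. complex_of_real ((norm x)^2)) has_derivative (\<lambda>h. complex_of_real (2 * (x \<bullet> h)))) (at x)" for x :: "real^3"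
    unfolding power2_norm_eq_inner
    by (auto intro!: derivative_eq_intros simp: inner_commute)
  show ?thesis
    by (rule C1I[OF D]) (intro continuous_intros)
qed

lemma C1cD: "C1c f \<Longrightarrow> C1 f"
  by (simp add: C1c_def)

lemma C1c_support:
  assumes "C1c f"
  obtains R where "R > 0" "\<And>x. norm x > R \<Longrightarrow> f x = 0" "\<And>x i. norm x > R \<Longrightarrow> pderiv3 i f x = 0"
proof -
  obtain R where R: "R > 0" "\<And>x. f x \<noteq> 0 \<Longrightarrow> norm x \<le> R"
    using assms unfolding C1c_def bounded_pos by auto
  have z: "f x = 0" if "norm x > R" for x using R(2)[of x] that by fastforce
  have "pderiv3 i f x = 0" if "norm x > R" for x i
  proof -
    have "open {x :: real^3. norm x > R}"
      by (intro open_Collect_less continuous_intros)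
    then have "(f has_derivative (\<lambda>_. 0)) (at x)"
      by (rule has_derivative_transform_within_open[OF has_derivative_const[of 0]]) (use that z in auto)
    then show ?thesis using pderiv3_eqI by metis
  qed
  with z R(1) that show thesis by blast
qed

lemma compact_support_integrable:
  fixes f :: "real^3 \<Rightarrow> 'b :: {banach, second_countable_topology}"
  assumes "continuous_on UNIV f" "\<And>x. norm x > R \<Longrightarrow> f x = 0"
  shows "integrable lborel f"
proof -
  have "integrable lborel (\<lambda>x. indicator (cball 0 R) x *\<^sub>R f x)"
    by (rule borel_integrable_compact) (auto intro: continuous_on_subset[OF assms(1)])
  moreover have "(\<lambda>x. indicator (cball 0 R) x *\<^sub>R f x) = f"
    using assms(2) by (auto simp: indicator_def)
  ultimately show ?thesis by simp
qed

lemma compact_support_bounded: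
  fixes f :: "real^3 \<Rightarrow> complex"
  assumes "continuous_on UNIV f" "\<And>x. norm x > R \<Longrightarrow> f x = 0"
  obtains B where "B > 0" "\<And>x. cmod (f x) \<le> B"
proof -
  have "bounded (f ` cball 0 R)"
    by (intro compact_imp_bounded compact_continuous_image continuous_on_subset[OF assms(1)]) auto
  then obtain B where B: "B > 0" "\<And>x. x \<in> cball 0 R \<Longrightarrow> cmod (f x) \<le> B"
    by (auto simp: bounded_pos)
  have "cmod (f x) \<le> B" for x
    using B(2)[of x] assms(2)[of x] B(1) by (cases "norm x \<le> R") auto
  with B(1) that show thesis by blast
qed

lemma C1c_integrable: "C1c f \<Longrightarrow> integrable lborel f"
  by (metis C1c_support C1_continuous C1cD compact_support_integrable)

lemma C1c_integrable_pderiv3: "C1c f \<Longrightarrow> integrable lborel (pderiv3 i f)"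
  by (metis C1c_support C1_continuous_pderiv3 C1cD compact_support_integrable)

lemma compact_support_square_integrable:
  fixes f :: "real^3 \<Rightarrow> complex"
  assumes "continuous_on UNIV f" "\<And>x. norm x > R \<Longrightarrow> f x = 0"
  shows "square_integrable lborel f"
  unfolding square_integrable_def
proof
  show "f \<in> borel_measurable lborel"
    using borel_measurable_continuous_onI[OF assms(1)] by simp
  show "integrable lborel (\<lambda>x. (cmod (f x))^2)"
    by (rule compact_support_integrable[of _ R]) (use assms in \<open>auto intro!: continuous_intros\<close>)
qed

lemma C1c_square_integrable: "C1c f \<Longrightarrow> square_integrable lborel f"
  by (metis C1c_support C1_continuous C1cD compact_support_square_integrable)

lemma C1c_square_integrable_pderiv3: "C1c f \<Longrightarrow> square_integrable lborel (pderiv3 i f)"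
  by (metis C1c_support C1_continuous_pderiv3 C1cD compact_support_square_integrable)

lemma C1c_lin: "C1c f \<Longrightarrow> C1c g \<Longrightarrow> C1c (\<lambda>x. f x + c * g x)"
proof -
  assume f: "C1c f" and g: "C1c g"
  have "bounded ({x. f x \<noteq> 0} \<union> {x. g x \<noteq> 0})"
    using f g by (simp add: C1c_def)
  then have "bounded {x. f x + c * g x \<noteq> 0}"
    by (rule bounded_subset) auto
  then show ?thesis
    using C1_lin[OF C1cD[OF f] C1cD[OF g]] by (simp only: C1c_def)
qed

lemma C1c_mult: "C1 f \<Longrightarrow> C1c g \<Longrightarrow> C1c (\<lambda>x. f x * g x)"
  unfolding C1c_def by (auto intro!: C1_mult elim: bounded_subset)

lemma C1c_cnj: "C1c f \<Longrightarrow> C1c (\<lambda>x. cnj (f x))"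
  unfolding C1c_def by (auto intro!: C1_cnj elim: bounded_subset)

lemma C1c_comp_isometry:
  assumes "C1c f" "linear L" "\<And>x. norm (L x) = norm x"
  shows "C1c (\<lambda>x. f (L x))"
  unfolding C1c_def
proof
  show "C1 (\<lambda>x. f (L x))" by (rule C1_comp_linear[OF C1cD[OF assms(1)] assms(2)])
  obtain R where R: "\<And>x. norm x > R \<Longrightarrow> f x = 0" using C1c_support[OF assms(1)] by metis
  have "norm x \<le> R" if "f (L x) \<noteq> 0" for x
    using R[of "L x"] that assms(3)[of x] by (cases "norm x \<le> R") auto
  then show "bounded {x. f (L x) \<noteq> 0}" by (intro boundedI[of _ R]) simp
qed

lemma C1_along_curve:
  assumes "C1 f" "(\<gamma> has_vector_derivative v) (at t within S)"
  shows "((\<lambda>t. f (\<gamma> t)) has_vector_derivative ddir f (\<gamma> t) v) (at t within S)"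
proof -
  have "(\<gamma> has_derivative (\<lambda>h. h *\<^sub>R v)) (at t within S)"
    using assms(2) by (simp add: has_vector_derivative_def)
  from has_derivative_compose[OF this C1_has_derivative[OF assms(1)]]
  have "((\<lambda>t. f (\<gamma> t)) has_derivative (\<lambda>h. ddir f (\<gamma> t) (h *\<^sub>R v))) (at t within S)" .
  moreover have "ddir f (\<gamma> t) (h *\<^sub>R v) = h *\<^sub>R ddir f (\<gamma> t) v" for h
    by (simp add: ddir_def scaleR_sum_right)
  ultimately show ?thesis by (simp add: has_vector_derivative_def)
qed

lemma continuous_on_ddir:
  assumes "C1 f" "continuous_on S p" "continuous_on S v"
  shows "continuous_on S (\<lambda>t. ddir f (p t) (v t))"
proof -
  have "continuous_on S (\<lambda>t. pderiv3 i f (p t))" for i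
    by (rule continuous_on_compose2[OF C1_continuous_pderiv3 assms(2)]) (simp_all add: assms)
  then show ?thesis
    unfolding ddir_def by (intro continuous_intros assms)
qed

lemma C1_FTC:
  assumes "C1 f" "a \<le> b" "\<And>t. (\<gamma> has_vector_derivative v t) (at t)" "continuous_on {a..b} v"
  shows "(LINT t|lborel. indicator {a..b} t *\<^sub>R ddir f (\<gamma> t) (v t)) = f (\<gamma> b) - f (\<gamma> a)"
proof (rule integral_FTC_Icc[OF assms(2)])
  show "((\<lambda>t. f (\<gamma> t)) has_vector_derivative ddir f (\<gamma> t) (v t)) (at t within {a..b})" for t
    by (intro C1_along_curve assms has_vector_derivative_at_within)
  have "continuous_on {a..b} \<gamma>"
    using assms(3) by (meson continuous_at_imp_continuous_on has_vector_derivative_continuous)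
  then show "continuous_on {a..b} (\<lambda>t. ddir f (\<gamma> t) (v t))"
    by (intro continuous_on_ddir assms)
qed

lemma integral_translate:
  fixes f :: "real^3 \<Rightarrow> complex"
  assumes "f \<in> borel_measurable borel"
  shows "(LINT x|lborel. f (c + x)) = (LINT x|lborel. f x)"
  using integral_distr[of "(+) c" lborel borel f] assms by (simp add: lborel_distr_plus)

lemma integral_scale:
  fixes f :: "real^3 \<Rightarrow> complex"
  assumes [measurable]: "f \<in> borel_measurable borel" and "s > 0"
  shows "(LINT x|lborel. f (s *\<^sub>R x)) = (1 / s^3) *\<^sub>R (LINT x|lborel. f x)"
    and "integrable lborel f \<Longrightarrow> integrable lborel (\<lambda>x. f (s *\<^sub>R x))"
proof -
  have eq: "lborel = density (distr lborel borel (\<lambda>x. s *\<^sub>R x :: real^3)) (\<lambda>_. ennreal (s^3))"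
    using lborel_affine[of s "0 :: real^3"] assms(2) by simp
  have "(LINT x|lborel. f x) = (LINT x|density (distr lborel borel (\<lambda>x. s *\<^sub>R x :: real^3)) (\<lambda>_. ennreal (s^3)). f x)"
    using eq by simp
  also have "\<dots> = (LINT x|distr lborel borel (\<lambda>x. s *\<^sub>R x :: real^3). s^3 *\<^sub>R f x)"
    by (subst integral_density) (use assms(2) in auto)
  also have "\<dots> = s^3 *\<^sub>R (LINT x|lborel. f (s *\<^sub>R x))"
    by (subst integral_distr) auto
  finally show "(LINT x|lborel. f (s *\<^sub>R x)) = (1 / s^3) *\<^sub>R (LINT x|lborel. f x)"
    using assms(2) by simp
  assume "integrable lborel f"
  then have "integrable (density (distr lborel borel (\<lambda>x. s *\<^sub>R x :: real^3)) (\<lambda>_. ennreal (s^3))) f"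
    using eq by simp
  then have "integrable (distr lborel borel (\<lambda>x. s *\<^sub>R x :: real^3)) (\<lambda>x. s^3 *\<^sub>R f x)"
    by (subst (asm) integrable_density) (use assms(2) in auto)
  then have "integrable lborel (\<lambda>x. s^3 *\<^sub>R f (s *\<^sub>R x))"
    by (subst (asm) integrable_distr_eq) auto
  then show "integrable lborel (\<lambda>x. f (s *\<^sub>R x))"
    using assms(2) integrable_scaleR_right[of "1 / s^3" lborel "\<lambda>x. s^3 *\<^sub>R f (s *\<^sub>R x)"] by simp
qed

text \<open>
  Integration by parts, from translation invariance: the difference \<open>f (x + e) - f x\<close> has integral \<open>0\<close> and
  is the integral of the partial derivative along a segment of length one.
\<close>

lemma integral_pderiv3_eq_0:
  assumes "C1c f"
  shows "(LINT x|lborel. pderiv3 i f x) = 0"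
proof -
  have C: "C1 f" using assms by (rule C1cD)
  note [measurable] = C1_measurable[OF C] C1_measurable_pderiv3[OF C]
  obtain R where R: "\<And>x i. norm x > R \<Longrightarrow> pderiv3 i f x = 0" using C1c_support[OF assms] by metis
  have ftc: "(LINT t|lborel. indicator {0..1} t *\<^sub>R pderiv3 i f (t *\<^sub>R axis i 1 + x)) = f (axis i 1 + x) - f x" for x
  proof -
    have "((\<lambda>t. t *\<^sub>R axis i 1 + x) has_vector_derivative axis i 1) (at t)" for t
      by (auto intro!: derivative_eq_intros)
    from C1_FTC[OF C _ this, of 0 1] show ?thesis by (simp add: ddir_axis)
  qed
  let ?G = "\<lambda>(x, t). indicator {0..1} t *\<^sub>R pderiv3 i f (t *\<^sub>R axis i 1 + x)"
  have "integrable (lborel :: ((real^3) \<times> real) measure)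
      (\<lambda>p. indicator (cball 0 (R + 1) \<times> {0..1}) p *\<^sub>R pderiv3 i f (snd p *\<^sub>R axis i 1 + fst p))"
    by (rule borel_integrable_compact)
      (auto intro!: compact_Times continuous_on_compose2[OF C1_continuous_pderiv3[OF C]] continuous_intros)
  also have "(\<lambda>p. indicator (cball 0 (R + 1) \<times> {0..1}) p *\<^sub>R pderiv3 i f (snd p *\<^sub>R axis i 1 + fst p)) = ?G"
  proof (intro ext, clarify)
    fix x :: "real^3" and t :: real
    show "indicator (cball 0 (R + 1) \<times> {0..1}) (x, t) *\<^sub>R pderiv3 i f (snd (x, t) *\<^sub>R axis i 1 + fst (x, t))
        = indicator {0..1} t *\<^sub>R pderiv3 i f (t *\<^sub>R axis i 1 + x)"
    proof (cases "t \<in> {0..1} \<and> norm x > R + 1")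
      case True
      have "norm (t *\<^sub>R axis i 1 :: real^3) \<le> 1" using True by simp
      then have "norm (t *\<^sub>R axis i 1 + x) > R"
        using norm_triangle_ineq4[of "t *\<^sub>R axis i 1 + x" "t *\<^sub>R axis i 1"] True by simp
      then show ?thesis using R by simp
    qed (auto simp: indicator_def)
  qed
  finally have int: "integrable (lborel \<Otimes>\<^sub>M lborel) ?G"
    by (simp add: lborel_prod)
  have "0 = (LINT x|lborel. f (axis i 1 + x) - f x)"
    using integral_translate[of f "axis i 1"] C1c_integrable[OF assms]
      integrable_distr_eq[of "(+) (axis i 1)" lborel borel f]
    by (simp add: lborel_distr_plus)
  also have "\<dots> = (LINT x|lborel. LINT t|lborel. indicator {0..1} t *\<^sub>R pderiv3 i f (t *\<^sub>R axis i 1 + x))"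
    by (simp only: ftc)
  also have "\<dots> = (LINT t|lborel. LINT x|lborel. indicator {0..1} t *\<^sub>R pderiv3 i f (t *\<^sub>R axis i 1 + x))"
    using lborel_pair.Fubini_integral[OF int] by simp
  also have "\<dots> = (LINT t|lborel. indicator {0..1::real} t *\<^sub>R (LINT x|lborel. pderiv3 i f x))"
    by (rule Bochner_Integration.integral_cong[OF refl])
      (simp only: integral_scaleR_right integral_translate[OF C1_measurable_pderiv3[OF C]])
  also have "\<dots> = (LINT x|lborel. pderiv3 i f x)"
    by (subst integral_scaleR_left) simp_all
  finally show ?thesis by (rule sym)
qed

section \<open>The ground state representation of the form\<close>

text \<open>
  Integrability criterion for functions dominated by a series of multiples of indicators of balls. It serves
  both the singularity \<open>|x|\<^sup>-\<^sup>2\<close> and the decay of Schwartz functions at infinity.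
\<close>

lemma nn_integral_finite_if_ball_series:
  fixes h :: "real^3 \<Rightarrow> ennreal"
  assumes le: "\<And>x. h x \<le> (\<Sum>k. ennreal (a k) * indicator (cball 0 (r k)) x)"
    and a: "\<And>k. 0 \<le> a k" and r: "\<And>k. 0 \<le> r k" and sum: "summable (\<lambda>k. a k * r k ^ 3)"
  shows "(\<integral>\<^sub>+x. h x) < \<infinity>"
proof -
  define c where "c = unit_ball_vol (real DIM(real^3))"
  have c: "c \<ge> 0" by (simp add: c_def)
  have "(\<integral>\<^sub>+x. h x) \<le> (\<integral>\<^sub>+x::real^3. (\<Sum>k. ennreal (a k) * indicator (cball 0 (r k)) x))"
    by (intro nn_integral_mono le)
  also have "\<dots> = (\<Sum>k. \<integral>\<^sub>+x::real^3. ennreal (a k) * indicator (cball 0 (r k)) x)"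
    by (rule nn_integral_suminf)
      (intro borel_measurable_times_ennreal borel_measurable_indicator, simp_all)
  also have "\<dots> = (\<Sum>k. ennreal (c * (a k * r k ^ 3)))"
  proof (intro arg_cong[where f=suminf] ext)
    fix k
    have "(\<integral>\<^sub>+x::real^3. ennreal (a k) * indicator (cball 0 (r k)) x) = ennreal (a k) * ennreal (c * r k ^ 3)"
      using emeasure_cball[of "r k" "0 :: real^3"] r[of k]
      by (subst nn_integral_cmult_indicator) (auto simp: c_def)
    then show "(\<integral>\<^sub>+x::real^3. ennreal (a k) * indicator (cball 0 (r k)) x) = ennreal (c * (a k * r k ^ 3))"
      using a[of k] by (simp add: ennreal_mult'[symmetric] mult_ac)
  qed
  also have "\<dots> = ennreal (\<Sum>k. c * (a k * r k ^ 3))"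
    by (rule suminf_ennreal2) (use a r c sum in \<open>auto intro: summable_mult\<close>)
  also have "\<dots> < \<infinity>" by simp
  finally show ?thesis .
qed

lemma inverse_square_integrable:
  assumes "R > 0"
  shows "integrable lborel (\<lambda>x::real^3. indicator (cball 0 R) x * (1 / (norm x)^2))"
proof (rule integrableI_bounded)
  show "(\<lambda>x::real^3. indicator (cball 0 R) x * (1 / (norm x)^2)) \<in> borel_measurable lborel"
    by (intro borel_measurable_times borel_measurable_indicator borel_measurable_divide
        borel_measurable_power borel_measurable_norm) simp_all
  have le: "ennreal (norm (indicator (cball 0 R) x * (1 / (norm x)^2)))
      \<le> (\<Sum>k. ennreal (4^(k+1) / R^2) * indicator (cball 0 (R / 2^k)) x)" for x :: "real^3"
  proof (cases "x \<noteq> 0 \<and> norm x \<le> R")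
    case True
\<comment> \<open>The dyadic shell that contains \<open>x\<close>.\<close>
    obtain n where n: "R / 2^n < norm x"
      using real_arch_pow_inv[of "norm x / R" "1/2"] True assms
      by (auto simp: field_simps power_divide)
    have "\<not> R / 2^0 < norm x" using True by simp
    with n obtain k where k: "k < n" "\<forall>i\<le>k. \<not> R / 2^i < norm x" "R / 2^(Suc k) < norm x"
      using ex_least_nat_less[of "\<lambda>n. R / 2^n < norm x" n] by auto
    have "(R / 2^(Suc k))^2 \<le> (norm x)^2"
      using k(3) assms by (intro power_mono) auto
    then have "1 / (norm x)^2 \<le> 1 / (R / 2^(Suc k))^2"
      using assms by (intro divide_left_mono) (use True in \<open>auto intro!: mult_pos_pos\<close>)
    also have "\<dots> = 4^(k+1) / R^2"
    proof -
      have "((2::real)^(Suc k))^2 = 4^(k+1)"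
        by (metis Suc_eq_plus1 power_even_eq power_mult num_double numeral_times_numeral power2_eq_square power_commutes)
      then show ?thesis by (simp add: power_divide)
    qed
    finally have "ennreal (norm (indicator (cball 0 R) x * (1 / (norm x)^2)))
        \<le> ennreal (4^(k+1) / R^2) * indicator (cball 0 (R / 2^k)) x"
      using True k(2) by (auto intro!: ennreal_leI simp: not_less)
    also have "\<dots> = (\<Sum>j\<in>{k}. ennreal (4^(j+1) / R^2) * indicator (cball 0 (R / 2^j)) x)"
      by (subst sum.insert) simp_all
    also have "\<dots> \<le> (\<Sum>j. ennreal (4^(j+1) / R^2) * indicator (cball 0 (R / 2^j)) x)"
      by (rule sum_le_suminf) auto
    finally show ?thesis .
  qed auto
  show "(\<integral>\<^sub>+x::real^3. ennreal (norm (indicator (cball 0 R) x * (1 / (norm x)^2)))) < \<infinity>"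
  proof (rule nn_integral_finite_if_ball_series[OF le])
    have "4^(k+1) / R^2 * (R / 2^k)^3 = (4 * R) * (1/2)^k" for k
    proof -
      have "(2::real)^k * 2^k = 4^k" by (simp add: power_mult_distrib[symmetric])
      then have "(4::real)^k / ((2^k) * (2^k) * (2^k)) = 1 / 2^k" by simp
      then show ?thesis
        using assms by (simp add: power_divide power2_eq_square power3_eq_cube field_simps)
    qed
    then show "summable (\<lambda>k. 4^(k+1) / R^2 * (R / 2^k)^3)"
      by (simp only:) (intro summable_mult summable_geometric, simp)
  qed (use assms in simp_all)
qed

lemma compact_support_integrable_inverse_square:
  fixes g :: "real^3 \<Rightarrow> complex"
  assumes g: "continuous_on UNIV g" and R: "\<And>x. norm x > R \<Longrightarrow> g x = 0"
  shows "integrable lborel (\<lambda>x. g x / complex_of_real ((norm x)^2))"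
proof -
  obtain B where B: "B > 0" "\<And>x. cmod (g x) \<le> B"
    using compact_support_bounded[OF assms] by blast
  have [measurable]: "g \<in> borel_measurable borel"
    using g by (rule borel_measurable_continuous_onI)
  show ?thesis
  proof (rule Bochner_Integration.integrable_bound)
    show "integrable lborel (\<lambda>x::real^3. B * (indicator (cball 0 (max R 1)) x * (1 / (norm x)^2)))"
      by (intro integrable_mult_right inverse_square_integrable) auto
    show "(\<lambda>x. g x / complex_of_real ((norm x)^2)) \<in> borel_measurable lborel"
      by measurable
    have "norm (g x / complex_of_real ((norm x)^2)) \<le> norm (B * (indicator (cball 0 (max R 1)) x * (1 / (norm x)^2)))" for x
    proof (cases "norm x > max R 1")
      case False
      then show ?thesis
        using B by (auto simp: norm_divide norm_power divide_right_mono)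
    qed (use R in auto)
    then show "AE x in lborel. norm (g x / complex_of_real ((norm x)^2))
        \<le> norm (B * (indicator (cball 0 (max R 1)) x * (1 / (norm x)^2)))"
      by simp
  qed
qed

lemma continuous_on_ddir_self: "C1 w \<Longrightarrow> continuous_on UNIV (\<lambda>x. ddir w x x)"
  by (rule continuous_on_ddir) (auto intro: continuous_on_id)

lemma
  assumes "C1c w"
  shows C1c_integrable_inverse_square: "integrable lborel (\<lambda>x. w x / complex_of_real ((norm x)^2))"
    and C1c_integrable_radial: "integrable lborel (\<lambda>x. ddir w x x / complex_of_real ((norm x)^2))"
proof -
  obtain R where R: "\<And>x. norm x > R \<Longrightarrow> w x = 0" "\<And>x i. norm x > R \<Longrightarrow> pderiv3 i w x = 0"
    using C1c_support[OF assms] by metis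
  show "integrable lborel (\<lambda>x. w x / complex_of_real ((norm x)^2))"
    by (rule compact_support_integrable_inverse_square[of _ R]) (simp_all add: R C1_continuous C1cD assms)
  show "integrable lborel (\<lambda>x. ddir w x x / complex_of_real ((norm x)^2))"
    by (rule compact_support_integrable_inverse_square[of _ R])
      (simp_all add: R C1cD assms continuous_on_ddir_self, simp add: ddir_def R)
qed

text \<open>
  This is the identity \<open>\<integral> div (w x / |x|\<^sup>2) = 0\<close>, as \<open>div (x / |x|\<^sup>2) = 1 / |x|\<^sup>2\<close> in three dimensions.
  The singular divergence theorem is avoided by scaling: \<open>w (2 x) - w x\<close> is the integral of the radial derivative
  along the segment from \<open>x\<close> to \<open>2 x\<close>, and each side of the resulting equation is
  homogeneous under dilations.
\<close>

proposition integral_inverse_square_eq_radial: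
  assumes "C1c w"
  shows "(LINT x|lborel. w x / complex_of_real ((norm x)^2))
    = - (LINT x|lborel. ddir w x x / complex_of_real ((norm x)^2))"
proof -
  have C: "C1 w" using assms by (rule C1cD)
  define W where "W x = w x / complex_of_real ((norm x)^2)" for x
  define K where "K x = ddir w x x / complex_of_real ((norm x)^2)" for x
  have iW: "integrable lborel W" and iK: "integrable lborel K"
    unfolding W_def K_def by (rule C1c_integrable_inverse_square C1c_integrable_radial assms)+
  have [measurable]: "W \<in> borel_measurable borel" "K \<in> borel_measurable borel"
    using iW iK by auto
  have ftc: "(LINT s|lborel. indicator {1..2} s *\<^sub>R (s *\<^sub>R K (s *\<^sub>R x))) = 4 * W (2 *\<^sub>R x) - W x" for x
  proof -
    have "((\<lambda>s. s *\<^sub>R x) has_vector_derivative x) (at t)" for t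
      by (auto intro!: derivative_eq_intros)
    from C1_FTC[OF C _ this, of 1 2]
    have "(LINT s|lborel. indicator {1..2} s *\<^sub>R ddir w (s *\<^sub>R x) x) = w (2 *\<^sub>R x) - w x" by simp
    moreover have "indicator {1..2} s *\<^sub>R (s *\<^sub>R K (s *\<^sub>R x))
        = (indicator {1..2} s *\<^sub>R ddir w (s *\<^sub>R x) x) / complex_of_real ((norm x)^2)" for s :: real
    proof (cases "s \<in> {1..2}")
      case True
      define d where "d = ddir w (s *\<^sub>R x) x"
      have "ddir w (s *\<^sub>R x) (s *\<^sub>R x) = s *\<^sub>R d"
        by (simp add: ddir_def d_def scaleR_sum_right)
      then have "K (s *\<^sub>R x) = s *\<^sub>R d / complex_of_real (s^2 * (norm x)^2)"
        by (simp add: K_def power_mult_distrib)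
      then show ?thesis
        unfolding d_def[symmetric] using True by (simp add: scaleR_conv_of_real power2_eq_square)
    qed simp
    ultimately have "(LINT s|lborel. indicator {1..2} s *\<^sub>R (s *\<^sub>R K (s *\<^sub>R x)))
        = (w (2 *\<^sub>R x) - w x) / complex_of_real ((norm x)^2)"
      by (simp only: integral_divide_zero)
    also have "\<dots> = 4 * W (2 *\<^sub>R x) - W x"
      by (simp add: W_def power_mult_distrib diff_divide_distrib)
    finally show ?thesis .
  qed
  let ?G = "\<lambda>(s, x). indicator {1..2} s *\<^sub>R (s *\<^sub>R K (s *\<^sub>R x))"
  have int: "integrable (lborel \<Otimes>\<^sub>M lborel) ?G"
  proof (rule lborel_pair.Fubini_integrable)
    show "?G \<in> borel_measurable (lborel \<Otimes>\<^sub>M lborel)" by measurable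
    have iKs: "integrable lborel (\<lambda>x. K (s *\<^sub>R x))" if "s \<in> {1..2}" for s
      using integral_scale(2)[of K s] iK that by simp
    show "AE s in lborel. integrable lborel (\<lambda>x. ?G (s, x))"
    proof (rule always_eventually, rule allI)
      fix s show "integrable lborel (\<lambda>x. ?G (s, x))"
        using iKs[of s] by (cases "s \<in> {1..2}") auto
    qed
    have "(LINT x|lborel. norm (?G (s, x))) = indicator {1..2} s *\<^sub>R (1 / s^2 * (LINT x|lborel. cmod (K x)))" for s
    proof (cases "s \<in> {1..2}")
      case True
      have "complex_of_real (LINT x|lborel. cmod (K (s *\<^sub>R x))) = (1 / s^3) *\<^sub>R complex_of_real (LINT x|lborel. cmod (K x))"
        using integral_scale(1)[of "\<lambda>x. complex_of_real (cmod (K x))" s] True by simp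
      then have "(LINT x|lborel. cmod (K (s *\<^sub>R x))) = (1 / s^3) * (LINT x|lborel. cmod (K x))"
        by (metis of_real_eq_iff of_real_mult scaleR_conv_of_real)
      then show ?thesis
        using True by (simp add: power2_eq_square power3_eq_cube)
    qed auto
    moreover have "integrable lborel (\<lambda>s. indicator {1..2::real} s *\<^sub>R (1 / s^2 * (LINT x|lborel. cmod (K x))))"
      by (rule borel_integrable_compact) (auto intro!: continuous_intros)
    ultimately show "integrable lborel (\<lambda>s. LINT x|lborel. norm (?G (s, x)))"
      by simp
  qed
  have "4 * (LINT x|lborel. W (2 *\<^sub>R x)) - (LINT x|lborel. W x) = (LINT x|lborel. 4 * W (2 *\<^sub>R x) - W x)"
    using integral_scale(2)[of W 2] iW by simp
  also have "\<dots> = (LINT x|lborel. LINT s|lborel. indicator {1..2} s *\<^sub>R (s *\<^sub>R K (s *\<^sub>R x)))"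
    by (simp only: ftc)
  also have "\<dots> = (LINT s|lborel. LINT x|lborel. indicator {1..2} s *\<^sub>R (s *\<^sub>R K (s *\<^sub>R x)))"
    using lborel_pair.Fubini_integral[OF int] by simp
  also have "\<dots> = (LINT s|lborel. (indicator {1..2::real} s *\<^sub>R (1 / s^2)) *\<^sub>R (LINT x|lborel. K x))"
  proof (rule Bochner_Integration.integral_cong[OF refl])
    fix s :: real
    show "(LINT x|lborel. indicator {1..2} s *\<^sub>R (s *\<^sub>R K (s *\<^sub>R x))) = (indicator {1..2} s *\<^sub>R (1 / s^2)) *\<^sub>R (LINT x|lborel. K x)"
      using integral_scale(1)[of K s] by (cases "s \<in> {1..2}") (auto simp: power2_eq_square power3_eq_cube)
  qed
  also have "\<dots> = (LINT s|lborel. indicator {1..2::real} s *\<^sub>R (1 / s^2)) *\<^sub>R (LINT x|lborel. K x)"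
    by (rule integral_scaleR_left) (rule borel_integrable_compact, auto intro!: continuous_intros)
  also have "(LINT s|lborel. indicator {1..2::real} s *\<^sub>R (1 / s^2)) = - 1 / 2 - - 1 / 1"
  proof (rule integral_FTC_Icc)
    show "((\<lambda>s. - 1 / s) has_vector_derivative 1 / s^2) (at s within {1..2})" if "1 \<le> s" "s \<le> 2" for s :: real
      using that unfolding has_real_derivative_iff_has_vector_derivative[symmetric]
      by (auto intro!: derivative_eq_intros simp: power2_eq_square)
    show "continuous_on {1..2::real} (\<lambda>s. 1 / s^2)"
      by (auto intro!: continuous_intros)
  qed simp
  also have "(LINT x|lborel. W (2 *\<^sub>R x)) = (1/8) *\<^sub>R (LINT x|lborel. W x)"
    using integral_scale(1)[of W 2] by simp
  finally have "- (LINT x|lborel. W x) = (LINT x|lborel. K x)"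
    by (simp add: scaleR_conv_of_real algebra_simps)
  then show ?thesis
    unfolding W_def[symmetric] K_def[symmetric] by (metis minus_minus)
qed

text \<open>
  The conjugation of the gradient by the zero-energy solution \<open>|x|\<^sup>-\<^sup>1\<^sup>/\<^sup>2\<close>:
  \<open>T u = |x|\<^sup>-\<^sup>1\<^sup>/\<^sup>2 \<nabla>(|x|\<^sup>1\<^sup>/\<^sup>2 u)\<close>. At the origin the correction vanishes, since division by zero
  gives zero.
\<close>

definition T :: "3 \<Rightarrow> (real^3 \<Rightarrow> complex) \<Rightarrow> real^3 \<Rightarrow> complex" where
  "T i u x = pderiv3 i u x + complex_of_real (x $ i / (2 * (norm x)^2)) * u x"

lemma C1c_square_integrable_inverse:
  assumes "C1c u"
  shows "square_integrable lborel (\<lambda>x. u x / complex_of_real (norm x))"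
proof -
  have "C1c (\<lambda>x. u x * cnj (u x))"
    by (intro C1c_mult C1c_cnj C1cD assms)
  from integrable_norm[OF C1c_integrable_inverse_square[OF this]]
  have "integrable lborel (\<lambda>x. (cmod (u x / complex_of_real (norm x)))^2)"
    by (simp add: norm_divide norm_mult norm_power power_divide power2_eq_square)
  moreover have "(\<lambda>x. u x / complex_of_real (norm x)) \<in> borel_measurable lborel"
    using C1_measurable[OF C1cD[OF assms]] by measurable
  ultimately show ?thesis by (simp add: square_integrable_def)
qed

lemma C1c_square_integrable_T:
  assumes "C1c u"
  shows "square_integrable lborel (T i u)"
proof -
  have m: "u \<in> borel_measurable borel" using C1_measurable[OF C1cD[OF assms]] .
  have "square_integrable lborel (\<lambda>x. complex_of_real (x $ i / (2 * (norm x)^2)) * u x)"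
  proof (rule square_integrable_dominated[OF C1c_square_integrable_inverse[OF assms]])
    show "(\<lambda>x. complex_of_real (x $ i / (2 * (norm x)^2)) * u x) \<in> borel_measurable lborel"
      using m by measurable
    show "cmod (complex_of_real (x $ i / (2 * (norm x)^2)) * u x) \<le> 1 * cmod (u x / complex_of_real (norm x))" for x
    proof (cases "x = 0")
      case False
      have "\<bar>x $ i\<bar> / (2 * (norm x)^2) \<le> 1 / norm x"
        using component_le_norm_cart[of x i] False by (simp add: power2_eq_square divide_simps)
      from mult_right_mono[OF this, of "cmod (u x)"] show ?thesis
        by (simp add: norm_mult norm_divide norm_power)
    qed simp
  qed
  from square_integrable_lin[OF C1c_square_integrable_pderiv3[OF assms, of i] this, of 1]
  show ?thesis by (simp add: T_def[abs_def])
qed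

text \<open>
  Expanding \<open>\<langle>T u, T v\<rangle>\<close> gives the gradient term, half of the radial derivative of \<open>w = u \<cdot> cnj v\<close> over \<open>|x|\<^sup>2\<close>,
  and a quarter of \<open>w / |x|\<^sup>2\<close>; by the previous identity the last two add up to \<open>- w / (4 |x|\<^sup>2)\<close>.
\<close>

proposition Qform_eq_T:
  assumes "C1c u" "C1c v"
  shows "Qform u v = (\<Sum>i\<in>UNIV. inner_L2 lborel (T i u) (T i v))"
proof -
  define w where "w x = u x * cnj (v x)" for x
  have w: "C1c w"
    unfolding w_def by (intro C1c_mult C1c_cnj C1cD assms)
  have dw: "ddir w x x = (\<Sum>i\<in>UNIV. complex_of_real (x $ i) * (pderiv3 i u x * cnj (v x) + u x * cnj (pderiv3 i v x)))" for x
    unfolding ddir_def w_def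
    by (simp add: pderiv3_mult pderiv3_cnj C1_cnj C1cD assms scaleR_conv_of_real add.commute)
  define G where "G x = (\<Sum>i\<in>UNIV. pderiv3 i u x * cnj (pderiv3 i v x))" for x
  define W where "W x = w x / complex_of_real ((norm x)^2)" for x
  define K where "K x = ddir w x x / complex_of_real ((norm x)^2)" for x
  have iG: "integrable lborel G"
    unfolding G_def by (intro Bochner_Integration.integrable_sum square_integrable_inner C1c_square_integrable_pderiv3 assms)
  have iW: "integrable lborel W" and iK: "integrable lborel K"
    unfolding W_def K_def by (rule C1c_integrable_inverse_square C1c_integrable_radial w)+
  have pw: "(\<Sum>i\<in>UNIV. T i u x * cnj (T i v x)) = G x + (1/2) * K x + (1/4) * W x" for x
  proof (cases "x = 0")
    case True
    then show ?thesis by (simp add: T_def G_def K_def W_def)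
  next
    case False
    define n where "n = complex_of_real ((norm x)^2)"
    have n0: "n \<noteq> 0" using False by (simp add: n_def)
    have nn: "(\<Sum>i\<in>UNIV. (complex_of_real (x $ i))^2) = n"
      by (simp add: n_def norm_vec_def L2_set_def sum_nonneg flip: of_real_power of_real_sum)
    have "T i u x * cnj (T i v x) = pderiv3 i u x * cnj (pderiv3 i v x)
        + (1/2) * (complex_of_real (x $ i) * (pderiv3 i u x * cnj (v x) + u x * cnj (pderiv3 i v x)) / n)
        + (1/4) * ((complex_of_real (x $ i))^2 * (w x / n^2))" for i
      unfolding T_def w_def of_real_divide of_real_mult n_def[symmetric] complex_cnj_add complex_cnj_mult
        complex_cnj_divide
      using n0 by (simp add: n_def[symmetric] field_simps power2_eq_square) (simp add: n_def)?
    then have "(\<Sum>i\<in>UNIV. T i u x * cnj (T i v x)) = G x + (1/2) * K x + (1/4) * (n * (w x / n^2))"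
      by (simp only: sum.distrib sum_distrib_left[symmetric] sum_distrib_right[symmetric] sum_divide_distrib[symmetric]
          G_def K_def dw n_def[symmetric] nn)
    also have "n * (w x / n^2) = W x"
      unfolding W_def n_def[symmetric] using n0 by (simp add: power2_eq_square)
    finally show ?thesis .
  qed
  have "(\<Sum>i\<in>UNIV. inner_L2 lborel (T i u) (T i v)) = (LINT x|lborel. (\<Sum>i\<in>UNIV. T i u x * cnj (T i v x)))"
    unfolding inner_L2_def
    by (subst Bochner_Integration.integral_sum) (simp_all add: square_integrable_inner C1c_square_integrable_T assms)
  also have "\<dots> = (LINT x|lborel. G x) + (1/2) * (LINT x|lborel. K x) + (1/4) * (LINT x|lborel. W x)"
    unfolding pw using iG iK iW by simp
  also have "(LINT x|lborel. K x) = - (LINT x|lborel. W x)"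
    using integral_inverse_square_eq_radial[OF w] unfolding W_def[symmetric] K_def[symmetric] by simp
  also have "(LINT x|lborel. G x) + (1/2) * (- (LINT x|lborel. W x)) + (1/4) * (LINT x|lborel. W x)
      = (LINT x|lborel. G x - (1/4) * W x)"
    using iG iW by simp
  also have "\<dots> = Qform u v"
    unfolding Qform_def G_def W_def w_def by (intro Bochner_Integration.integral_cong) simp_all
  finally show ?thesis by simp
qed

section \<open>Rotations and the angular part of the form\<close>

lemma lborel_distr_isometry:
  fixes L :: "real^'n::{finite,wellorder} \<Rightarrow> real^'n::_"
  assumes "linear L" "\<And>x. norm (L x) = norm x"
  shows "distr lborel borel L = lborel"
proof (rule lborel_eqI[symmetric])
  have orth: "orthogonal_transformation L"
    using assms by (simp add: orthogonal_transformation)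
  define L' where "L' = inv L"
  have orth': "orthogonal_transformation L'"
    unfolding L'_def by (rule orthogonal_transformation_inv[OF orth])
  have bij: "bij L" by (rule orthogonal_transformation_bij[OF orth])
  have det: "\<bar>det (matrix L')\<bar> = 1" by (rule orthogonal_transformation_det[OF orth'])
  have lin': "linear L'" using orth' by (simp add: orthogonal_transformation)
  fix l u :: "real^'n::_"
  assume lu: "\<And>b. b \<in> Basis \<Longrightarrow> l \<bullet> b \<le> u \<bullet> b"
  have pre: "L -` box l u = L' ` box l u"
    unfolding L'_def using bij by (simp add: bij_vimage_eq_inv_image)
  have cont: "continuous_on UNIV L"
    by (intro linear_continuous_on linear_conv_bounded_linear[THEN iffD1] assms)
  then have [measurable]: "L \<in> borel_measurable borel" by (rule borel_measurable_continuous_onI)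
  have op: "open (L' ` box l u)"
    unfolding pre[symmetric] by (rule open_vimage[OF open_box cont])
  have lm: "L' ` box l u \<in> lmeasurable"
    by (rule measurable_linear_image[OF lin']) simp
  have "emeasure (distr lborel borel L) (box l u) = emeasure lborel (L' ` box l u)"
    by (subst emeasure_distr) (simp_all add: pre)
  also have "\<dots> = emeasure lebesgue (L' ` box l u)"
    using op by simp
  also have "\<dots> = ennreal (measure lebesgue (L' ` box l u))"
    using lm by (simp add: emeasure_eq_measure2)
  also have "measure lebesgue (L' ` box l u) = measure lebesgue (box l u)"
    using measure_linear_image[OF lin', of "box l u"] det by simp
  also have "ennreal (measure lebesgue (box l u)) = ennreal (\<Prod>b\<in>Basis. (u - l) \<bullet> b)"
    using lu by (simp add: measure_lborel_box_eq)
  finally show "emeasure (distr lborel borel L) (box l u) = ennreal (\<Prod>b\<in>Basis. (u - l) \<bullet> b)" .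
qed simp

lemma nn_integral_isometry:
  fixes L :: "real^'n::{finite,wellorder} \<Rightarrow> real^'n::_"
  assumes L: "linear L" "\<And>x. norm (L x) = norm x" and f: "f \<in> borel_measurable borel"
  shows "(\<integral>\<^sub>+x. f (L x)) = (\<integral>\<^sub>+x. f x)"
proof -
  have "L \<in> borel_measurable borel"
    by (intro borel_measurable_continuous_onI linear_continuous_on linear_conv_bounded_linear[THEN iffD1] L)
  then have "(\<integral>\<^sup>+ x. f x \<partial>distr lborel borel L) = (\<integral>\<^sub>+x. f (L x))"
    using f by (intro nn_integral_distr) simp_all
  then show ?thesis
    by (simp add: lborel_distr_isometry[OF L])
qed

text \<open>
  Rotation by the angle \<open>t\<close> about the axis \<open>n\<close> (Rodrigues' formula).
\<close>

definition rot :: "real^3 \<Rightarrow> real \<Rightarrow> real^3 \<Rightarrow> real^3" where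
  "rot n t x = cos t *\<^sub>R x + ((1 - cos t) * (n \<bullet> x)) *\<^sub>R n + sin t *\<^sub>R cross3 n x"

lemma linear_rot: "linear (rot n t)"
  by (rule linearI)
    (simp_all add: rot_def inner_add_right cross_add_right cross_mult_right algebra_simps)

lemma norm_rot:
  assumes "norm n = 1"
  shows "norm (rot n t x) = norm x"
proof -
  define p where "p = n \<bullet> x"
  have nn: "n \<bullet> n = 1" using assms by (simp add: norm_eq_1)
  have cr: "cross3 n x \<bullet> cross3 n x = x \<bullet> x - p^2"
    using norm_cross[of n x] assms by (simp add: power2_norm_eq_inner p_def)
  have "rot n t x \<bullet> rot n t x = (cos t)^2 * (x \<bullet> x) + (1 - cos t)^2 * p^2 + 2 * cos t * (1 - cos t) * p^2
      + (sin t)^2 * (x \<bullet> x - p^2)"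
    unfolding rot_def p_def[symmetric]
    by (simp add: inner_add_left inner_add_right dot_cross_self nn cr inner_commute[of x n] p_def[symmetric])
      (simp add: power2_eq_square algebra_simps)
  also have "\<dots> = x \<bullet> x"
    unfolding sin_squared_eq by (simp add: power2_eq_square algebra_simps)
  finally show ?thesis
    by (simp add: norm_eq_sqrt_inner)
qed

lemma rot_0: "rot n 0 x = x"
  by (simp add: rot_def)

lemma rot_has_vector_derivative:
  assumes "norm n = 1"
  shows "((\<lambda>t. rot n t x) has_vector_derivative cross3 n (rot n t x)) (at t)"
proof -
  have nn: "n \<bullet> n = 1" using assms by (simp add: norm_eq_1)
  have cc: "cross3 n (cross3 n x) = (n \<bullet> x) *\<^sub>R n - x"
    using Lagrange[of n n x] nn by simp
  have "cross3 n (rot n t x)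
      = cos t *\<^sub>R cross3 n x + ((1 - cos t) * (n \<bullet> x)) *\<^sub>R cross3 n n + sin t *\<^sub>R cross3 n (cross3 n x)"
    by (simp only: rot_def cross_add_right cross_mult_right)
  then have eq: "cross3 n (rot n t x) = - sin t *\<^sub>R x + (sin t * (n \<bullet> x)) *\<^sub>R n + cos t *\<^sub>R cross3 n x"
    by (simp add: cc algebra_simps)
  show ?thesis
    unfolding eq unfolding rot_def by (auto intro!: derivative_eq_intros simp: algebra_simps)
qed

definition energy_density :: "(real^3 \<Rightarrow> complex) \<Rightarrow> real^3 \<Rightarrow> real" where
  "energy_density u x = (\<Sum>i\<in>UNIV. (cmod (T i u x))^2)"

abbreviation energy :: "(real^3 \<Rightarrow> complex) \<Rightarrow> ennreal" where
  "energy u \<equiv> (\<integral>\<^sub>+x. ennreal (energy_density u x))"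

lemma energy_density_nonneg: "0 \<le> energy_density u x"
  by (simp add: energy_density_def sum_nonneg)

lemma T_measurable:
  assumes "C1 u"
  shows "T i u \<in> borel_measurable borel"
proof -
  note [measurable] = C1_measurable[OF assms] C1_measurable_pderiv3[OF assms]
  show ?thesis unfolding T_def[abs_def] by measurable
qed

lemma energy_density_measurable: "C1 u \<Longrightarrow> energy_density u \<in> borel_measurable borel"
proof -
  assume "C1 u"
  note [measurable] = T_measurable[OF this]
  show ?thesis unfolding energy_density_def[abs_def] by measurable
qed

lemma sum_T_direction:
  "(\<Sum>i\<in>UNIV. complex_of_real (h $ i) * T i u x) = ddir u x h + complex_of_real ((h \<bullet> x) / (2 * (norm x)^2)) * u x"
proof -
  have "(\<Sum>i\<in>UNIV. complex_of_real (h $ i) * T i u x)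
      = ddir u x h + (\<Sum>i\<in>UNIV. complex_of_real (h $ i * x $ i / (2 * (norm x)^2))) * u x"
    by (simp add: T_def ddir_def distrib_left sum.distrib sum_distrib_right scaleR_conv_of_real mult.assoc)
  also have "(\<Sum>i\<in>UNIV. complex_of_real (h $ i * x $ i / (2 * (norm x)^2))) = complex_of_real ((h \<bullet> x) / (2 * (norm x)^2))"
    by (simp add: inner_vec_def sum_divide_distrib)
  finally show ?thesis .
qed

lemma cmod_sum_le:
  fixes h :: "real^3" and z :: "3 \<Rightarrow> complex"
  shows "(cmod (\<Sum>i\<in>UNIV. complex_of_real (h $ i) * z i))^2 \<le> (norm h)^2 * (\<Sum>i\<in>UNIV. (cmod (z i))^2)"
proof -
  have "cmod (\<Sum>i\<in>UNIV. complex_of_real (h $ i) * z i) \<le> (\<Sum>i\<in>UNIV. \<bar>h $ i\<bar> * \<bar>cmod (z i)\<bar>)"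
    by (rule sum_norm_le) (simp add: norm_mult)
  also have "\<dots> \<le> L2_set (\<lambda>i. h $ i) UNIV * L2_set (\<lambda>i. cmod (z i)) UNIV"
    by (rule L2_set_mult_ineq)
  finally have "(cmod (\<Sum>i\<in>UNIV. complex_of_real (h $ i) * z i))^2
      \<le> (L2_set (\<lambda>i. h $ i) UNIV * L2_set (\<lambda>i. cmod (z i)) UNIV)^2"
    by (intro power_mono) auto
  then show ?thesis
    by (simp add: power_mult_distrib norm_vec_def L2_set_def sum_nonneg)
qed

text \<open>
  The rotation field \<open>n \<times> y\<close> is orthogonal to \<open>y\<close>, so the radial correction in \<open>T\<close> contributes
  nothing in its direction.
\<close>

lemma angular_derivative_le:
  assumes "norm n = 1"
  shows "(cmod (ddir u y (cross3 n y)))^2 \<le> (norm y)^2 * energy_density u y"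
proof -
  have eq: "ddir u y (cross3 n y) = (\<Sum>i\<in>UNIV. complex_of_real (cross3 n y $ i) * T i u y)"
    unfolding sum_T_direction by (simp add: dot_cross_self)
  have "(norm (cross3 n y))^2 \<le> (norm y)^2"
    using norm_cross[of n y] assms by simp
  then show ?thesis
    unfolding eq energy_density_def
    by (intro order_trans[OF cmod_sum_le] mult_right_mono sum_nonneg) auto
qed

text \<open>
  The fundamental theorem of calculus along the orbit of \<open>x\<close>, followed by the Cauchy-Schwarz inequality. Division
  by \<open>|x|\<^sup>2\<close> cancels the squared speed of the flow.
\<close>

lemma rotation_difference_pointwise:
  assumes u: "C1 u" and n: "norm n = 1" and "0 \<le> \<theta>"
  shows "ennreal ((cmod (u (rot n \<theta> x) - u x))^2 / (norm x)^2)
    \<le> ennreal \<theta> * (\<integral>\<^sub>+t. indicator {0..\<theta>} t * ennreal (energy_density u (rot n t x)))"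
    (is "_ \<le> _ * ?I")
proof (cases "x = 0")
  case False
  define g where "g t = ddir u (rot n t x) (cross3 n (rot n t x))" for t
  have cr: "continuous_on S (\<lambda>t. rot n t x)" for S
    unfolding rot_def by (intro continuous_intros)
  have cc: "continuous_on S (\<lambda>t. cross3 n (rot n t x))" for S
    by (intro continuous_on_cross continuous_intros cr)
  have cg: "continuous_on S g" for S
    unfolding g_def by (intro continuous_on_ddir u cr cc)
  have ftc: "(LINT t|lborel. indicator {0..\<theta>} t *\<^sub>R g t) = u (rot n \<theta> x) - u x"
    using C1_FTC[OF u \<open>0 \<le> \<theta>\<close> rot_has_vector_derivative[OF n, of x] cc] by (simp add: g_def rot_0)
  have int: "integrable lborel (\<lambda>t. indicator {0..\<theta>} t *\<^sub>R g t)"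
    by (rule borel_integrable_compact) (auto intro: cg)
  have [measurable]: "g \<in> borel_measurable borel" by (rule borel_measurable_continuous_onI[OF cg])
  have [measurable]: "(\<lambda>t. rot n t x) \<in> borel_measurable borel" by (rule borel_measurable_continuous_onI[OF cr])
  note [measurable] = energy_density_measurable[OF u]
  have "ennreal (cmod (u (rot n \<theta> x) - u x)) \<le> (\<integral>\<^sub>+t. ennreal (norm (indicator {0..\<theta>} t *\<^sub>R g t)))"
    unfolding ftc[symmetric] by (rule integral_norm_bound_ennreal[OF int])
  also have "\<dots> = (\<integral>\<^sub>+t. indicator {0..\<theta>} t * (indicator {0..\<theta>} t * ennreal (cmod (g t))))"
    by (intro nn_integral_cong) (auto simp: indicator_def)
  finally have "(ennreal (cmod (u (rot n \<theta> x) - u x)))^2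
      \<le> (\<integral>\<^sub>+t. indicator {0..\<theta>} t * (indicator {0..\<theta>} t * ennreal (cmod (g t))))^2"
    by (intro power_mono) auto
  also have "\<dots> \<le> (\<integral>\<^sub>+t. (indicator {0..\<theta>} t)^2) * (\<integral>\<^sub>+t. (indicator {0..\<theta>} t * ennreal (cmod (g t)))^2)"
    by (rule Cauchy_Schwarz_nn_integral) measurable
  also have "(\<integral>\<^sub>+t. (indicator {0..\<theta>} t)^2) = (\<integral>\<^sub>+t. indicator {0..\<theta>} t)"
    by (intro nn_integral_cong) (auto simp: indicator_def)
  also have "\<dots> = ennreal \<theta>"
    using \<open>0 \<le> \<theta>\<close> by simp
  also have "(\<integral>\<^sub>+t. (indicator {0..\<theta>} t * ennreal (cmod (g t)))^2)
      \<le> (\<integral>\<^sub>+t. ennreal ((norm x)^2) * (indicator {0..\<theta>} t * ennreal (energy_density u (rot n t x))))"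
  proof (rule nn_integral_mono)
    fix t
    show "(indicator {0..\<theta>} t * ennreal (cmod (g t)))^2
        \<le> ennreal ((norm x)^2) * (indicator {0..\<theta>} t * ennreal (energy_density u (rot n t x)))"
      using angular_derivative_le[OF n, of u "rot n t x"] energy_density_nonneg[of u "rot n t x"]
      by (cases "t \<in> {0..\<theta>}") (auto simp: g_def norm_rot[OF n] ennreal_power ennreal_mult[symmetric] intro!: ennreal_leI)
  qed
  also have "\<dots> = ennreal ((norm x)^2) * ?I"
    by (rule nn_integral_cmult) measurable
  finally have le: "ennreal ((cmod (u (rot n \<theta> x) - u x))^2)
      \<le> ennreal \<theta> * (ennreal ((norm x)^2) * ?I)"
    by (simp add: ennreal_power mult_left_mono)
  have "ennreal ((cmod (u (rot n \<theta> x) - u x))^2 / (norm x)^2)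
      = ennreal (1 / (norm x)^2) * ennreal ((cmod (u (rot n \<theta> x) - u x))^2)"
    by (simp add: ennreal_mult[symmetric])
  also have "\<dots> \<le> ennreal (1 / (norm x)^2) * (ennreal \<theta> * (ennreal ((norm x)^2) * ?I))"
    by (intro mult_left_mono le) simp
  also have "\<dots> = (ennreal (1 / (norm x)^2) * ennreal ((norm x)^2)) * (ennreal \<theta> * ?I)"
    by (simp only: mult_ac)
  also have "ennreal (1 / (norm x)^2) * ennreal ((norm x)^2) = 1"
    using False by (simp add: ennreal_mult[symmetric])
  finally show ?thesis by simp
qed simp

text \<open>
  For a general \<open>u\<close> the left-hand side with \<open>u\<close> in place of the difference is not bounded by the energy: Hardy's
  inequality with the critical constant has no remainder of this kind. Subtracting a rotated copy removes the
  radial part, which causes the failure.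
\<close>

proposition rotation_difference_hardy:
  assumes u: "C1 u" and n: "norm n = 1" and "0 \<le> \<theta>"
  shows "(\<integral>\<^sub>+x. ennreal ((cmod (u (rot n \<theta> x) - u x))^2 / (norm x)^2))
    \<le> ennreal (\<theta>^2) * energy u"
proof -
  note [measurable] = energy_density_measurable[OF u]
  have "(\<lambda>p. rot n (fst p) (snd p)) \<in> borel_measurable (borel :: (real \<times> (real^3)) measure)"
    unfolding rot_def by (intro borel_measurable_continuous_onI continuous_intros continuous_on_cross)
  then have [measurable]: "(\<lambda>p. rot n (fst p) (snd p)) \<in> borel_measurable (borel \<Otimes>\<^sub>M borel)"
    by (simp add: borel_prod)
  have m: "(\<lambda>(x, t). indicator {0..\<theta>} t * ennreal (energy_density u (rot n t x))) \<in> borel_measurable (lborel \<Otimes>\<^sub>M lborel)"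
  proof -
    have "(\<lambda>p. rot n (snd p) (fst p)) \<in> borel_measurable (borel :: ((real^3) \<times> real) measure)"
      unfolding rot_def by (intro borel_measurable_continuous_onI continuous_intros continuous_on_cross)
    then have [measurable]: "(\<lambda>p. rot n (snd p) (fst p)) \<in> borel_measurable (lborel \<Otimes>\<^sub>M lborel)"
      by (simp add: lborel_prod)
    show ?thesis unfolding case_prod_beta by measurable
  qed
  have "(\<integral>\<^sub>+x. ennreal ((cmod (u (rot n \<theta> x) - u x))^2 / (norm x)^2))
      \<le> (\<integral>\<^sub>+x. ennreal \<theta> * (\<integral>\<^sub>+t. indicator {0..\<theta>} t * ennreal (energy_density u (rot n t x))))"
    by (intro nn_integral_mono rotation_difference_pointwise assms)
  also have "\<dots> = ennreal \<theta> * (\<integral>\<^sub>+x. \<integral>\<^sub>+t. indicator {0..\<theta>} t * ennreal (energy_density u (rot n t x)))"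
    using m by (intro nn_integral_cmult lborel.borel_measurable_nn_integral)
  also have "(\<integral>\<^sub>+x. \<integral>\<^sub>+t. indicator {0..\<theta>} t * ennreal (energy_density u (rot n t x)))
      = (\<integral>\<^sub>+t. \<integral>\<^sub>+x. indicator {0..\<theta>} t * ennreal (energy_density u (rot n t x)))"
    by (rule lborel_pair.Fubini'[OF m, symmetric])
  also have "\<dots> = (\<integral>\<^sub>+t. indicator {0..\<theta>} t * energy u)"
  proof (rule nn_integral_cong)
    fix t
    have "(\<integral>\<^sub>+x. ennreal (energy_density u (rot n t x))) = energy u"
      by (rule nn_integral_isometry[OF linear_rot norm_rot[OF n]]) measurable
    then show "(\<integral>\<^sub>+x. indicator {0..\<theta>} t * ennreal (energy_density u (rot n t x)))
        = indicator {0..\<theta>} t * energy u"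
      by (cases "t \<in> {0..\<theta>}") simp_all
  qed
  also have "\<dots> = ennreal \<theta> * energy u"
    using \<open>0 \<le> \<theta>\<close> by (simp add: nn_integral_multc)
  finally show ?thesis
    using \<open>0 \<le> \<theta>\<close> by (simp add: power2_eq_square ennreal_mult mult.assoc)
qed

text \<open>
  \<open>T (u \<circ> L)\<close> at \<open>x\<close> is \<open>T u\<close> at \<open>L x\<close>, read in the orthonormal frame formed by the images of the
  coordinate vectors under \<open>L\<close>; a change of frame preserves the sum of squares.
\<close>

lemma energy_density_comp_isometry:
  assumes u: "C1 u" and L: "linear L" "\<And>x. norm (L x) = norm x"
  shows "energy_density (\<lambda>x. u (L x)) x = energy_density u (L x)"
proof -
  have orth: "orthogonal_transformation L"
    using L by (simp add: orthogonal_transformation)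
  have sum_sq: "(\<Sum>i\<in>UNIV. (L (axis i 1) \<bullet> a)^2) = (norm a)^2" for a :: "real^3"
  proof -
    obtain b where b: "a = L b"
      using orthogonal_transformation_surj[OF orth] by blast
    have "L (axis i 1) \<bullet> L b = b $ i" for i
      using orth by (simp add: orthogonal_transformation_def inner_axis')
    then show ?thesis
      unfolding b L(2) by (simp add: norm_vec_def L2_set_def sum_nonneg)
  qed
  have Ti: "T i (\<lambda>x. u (L x)) x = (\<Sum>j\<in>UNIV. complex_of_real (L (axis i 1) $ j) * T j u (L x))" for i
  proof -
    have "L (axis i 1) \<bullet> L x = x $ i"
      using orth by (simp add: orthogonal_transformation_def inner_axis')
    moreover have "T i (\<lambda>x. u (L x)) x
        = ddir u (L x) (L (axis i 1)) + complex_of_real (x $ i / (2 * (norm x)^2)) * u (L x)"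
      by (simp only: T_def ddir_axis[symmetric] ddir_comp_linear[OF u L(1)])
    ultimately show ?thesis
      unfolding sum_T_direction by (simp add: L(2))
  qed
  define a where "a = (\<chi> j. Re (T j u (L x)))"
  define b where "b = (\<chi> j. Im (T j u (L x)))"
  have "(cmod (T i (\<lambda>x. u (L x)) x))^2 = (L (axis i 1) \<bullet> a)^2 + (L (axis i 1) \<bullet> b)^2" for i
    unfolding Ti cmod_power2 by (simp add: a_def b_def inner_vec_def)
  then have "energy_density (\<lambda>x. u (L x)) x = (norm a)^2 + (norm b)^2"
    by (simp add: energy_density_def sum.distrib sum_sq)
  also have "\<dots> = energy_density u (L x)"
    by (simp add: energy_density_def a_def b_def norm_vec_def L2_set_def sum_nonneg cmod_power2 sum.distrib)
  finally show ?thesis .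
qed

text \<open>
  The gradient of the difference \<open>w\<close> differs from \<open>T w\<close> by a multiple of \<open>w / |x|\<close>. The energy of \<open>w\<close> is
  at most four times that of \<open>u\<close> by rotation invariance, and \<open>w / |x|\<close> is controlled by the previous proposition.
\<close>

proposition rotation_difference_gradient:
  assumes u: "C1 u" and n: "norm n = 1" and "0 \<le> \<theta>"
  shows "(\<integral>\<^sub>+x. ennreal (\<Sum>i\<in>UNIV. (cmod (pderiv3 i (\<lambda>x. u (rot n \<theta> x) - u x) x))^2))
    \<le> ennreal (8 + \<theta>^2) * energy u"
proof -
  define v where "v x = u (rot n \<theta> x)" for x
  define w where "w x = v x - u x" for x
  have v: "C1 v" unfolding v_def by (rule C1_comp_linear[OF u linear_rot])
  have w_eq: "w = (\<lambda>x. v x + (-1) * u x)" by (simp add: w_def fun_eq_iff)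
  have w: "C1 w" unfolding w_eq by (rule C1_lin[OF v u])
  have Tw: "T i w x = T i v x - T i u x" for i x
  proof -
    have "pderiv3 i w x = pderiv3 i v x - pderiv3 i u x"
      using pderiv3_lin[OF v u, of i "-1" x, folded w_eq] by simp
    then show ?thesis by (simp only: T_def w_def right_diff_distrib' add_diff_add)
  qed
  note [measurable] = energy_density_measurable[OF u] C1_measurable[OF w] C1_measurable[OF u]
  have [measurable]: "rot n \<theta> \<in> borel_measurable borel"
    by (intro borel_measurable_continuous_onI linear_continuous_on linear_conv_bounded_linear[THEN iffD1] linear_rot)
  have pw: "(\<Sum>i\<in>UNIV. (cmod (pderiv3 i w x))^2)
      \<le> 4 * energy_density u (rot n \<theta> x) + 4 * energy_density u x + (cmod (w x))^2 / (norm x)^2" for x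
  proof -
    have "(cmod (pderiv3 i w x))^2 \<le> 4 * (cmod (T i v x))^2 + 4 * (cmod (T i u x))^2
        + 2 * ((x $ i)^2 / (4 * (norm x)^4) * (cmod (w x))^2)" for i
    proof -
      have "(cmod (pderiv3 i w x))^2 = (cmod (T i w x + - (complex_of_real (x $ i / (2 * (norm x)^2)) * w x)))^2"
        by (simp add: T_def)
      also have "\<dots> \<le> 2 * (cmod (T i w x))^2 + 2 * (cmod (- (complex_of_real (x $ i / (2 * (norm x)^2)) * w x)))^2"
        by (rule cmod_add_power2_le)
      also have "(cmod (- (complex_of_real (x $ i / (2 * (norm x)^2)) * w x)))^2 = (x $ i)^2 / (4 * (norm x)^4) * (cmod (w x))^2"
        by (simp add: norm_mult norm_divide norm_power power_mult_distrib power_divide flip: power_mult)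
      also have "(cmod (T i w x))^2 \<le> 2 * (cmod (T i v x))^2 + 2 * (cmod (T i u x))^2"
        using cmod_add_power2_le[of "T i v x" "- T i u x"] by (simp add: Tw)
      finally show ?thesis by simp
    qed
    then have "(\<Sum>i\<in>UNIV. (cmod (pderiv3 i w x))^2)
        \<le> (\<Sum>i\<in>UNIV. 4 * (cmod (T i v x))^2 + 4 * (cmod (T i u x))^2 + 2 * ((x $ i)^2 / (4 * (norm x)^4) * (cmod (w x))^2))"
      by (intro sum_mono)
    also have "\<dots> = 4 * energy_density v x + 4 * energy_density u x
        + 2 * ((\<Sum>i\<in>UNIV. (x $ i)^2) / (4 * (norm x)^4) * (cmod (w x))^2)"
      by (simp add: energy_density_def sum.distrib sum_distrib_left sum_distrib_right sum_divide_distrib)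
    also have "(\<Sum>i\<in>UNIV. (x $ i)^2) = (norm x)^2"
      by (simp add: norm_vec_def L2_set_def sum_nonneg)
    also have "2 * ((norm x)^2 / (4 * (norm x)^4) * (cmod (w x))^2) \<le> (cmod (w x))^2 / (norm x)^2"
      by (cases "x = 0") (simp_all add: power2_eq_square power4_eq_xxxx divide_simps)
    also have "energy_density v x = energy_density u (rot n \<theta> x)"
      unfolding v_def by (rule energy_density_comp_isometry[OF u linear_rot norm_rot[OF n]])
    finally show ?thesis by simp
  qed
  have "(\<integral>\<^sub>+x. ennreal (\<Sum>i\<in>UNIV. (cmod (pderiv3 i w x))^2))
      \<le> (\<integral>\<^sub>+x. 4 * ennreal (energy_density u (rot n \<theta> x)) + 4 * ennreal (energy_density u x)
           + ennreal ((cmod (w x))^2 / (norm x)^2))"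
  proof (rule nn_integral_mono)
    fix x
    have "ennreal (\<Sum>i\<in>UNIV. (cmod (pderiv3 i w x))^2)
        \<le> ennreal (4 * energy_density u (rot n \<theta> x) + 4 * energy_density u x + (cmod (w x))^2 / (norm x)^2)"
      by (rule ennreal_leI[OF pw])
    also have "\<dots> = 4 * ennreal (energy_density u (rot n \<theta> x)) + 4 * ennreal (energy_density u x)
           + ennreal ((cmod (w x))^2 / (norm x)^2)"
      by (simp add: energy_density_nonneg ennreal_plus ennreal_mult)
    finally show "ennreal (\<Sum>i\<in>UNIV. (cmod (pderiv3 i w x))^2)
        \<le> 4 * ennreal (energy_density u (rot n \<theta> x)) + 4 * ennreal (energy_density u x)
           + ennreal ((cmod (w x))^2 / (norm x)^2)" .
  qed
  also have "\<dots> = 4 * (\<integral>\<^sub>+x. ennreal (energy_density u (rot n \<theta> x))) + 4 * energy u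
           + (\<integral>\<^sub>+x. ennreal ((cmod (w x))^2 / (norm x)^2))"
    by (simp add: nn_integral_add nn_integral_cmult)
  also have "(\<integral>\<^sub>+x. ennreal (energy_density u (rot n \<theta> x))) = energy u"
    by (rule nn_integral_isometry[OF linear_rot norm_rot[OF n]]) measurable
  also have "(\<integral>\<^sub>+x. ennreal ((cmod (w x))^2 / (norm x)^2)) \<le> ennreal (\<theta>^2) * energy u"
    unfolding w_def v_def by (rule rotation_difference_hardy[OF assms])
  finally have "(\<integral>\<^sub>+x. ennreal (\<Sum>i\<in>UNIV. (cmod (pderiv3 i w x))^2))
      \<le> 4 * energy u + 4 * energy u
        + ennreal (\<theta>^2) * energy u"
    by (simp add: add_left_mono)
  also have "\<dots> = (4 + 4 + ennreal (\<theta>^2)) * energy u"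
    by (simp only: distrib_right)
  also have "4 + 4 + ennreal (\<theta>^2) = ennreal (8 + \<theta>^2)"
    by (simp add: ennreal_plus)
  finally show ?thesis
    unfolding w_def[abs_def] v_def .
qed

section \<open>The Sobolev inequality\<close>

definition ennsqrt :: "ennreal \<Rightarrow> ennreal" where
  "ennsqrt x = (if x = top then top else ennreal (sqrt (enn2real x)))"

lemma ennsqrt_power2: "(ennsqrt x)^2 = x"
  by (cases x) (auto simp: ennsqrt_def ennreal_power power2_eq_square ennreal_top_mult ennreal_mult[symmetric])

lemma ennsqrt_measurable [measurable]: "ennsqrt \<in> borel_measurable borel"
  unfolding ennsqrt_def[abs_def] by measurable

lemma ennreal_power2_le_imp_le:
  fixes a b :: ennreal
  assumes "a^2 \<le> b^2"
  shows "a \<le> b"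
proof (rule ccontr)
  assume "\<not> a \<le> b"
  then have lt: "b < a" by simp
  then obtain s where s: "b = ennreal s" "0 \<le> s" by (cases b) auto
  show False
  proof (cases a)
    case (real r)
    then have "r^2 \<le> s^2" using assms s by (simp add: ennreal_power)
    then have "r \<le> s" using power2_le_imp_le s(2) by blast
    then show False using lt real s by (simp add: ennreal_leI leD)
  next
    case top
    then show False using assms s by (simp add: ennreal_power ennreal_top_eq_mult_iff power2_eq_square top_unique flip: ennreal_mult)
  qed
qed

lemma ennreal_le_ennsqrt: "a^2 \<le> x \<Longrightarrow> a \<le> ennsqrt x"
  by (rule ennreal_power2_le_imp_le) (simp add: ennsqrt_power2)

lemma nn_integral_Cauchy_Schwarz_sqrt:
  assumes "f \<in> borel_measurable M" "g \<in> borel_measurable M"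
  shows "(\<integral>\<^sup>+ x. f x * g x \<partial>M) \<le> ennsqrt (\<integral>\<^sup>+ x. (f x)^2 \<partial>M) * ennsqrt (\<integral>\<^sup>+ x. (g x)^2 \<partial>M)"
  by (rule ennreal_power2_le_imp_le)
    (simp only: power_mult_distrib ennsqrt_power2 Cauchy_Schwarz_nn_integral[OF assms])

text \<open>
  Two applications of the Cauchy-Schwarz inequality: first in \<open>c\<close> for fixed \<open>a, b\<close>, then in \<open>b\<close> and \<open>a\<close>.
\<close>

proposition Loomis_Whitney:
  fixes F G H :: "real \<times> real \<Rightarrow> ennreal"
  assumes [measurable]: "F \<in> borel_measurable (lborel \<Otimes>\<^sub>M lborel)" "G \<in> borel_measurable (lborel \<Otimes>\<^sub>M lborel)"
    "H \<in> borel_measurable (lborel \<Otimes>\<^sub>M lborel)"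
  shows "(\<integral>\<^sub>+a. \<integral>\<^sub>+b. \<integral>\<^sub>+c. F (b, c) * G (a, c) * H (a, b))
    \<le> ennsqrt (\<integral>\<^sub>+b. \<integral>\<^sub>+c. (F (b, c))^2)
      * ennsqrt (\<integral>\<^sub>+a. \<integral>\<^sub>+c. (G (a, c))^2)
      * ennsqrt (\<integral>\<^sub>+a. \<integral>\<^sub>+b. (H (a, b))^2)"
proof -
  define F' where "F' b = ennsqrt (\<integral>\<^sub>+c. (F (b, c))^2)" for b
  define G' where "G' a = ennsqrt (\<integral>\<^sub>+c. (G (a, c))^2)" for a
  define H' where "H' a = ennsqrt (\<integral>\<^sub>+b. (H (a, b))^2)" for a
  have [measurable]: "F' \<in> borel_measurable lborel" "G' \<in> borel_measurable lborel" "H' \<in> borel_measurable lborel"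
    unfolding F'_def G'_def H'_def by measurable
  have in_c: "(\<integral>\<^sub>+c. F (b, c) * G (a, c) * H (a, b)) \<le> G' a * (H (a, b) * F' b)" for a b
  proof -
    have "(\<integral>\<^sub>+c. F (b, c) * G (a, c) * H (a, b)) = (\<integral>\<^sub>+c. F (b, c) * G (a, c)) * H (a, b)"
      by (rule nn_integral_multc) measurable
    also have "\<dots> \<le> (F' b * G' a) * H (a, b)"
      unfolding F'_def G'_def by (intro mult_right_mono nn_integral_Cauchy_Schwarz_sqrt) simp_all
    finally show ?thesis by (simp only: mult_ac)
  qed
  have in_b: "(\<integral>\<^sub>+b. \<integral>\<^sub>+c. F (b, c) * G (a, c) * H (a, b))
      \<le> (G' a * H' a) * ennsqrt (\<integral>\<^sub>+b. \<integral>\<^sub>+c. (F (b, c))^2)" for a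
  proof -
    have "(\<integral>\<^sub>+b. \<integral>\<^sub>+c. F (b, c) * G (a, c) * H (a, b))
        \<le> (\<integral>\<^sub>+b. G' a * (H (a, b) * F' b))"
      by (intro nn_integral_mono in_c)
    also have "\<dots> = G' a * (\<integral>\<^sub>+b. H (a, b) * F' b)"
      by (rule nn_integral_cmult) measurable
    also have "\<dots> \<le> G' a * (H' a * ennsqrt (\<integral>\<^sub>+b. (F' b)^2))"
      unfolding H'_def by (intro mult_left_mono nn_integral_Cauchy_Schwarz_sqrt) simp_all
    finally show ?thesis by (simp add: F'_def ennsqrt_power2 mult.assoc)
  qed
  have "(\<integral>\<^sub>+a. \<integral>\<^sub>+b. \<integral>\<^sub>+c. F (b, c) * G (a, c) * H (a, b))
      \<le> (\<integral>\<^sub>+a. (G' a * H' a) * ennsqrt (\<integral>\<^sub>+b. \<integral>\<^sub>+c. (F (b, c))^2))"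
    by (intro nn_integral_mono in_b)
  also have "\<dots> = (\<integral>\<^sub>+a. G' a * H' a) * ennsqrt (\<integral>\<^sub>+b. \<integral>\<^sub>+c. (F (b, c))^2)"
    by (rule nn_integral_multc) measurable
  also have "\<dots> \<le> (ennsqrt (\<integral>\<^sub>+a. (G' a)^2) * ennsqrt (\<integral>\<^sub>+a. (H' a)^2))
      * ennsqrt (\<integral>\<^sub>+b. \<integral>\<^sub>+c. (F (b, c))^2)"
    by (intro mult_right_mono nn_integral_Cauchy_Schwarz_sqrt) simp_all
  finally show ?thesis
    by (simp only: G'_def H'_def ennsqrt_power2 mult_ac)
qed

lemma borel_measurable_vec3: "(\<lambda>p. vector [fst p, fst (snd p), snd (snd p)] :: real^3) \<in> borel_measurable borel"
proof (rule borel_measurable_continuous_onI)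
  have eq: "(vector [a, b, c] :: real^3) = a *\<^sub>R axis 1 1 + b *\<^sub>R axis 2 1 + c *\<^sub>R axis 3 1" for a b c :: real
    by (simp add: vec_eq_iff forall_3 axis_def)
  show "continuous_on UNIV (\<lambda>p. vector [fst p, fst (snd p), snd (snd p)] :: real^3)"
    unfolding eq by (intro continuous_intros)
qed

lemma measurable_vec3_comp:
  assumes "f \<in> borel_measurable borel" "a \<in> borel_measurable M" "b \<in> borel_measurable M" "c \<in> borel_measurable M"
  shows "(\<lambda>x. f (vector [a x, b x, c x] :: real^3)) \<in> borel_measurable M"
proof -
  have "(\<lambda>x. (a x, b x, c x)) \<in> borel_measurable M"
    using assms(2-4) by (simp add: borel_prod[symmetric])
  from measurable_compose[OF measurable_compose[OF this borel_measurable_vec3] assms(1)]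
  show ?thesis by simp
qed

lemma nn_integral_vec3:
  assumes f: "f \<in> borel_measurable borel"
  shows "(\<integral>\<^sub>+x::real^3. f x) = (\<integral>\<^sub>+a. \<integral>\<^sub>+b. \<integral>\<^sub>+c. f (vector [a, b, c]))"
proof -
  let ?J = "\<lambda>p. vector [fst p, fst (snd p), snd (snd p)] :: real^3"
  let ?P = "lborel :: (real \<times> real \<times> real) measure"
  have J: "?J \<in> ?P \<rightarrow>\<^sub>M borel"
    using borel_measurable_vec3 by simp
  have e2: "emeasure (lborel :: (real \<times> real) measure) (B \<times> C) = emeasure lborel B * emeasure lborel C"
    if "B \<in> sets borel" "C \<in> sets borel" for B C :: "real set"
    using lborel.emeasure_pair_measure_Times[of B lborel C] that by (simp add: lborel_prod)
  have e3: "emeasure ?P (A \<times> D) = emeasure lborel A * emeasure lborel D"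
    if "A \<in> sets borel" "D \<in> sets borel" for A :: "real set" and D :: "(real \<times> real) set"
    using lborel.emeasure_pair_measure_Times[of A lborel D] that by (simp add: lborel_prod)
  have "distr ?P borel ?J = lborel"
  proof (rule lborel_eqI[symmetric])
    fix l u :: "real^3"
    assume lu: "\<And>b. b \<in> Basis \<Longrightarrow> l \<bullet> b \<le> u \<bullet> b"
    have le: "l $ i \<le> u $ i" for i
      using lu[of "axis i 1"] by (simp add: inner_axis axis_in_Basis_iff)
    have pre: "?J -` box l u = {l $ 1<..<u $ 1} \<times> {l $ 2<..<u $ 2} \<times> {l $ 3<..<u $ 3}"
      by (auto simp: mem_box_cart forall_3)
    have s2: "{l $ 2<..<u $ 2} \<times> {l $ 3<..<u $ 3} \<in> sets borel"
      by (intro borel_open open_Times) simp_all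
    have "emeasure (distr ?P borel ?J) (box l u) = emeasure ?P ({l $ 1<..<u $ 1} \<times> {l $ 2<..<u $ 2} \<times> {l $ 3<..<u $ 3})"
      using J by (subst emeasure_distr) (simp_all only: pre sets_lborel borel_open open_box space_lborel space_borel Int_UNIV_right)
    also have "\<dots> = ennreal (u $ 1 - l $ 1) * (ennreal (u $ 2 - l $ 2) * ennreal (u $ 3 - l $ 3))"
      using le[of 1] le[of 2] le[of 3] s2 by (simp add: e3 e2)
    also have "\<dots> = ennreal ((u $ 1 - l $ 1) * ((u $ 2 - l $ 2) * (u $ 3 - l $ 3)))"
      using le[of 1] le[of 2] le[of 3] by (subst ennreal_mult[symmetric], simp, simp)+ simp
    also have "(u $ 1 - l $ 1) * ((u $ 2 - l $ 2) * (u $ 3 - l $ 3)) = (\<Prod>i\<in>UNIV. u $ i - l $ i)"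
      unfolding UNIV_3 by simp
    also have "(\<Prod>i\<in>UNIV. u $ i - l $ i) = (\<Prod>b\<in>Basis. (u - l) \<bullet> b)"
    proof -
      have B: "(Basis :: (real^3) set) = (\<lambda>i. axis i 1) ` UNIV"
        by (auto simp: Basis_vec_def)
      have "inj (\<lambda>i::3. axis i (1::real))"
        by (auto simp: inj_on_def axis_eq_axis)
      then show ?thesis
        unfolding B by (simp add: prod.reindex inner_axis)
    qed
    finally show "emeasure (distr ?P borel ?J) (box l u) = ennreal (\<Prod>b\<in>Basis. (u - l) \<bullet> b)" .
  qed simp
  then have "(\<integral>\<^sub>+x. f x) = (\<integral>\<^sup>+ x. f x \<partial>distr ?P borel ?J)" by simp
  also have "\<dots> = (\<integral>\<^sup>+ p. f (?J p) \<partial>?P)"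
    using f J by (intro nn_integral_distr) simp_all
  also have "\<dots> = (\<integral>\<^sub>+a. \<integral>\<^sub>+q. f (?J (a, q)))"
  proof -
    have "(\<lambda>p. f (?J p)) \<in> borel_measurable (lborel \<Otimes>\<^sub>M lborel)"
      using measurable_compose[OF J f] by (simp only: lborel_prod)
    from lborel.nn_integral_fst[OF this] show ?thesis by (simp only: lborel_prod)
  qed
  also have "\<dots> = (\<integral>\<^sub>+a. \<integral>\<^sub>+b. \<integral>\<^sub>+c. f (?J (a, b, c)))"
  proof (rule nn_integral_cong)
    fix a :: real
    have "(\<lambda>q. f (?J (a, q))) \<in> borel_measurable (lborel \<Otimes>\<^sub>M lborel)"
      unfolding fst_conv snd_conv by (intro measurable_vec3_comp[OF f]) simp_all
    from lborel.nn_integral_fst[OF this]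
    show "(\<integral>\<^sub>+q. f (?J (a, q))) = (\<integral>\<^sub>+b. \<integral>\<^sub>+c. f (?J (a, b, c)))"
      by (simp only: lborel_prod)
  qed
  finally show ?thesis by simp
qed

text \<open>
  The fourth power is chosen so that Loomis-Whitney, applied to its line integrals, produces the sixth
  power of \<open>w\<close> on both sides. As a polynomial in \<open>w\<close> and \<open>cnj w\<close> it is differentiated by the product rule.
\<close>

lemma power4_le_line_integral:
  assumes w: "C1c w"
  shows "ennreal ((cmod (w p))^4)
    \<le> (\<integral>\<^sub>+t. ennreal (4 * (cmod (w (p + t *\<^sub>R axis i 1)))^3 * cmod (pderiv3 i w (p + t *\<^sub>R axis i 1))))"
proof -
  note C = C1cD[OF w]
  obtain R where R: "R > 0" "\<And>x. norm x > R \<Longrightarrow> w x = 0" using C1c_support[OF w] by metis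
  define W where "W x = (w x * cnj (w x)) * (w x * cnj (w x))" for x
  have W: "C1 W" unfolding W_def by (intro C1_mult C1_cnj C)
  have dW: "pderiv3 i W x = 2 * (w x * cnj (w x)) * (w x * cnj (pderiv3 i w x) + pderiv3 i w x * cnj (w x))" for x
    unfolding W_def by (simp add: pderiv3_mult pderiv3_cnj C1_mult C1_cnj C algebra_simps)
  have dW_le: "cmod (pderiv3 i W x) \<le> 4 * (cmod (w x))^3 * cmod (pderiv3 i w x)" for x
  proof -
    define e where "e = w x * cnj (pderiv3 i w x) + pderiv3 i w x * cnj (w x)"
    have "cmod e \<le> 2 * (cmod (w x) * cmod (pderiv3 i w x))"
      unfolding e_def by (rule order_trans[OF norm_triangle_ineq]) (simp add: norm_mult mult.commute)
    from mult_left_mono[OF this, of "2 * (cmod (w x))^2"] show ?thesis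
      unfolding dW e_def[symmetric] by (simp add: norm_mult power2_eq_square power3_eq_cube mult_ac)
  qed
  define M where "M = R + norm p + 1"
  have M: "0 \<le> M" using R by (simp add: M_def)
  have "norm (M *\<^sub>R axis i 1 :: real^3) = M" using M by simp
  then have "norm (p - M *\<^sub>R axis i 1) > R"
    using norm_triangle_ineq2[of "M *\<^sub>R axis i 1" p] by (simp add: M_def norm_minus_commute)
  then have W0: "W (p - M *\<^sub>R axis i 1) = 0" by (simp add: W_def R)
  have "((\<lambda>t. p + t *\<^sub>R axis i 1) has_vector_derivative axis i 1) (at t)" for t
    by (auto intro!: derivative_eq_intros)
  from C1_FTC[OF W _ this, of "-M" 0]
  have ftc: "(LINT t|lborel. indicator {-M..0} t *\<^sub>R pderiv3 i W (p + t *\<^sub>R axis i 1)) = W p"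
    using W0 M by (simp add: ddir_axis)
  have int: "integrable lborel (\<lambda>t. indicator {-M..0} t *\<^sub>R pderiv3 i W (p + t *\<^sub>R axis i 1))"
    by (rule borel_integrable_compact[OF compact_Icc])
      (rule continuous_on_compose2[OF C1_continuous_pderiv3[OF W]], intro continuous_intros, simp)
  have "ennreal (cmod (W p)) \<le> (\<integral>\<^sub>+t. ennreal (norm (indicator {-M..0} t *\<^sub>R pderiv3 i W (p + t *\<^sub>R axis i 1))))"
    using integral_norm_bound_ennreal[OF int] unfolding ftc .
  also have "\<dots> \<le> (\<integral>\<^sub>+t. ennreal (4 * (cmod (w (p + t *\<^sub>R axis i 1)))^3 * cmod (pderiv3 i w (p + t *\<^sub>R axis i 1))))"
  proof (intro nn_integral_mono ennreal_leI)
    fix t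
    show "norm (indicator {-M..0} t *\<^sub>R pderiv3 i W (p + t *\<^sub>R axis i 1))
        \<le> 4 * (cmod (w (p + t *\<^sub>R axis i 1)))^3 * cmod (pderiv3 i w (p + t *\<^sub>R axis i 1))"
      using dW_le[of "p + t *\<^sub>R axis i 1"] by (cases "t \<in> {-M..0}") auto
  qed
  also have "cmod (W p) = (cmod (w p))^4"
    by (simp add: W_def norm_mult power4_eq_xxxx mult.assoc)
  finally show ?thesis .
qed

text \<open>
  The Gagliardo-Nirenberg argument. With \<open>X = \<parallel>w\<parallel>\<^sub>6\<^sup>6\<close> and \<open>D = \<parallel>\<nabla>w\<parallel>\<^sub>2\<^sup>2\<close>, Loomis-Whitney and
  Cauchy-Schwarz give \<open>X\<^sup>2 \<le> (4 X\<^sup>1\<^sup>/\<^sup>2 D\<^sup>1\<^sup>/\<^sup>2)\<^sup>3\<close>, and \<open>X\<close> is finite, so three of its four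
  powers in the square of this inequality cancel.
\<close>

theorem Sobolev_L6:
  assumes w: "C1c w"
  shows "(\<integral>\<^sub>+x. ennreal ((cmod (w x))^6))
    \<le> 4096 * (\<integral>\<^sub>+x. ennreal (\<Sum>i\<in>UNIV. (cmod (pderiv3 i w x))^2))^3"
proof -
  note C = C1cD[OF w]
  note [measurable] = C1_measurable[OF C] C1_measurable_pderiv3[OF C]
  define h where "h i x = ennreal (4 * (cmod (w x))^3 * cmod (pderiv3 i w x))" for i x
  have hm: "h i \<in> borel_measurable borel" for i unfolding h_def[abs_def] by measurable
  define A1 where "A1 q = (\<integral>\<^sub>+t. h 1 (vector [t, fst q, snd q]))" for q
  define A2 where "A2 q = (\<integral>\<^sub>+t. h 2 (vector [fst q, t, snd q]))" for q
  define A3 where "A3 q = (\<integral>\<^sub>+t. h 3 (vector [fst q, snd q, t]))" for q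
  have [measurable]: "A1 \<in> borel_measurable (lborel \<Otimes>\<^sub>M lborel)"
    unfolding A1_def
    by (rule lborel.borel_measurable_nn_integral, unfold case_prod_beta, rule measurable_vec3_comp[OF hm]) measurable
  have [measurable]: "A2 \<in> borel_measurable (lborel \<Otimes>\<^sub>M lborel)"
    unfolding A2_def
    by (rule lborel.borel_measurable_nn_integral, unfold case_prod_beta, rule measurable_vec3_comp[OF hm]) measurable
  have [measurable]: "A3 \<in> borel_measurable (lborel \<Otimes>\<^sub>M lborel)"
    unfolding A3_def
    by (rule lborel.borel_measurable_nn_integral, unfold case_prod_beta, rule measurable_vec3_comp[OF hm]) measurable
  define X where "X = (\<integral>\<^sub>+x. ennreal ((cmod (w x))^6))"
  define D where "D = (\<integral>\<^sub>+x. ennreal (\<Sum>i\<in>UNIV. (cmod (pderiv3 i w x))^2))"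
  have shift: "(\<integral>\<^sub>+t. f (s + t)) = (\<integral>\<^sub>+t. f t)" if "f \<in> borel_measurable borel" for f :: "real \<Rightarrow> ennreal" and s
    using nn_integral_real_affine[OF that, of 1 s] by simp
  have line: "ennreal ((cmod (w (vector [a, b, c])))^4) \<le> A1 (b, c)"
    "ennreal ((cmod (w (vector [a, b, c])))^4) \<le> A2 (a, c)"
    "ennreal ((cmod (w (vector [a, b, c])))^4) \<le> A3 (a, b)" for a b c
  proof -
    have v: "vector [a, b, c] + t *\<^sub>R axis 1 1 = (vector [a + t, b, c] :: real^3)"
      "vector [a, b, c] + t *\<^sub>R axis 2 1 = (vector [a, b + t, c] :: real^3)"
      "vector [a, b, c] + t *\<^sub>R axis 3 1 = (vector [a, b, c + t] :: real^3)" for t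
      by (simp_all add: vec_eq_iff forall_3 axis_def)
    note P = power4_le_line_integral[OF w, of "vector [a, b, c]"]
    have s1: "(\<integral>\<^sub>+t. h 1 (vector [a + t, b, c])) = (\<integral>\<^sub>+t. h 1 (vector [t, b, c]))"
      by (rule shift[of "\<lambda>t. h 1 (vector [t, b, c])"], rule measurable_vec3_comp[OF hm]) simp_all
    have s2: "(\<integral>\<^sub>+t. h 2 (vector [a, b + t, c])) = (\<integral>\<^sub>+t. h 2 (vector [a, t, c]))"
      by (rule shift[of "\<lambda>t. h 2 (vector [a, t, c])"], rule measurable_vec3_comp[OF hm]) simp_all
    have s3: "(\<integral>\<^sub>+t. h 3 (vector [a, b, c + t])) = (\<integral>\<^sub>+t. h 3 (vector [a, b, t]))"
      by (rule shift[of "\<lambda>t. h 3 (vector [a, b, t])"], rule measurable_vec3_comp[OF hm]) simp_all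
    show "ennreal ((cmod (w (vector [a, b, c])))^4) \<le> A1 (b, c)"
      using P[of 1] unfolding v h_def[symmetric] s1 A1_def fst_conv snd_conv .
    show "ennreal ((cmod (w (vector [a, b, c])))^4) \<le> A2 (a, c)"
      using P[of 2] unfolding v h_def[symmetric] s2 A2_def fst_conv snd_conv .
    show "ennreal ((cmod (w (vector [a, b, c])))^4) \<le> A3 (a, b)"
      using P[of 3] unfolding v h_def[symmetric] s3 A3_def fst_conv snd_conv .
  qed
  have six: "ennreal ((cmod (w (vector [a, b, c])))^6) \<le> ennsqrt (A1 (b, c)) * ennsqrt (A2 (a, c)) * ennsqrt (A3 (a, b))" for a b c
  proof -
    have le: "ennreal ((cmod (w (vector [a, b, c])))^2) \<le> ennsqrt y" if "ennreal ((cmod (w (vector [a, b, c])))^4) \<le> y" for y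
      using that by (intro ennreal_le_ennsqrt) (simp add: ennreal_power flip: power_mult)
    have "ennreal ((cmod (w (vector [a, b, c])))^6) = ennreal ((cmod (w (vector [a, b, c])))^2) * ennreal ((cmod (w (vector [a, b, c])))^2) * ennreal ((cmod (w (vector [a, b, c])))^2)"
      by (simp add: ennreal_mult[symmetric] flip: power_add)
    also have "\<dots> \<le> ennsqrt (A1 (b, c)) * ennsqrt (A2 (a, c)) * ennsqrt (A3 (a, b))"
      by (intro mult_mono le line) simp_all
    finally show ?thesis .
  qed
  have "X = (\<integral>\<^sub>+a. \<integral>\<^sub>+b. \<integral>\<^sub>+c. ennreal ((cmod (w (vector [a, b, c])))^6))"
    unfolding X_def by (rule nn_integral_vec3) measurable
  also have "\<dots> \<le> (\<integral>\<^sub>+a. \<integral>\<^sub>+b. \<integral>\<^sub>+c. ennsqrt (A1 (b, c)) * ennsqrt (A2 (a, c)) * ennsqrt (A3 (a, b)))"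
    by (intro nn_integral_mono six)
  also have "\<dots> \<le> ennsqrt (\<integral>\<^sub>+b. \<integral>\<^sub>+c. (ennsqrt (A1 (b, c)))^2)
      * ennsqrt (\<integral>\<^sub>+a. \<integral>\<^sub>+c. (ennsqrt (A2 (a, c)))^2)
      * ennsqrt (\<integral>\<^sub>+a. \<integral>\<^sub>+b. (ennsqrt (A3 (a, b)))^2)"
    by (rule Loomis_Whitney[of "\<lambda>q. ennsqrt (A1 q)" "\<lambda>q. ennsqrt (A2 q)" "\<lambda>q. ennsqrt (A3 q)"]) measurable
  also have "\<dots> = ennsqrt (\<integral>\<^sub>+x. h 1 x) * ennsqrt (\<integral>\<^sub>+x. h 2 x) * ennsqrt (\<integral>\<^sub>+x. h 3 x)"
  proof -
    have "(\<integral>\<^sub>+b. \<integral>\<^sub>+c. A1 (b, c)) = (\<integral>\<^sub>+b. \<integral>\<^sub>+a. \<integral>\<^sub>+c. h 1 (vector [a, b, c]))"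
      unfolding A1_def fst_conv snd_conv
      by (intro nn_integral_cong lborel_pair.Fubini', unfold case_prod_beta, rule measurable_vec3_comp[OF hm]) measurable
    also have "\<dots> = (\<integral>\<^sub>+a. \<integral>\<^sub>+b. \<integral>\<^sub>+c. h 1 (vector [a, b, c]))"
    proof (rule lborel_pair.Fubini')
      have "(\<lambda>x. \<integral>\<^sub>+c. h 1 (vector [fst x, snd x, c])) \<in> borel_measurable (lborel \<Otimes>\<^sub>M lborel)"
        by (rule lborel.borel_measurable_nn_integral, unfold case_prod_beta, rule measurable_vec3_comp[OF hm]) measurable
      then show "(\<lambda>(a, b). \<integral>\<^sub>+c. h 1 (vector [a, b, c])) \<in> borel_measurable (lborel \<Otimes>\<^sub>M lborel)"
        by (simp add: case_prod_beta)
    qed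
    also have "\<dots> = (\<integral>\<^sub>+x. h 1 x)" by (rule nn_integral_vec3[OF hm, symmetric])
    finally have 1: "(\<integral>\<^sub>+b. \<integral>\<^sub>+c. A1 (b, c)) = (\<integral>\<^sub>+x. h 1 x)" .
    have "(\<integral>\<^sub>+a. \<integral>\<^sub>+c. A2 (a, c)) = (\<integral>\<^sub>+a. \<integral>\<^sub>+b. \<integral>\<^sub>+c. h 2 (vector [a, b, c]))"
      unfolding A2_def fst_conv snd_conv
      by (intro nn_integral_cong lborel_pair.Fubini', unfold case_prod_beta, rule measurable_vec3_comp[OF hm]) measurable
    also have "\<dots> = (\<integral>\<^sub>+x. h 2 x)" by (rule nn_integral_vec3[OF hm, symmetric])
    finally have 2: "(\<integral>\<^sub>+a. \<integral>\<^sub>+c. A2 (a, c)) = (\<integral>\<^sub>+x. h 2 x)" .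
    have 3: "(\<integral>\<^sub>+a. \<integral>\<^sub>+b. A3 (a, b)) = (\<integral>\<^sub>+x. h 3 x)"
      unfolding A3_def fst_conv snd_conv by (rule nn_integral_vec3[OF hm, symmetric])
    show ?thesis unfolding ennsqrt_power2 1 2 3 ..
  qed
  also have "\<dots> \<le> ennsqrt (4 * (ennsqrt X * ennsqrt D)) * ennsqrt (4 * (ennsqrt X * ennsqrt D)) * ennsqrt (4 * (ennsqrt X * ennsqrt D))"
  proof -
    have "ennsqrt (\<integral>\<^sub>+x. h i x) \<le> ennsqrt (4 * (ennsqrt X * ennsqrt D))" for i
    proof -
      have "(\<integral>\<^sub>+x. h i x) = 4 * (\<integral>\<^sub>+x. ennreal ((cmod (w x))^3) * ennreal (cmod (pderiv3 i w x)))"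
        by (subst nn_integral_cmult[symmetric])
          (auto intro!: nn_integral_cong simp: h_def ennreal_mult mult.assoc)
      also have "\<dots> \<le> 4 * (ennsqrt (\<integral>\<^sub>+x. (ennreal ((cmod (w x))^3))^2) * ennsqrt (\<integral>\<^sub>+x. (ennreal (cmod (pderiv3 i w x)))^2))"
        by (intro mult_left_mono nn_integral_Cauchy_Schwarz_sqrt) simp_all
      also have "(\<integral>\<^sub>+x. (ennreal ((cmod (w x))^3))^2) = X"
        unfolding X_def by (intro nn_integral_cong) (simp add: ennreal_power flip: power_mult)
      also have "ennsqrt (\<integral>\<^sub>+x. (ennreal (cmod (pderiv3 i w x)))^2) \<le> ennsqrt D"
      proof (rule ennreal_le_ennsqrt, unfold ennsqrt_power2 D_def, rule nn_integral_mono)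
        fix x
        have "(cmod (pderiv3 i w x))^2 \<le> (\<Sum>j\<in>UNIV. (cmod (pderiv3 j w x))^2)"
          by (rule member_le_sum) auto
        then show "(ennreal (cmod (pderiv3 i w x)))^2 \<le> ennreal (\<Sum>i\<in>UNIV. (cmod (pderiv3 i w x))^2)"
          by (simp add: ennreal_power ennreal_leI)
      qed
      finally have "(\<integral>\<^sub>+x. h i x) \<le> 4 * (ennsqrt X * ennsqrt D)"
        by (simp add: mult_left_mono)
      then show ?thesis
        by (intro ennreal_le_ennsqrt) (simp add: ennsqrt_power2)
    qed
    then show ?thesis by (intro mult_mono) simp_all
  qed
  finally have "X^2 \<le> (ennsqrt (4 * (ennsqrt X * ennsqrt D)) * ennsqrt (4 * (ennsqrt X * ennsqrt D)) * ennsqrt (4 * (ennsqrt X * ennsqrt D)))^2"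
    by (intro power_mono) auto
  then have "X^2 \<le> (4 * (ennsqrt X * ennsqrt D))^3"
    by (simp only: power_mult_distrib ennsqrt_power2) (simp add: power3_eq_cube mult_ac)
  then have "(X^2)^2 \<le> ((4 * (ennsqrt X * ennsqrt D))^3)^2"
    by (intro power_mono) auto
  also have "\<dots> = 4096 * (X^3 * D^3)"
  proof -
    have "((4 * (ennsqrt X * ennsqrt D))^3)^2 = ((4 * (ennsqrt X * ennsqrt D))^2)^3"
      by (simp only: power_mult[symmetric] mult.commute)
    also have "\<dots> = (4^2)^3 * (X^3 * D^3)"
      by (simp only: power_mult_distrib ennsqrt_power2)
    finally show ?thesis by simp
  qed
  finally have fin: "X * X^3 \<le> (4096 * D^3) * X^3"
    by (simp add: power2_eq_square power3_eq_cube mult_ac)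
  have "integrable lborel (\<lambda>x. (cmod (w x))^6)"
  proof -
    obtain R where R: "\<And>x. norm x > R \<Longrightarrow> w x = 0" using C1c_support[OF w] by metis
    show ?thesis
      by (rule compact_support_integrable[of _ R]) (use R C1_continuous[OF C] in \<open>auto intro!: continuous_intros\<close>)
  qed
  then have "X < top"
    unfolding X_def by (subst nn_integral_eq_integral) auto
  have "X \<le> 4096 * D^3"
  proof (cases "X = 0")
    case False
    then have "X^3 \<noteq> 0" "X^3 < top" using \<open>X < top\<close> by (auto simp: power_less_top_ennreal)
    then show ?thesis using fin by (metis ennreal_mult_le_mult_iff mult.commute less_irrefl)
  qed simp
  then show ?thesis unfolding X_def D_def .
qed

section \<open>Averages over spheres as averages over rotations\<close>

text \<open>
  Quaternions \<open>q = (q $ 1, qvec q)\<close> parametrise the rotations of space, and multiplication by a unit quaternion is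
  an isometry of \<open>\<real>\<^sup>4\<close>. Lebesgue measure on the unit ball of \<open>\<real>\<^sup>4\<close> therefore induces an invariant measure on
  the rotations, without any construction of Haar measure.
\<close>

definition qvec :: "real^4 \<Rightarrow> real^3" where "qvec q = vector [q $ 2, q $ 3, q $ 4]"

text \<open>
  The quaternion product of \<open>q\<close> with the pure quaternion \<open>y\<close> on the right.
\<close>

definition qmul_pure :: "real^3 \<Rightarrow> real^4 \<Rightarrow> real^4" where
  "qmul_pure y q = (let w = q $ 1 *\<^sub>R y + cross3 (qvec q) y in vector [- (qvec q \<bullet> y), w $ 1, w $ 2, w $ 3])"

text \<open>
  The vector part of \<open>q x q\<^sup>*\<close>, where \<open>q\<^sup>*\<close> is the conjugate quaternion.
\<close>

definition qrot_num :: "real^4 \<Rightarrow> real^3 \<Rightarrow> real^3" where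
  "qrot_num q x = ((q $ 1)^2 - qvec q \<bullet> qvec q) *\<^sub>R x + (2 * (qvec q \<bullet> x)) *\<^sub>R qvec q
     + (2 * q $ 1) *\<^sub>R cross3 (qvec q) x"

definition qrot :: "real^4 \<Rightarrow> real^3 \<Rightarrow> real^3" where
  "qrot q x = (1 / (norm q)^2) *\<^sub>R qrot_num q x"

definition half_turn :: "real^3 \<Rightarrow> real^3 \<Rightarrow> real^3" where
  "half_turn y x = (2 * (y \<bullet> x)) *\<^sub>R y - x"

lemma norm_power2_4: "(norm q)^2 = (q $ 1)^2 + qvec q \<bullet> qvec q" for q :: "real^4"
  by (simp add: norm_vec_def L2_set_def sum_nonneg sum_4 qvec_def inner_vec_def sum_3 power2_eq_square)

lemma vector_4: "(vector [a, b, c, d] :: real^4) $ 1 = a" "(vector [a, b, c, d] :: real^4) $ 2 = b"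
  "(vector [a, b, c, d] :: real^4) $ 3 = c" "(vector [a, b, c, d] :: real^4) $ 4 = d"
  by (simp_all add: vector_def)

lemma qmul_pure_components:
  "qmul_pure y q $ 1 = - (qvec q \<bullet> y)" "qvec (qmul_pure y q) = q $ 1 *\<^sub>R y + cross3 (qvec q) y"
  by (simp_all add: qmul_pure_def Let_def vector_4 qvec_def vec_eq_iff forall_3)

lemma linear_qmul_pure: "linear (qmul_pure y)"
  by (rule linearI)
    (simp_all add: qmul_pure_def Let_def vec_eq_iff forall_4 vector_4 qvec_def cross3_simps)

lemma norm_qmul_pure:
  assumes "norm y = 1"
  shows "norm (qmul_pure y q) = norm q"
proof -
  have yy: "y \<bullet> y = 1" using assms by (simp add: norm_eq_1)
  have "cross3 (qvec q) y \<bullet> cross3 (qvec q) y = qvec q \<bullet> qvec q - (qvec q \<bullet> y)^2"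
    using norm_cross[of "qvec q" y] assms by (simp add: power2_norm_eq_inner)
  then have "(norm (qmul_pure y q))^2 = (norm q)^2"
    unfolding norm_power2_4 qmul_pure_components
    by (simp add: inner_add_left inner_add_right dot_cross_self yy power2_eq_square)
  then show ?thesis by simp
qed

text \<open>
  Conjugation by a product is the composition of conjugations, and conjugation by a pure unit quaternion
  is the half turn about it. Half turns suffice below, because they already act transitively on spheres.
\<close>

lemma qrot_qmul_pure:
  assumes "norm y = 1"
  shows "qrot (qmul_pure y q) x = qrot q (half_turn y x)"
proof -
  have yy: "y $ 1 * y $ 1 + y $ 2 * y $ 2 + y $ 3 * y $ 3 = 1"
    using assms by (simp add: norm_eq_1 inner_vec_def sum_3)
  have "qrot_num (qmul_pure y q) x = qrot_num q ((2 * (y \<bullet> x)) *\<^sub>R y - (y \<bullet> y) *\<^sub>R x)"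
    unfolding qrot_num_def qmul_pure_components
    unfolding vec_eq_iff forall_3 cross3_def inner_vec_def sum_3 vector_add_component vector_minus_component
      vector_scaleR_component vector_3 real_scaleR_def inner_real_def
    by (intro conjI; algebra)
  also have "y \<bullet> y = 1" using assms by (simp add: norm_eq_1)
  finally show ?thesis
    by (simp add: qrot_def norm_qmul_pure[OF assms] half_turn_def)
qed

lemma qrot_eq_rot:
  assumes "q \<noteq> 0"
  obtains n \<theta> where "norm n = 1" "0 \<le> \<theta>" "\<theta> \<le> 4 * pi" "qrot q = rot n \<theta>"
proof -
  define r where "r = norm q"
  have r: "r > 0" using assms by (simp add: r_def)
  define v where "v = qvec q"
  have rr: "r^2 = (q $ 1)^2 + (norm v)^2"
    unfolding r_def v_def norm_power2_4 by (simp add: power2_norm_eq_inner)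
  have "(q $ 1 / r)^2 + (norm v / r)^2 = r^2 / r^2"
    by (simp only: power_divide add_divide_distrib[symmetric] rr[symmetric])
  then have "(q $ 1 / r)^2 + (norm v / r)^2 = 1"
    using r by simp
  from sincos_total_2pi[OF this] obtain t where t: "0 \<le> t" "t < 2 * pi" "q $ 1 / r = cos t" "norm v / r = sin t"
    by metis
  obtain n :: "real^3" where n: "norm n = 1" "v = norm v *\<^sub>R n"
  proof (cases "v = 0")
    case True
    then show ?thesis by (intro that[of "axis 1 1"]) simp_all
  next
    case False
    then show ?thesis by (intro that[of "(1 / norm v) *\<^sub>R v"]) simp_all
  qed
  have a: "q $ 1 = r * cos t" and vn: "v = (r * sin t) *\<^sub>R n"
    using t(3,4) n(2) r by (simp_all add: field_simps)
  have nn: "n \<bullet> n = 1" using n(1) by (simp add: norm_eq_1)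
  have "qrot q x = rot n (2 * t) x" for x
  proof -
    have "qrot q x = (1 / r^2) *\<^sub>R (((r * cos t)^2 - (r * sin t)^2) *\<^sub>R x
        + (2 * ((r * sin t) * (n \<bullet> x))) *\<^sub>R ((r * sin t) *\<^sub>R n) + (2 * (r * cos t)) *\<^sub>R ((r * sin t) *\<^sub>R cross3 n x))"
      unfolding qrot_def qrot_num_def r_def[symmetric] v_def[symmetric] a
      unfolding vn by (simp add: cross_mult_left nn power2_eq_square)
    also have "\<dots> = ((cos t)^2 - (sin t)^2) *\<^sub>R x + (2 * (sin t)^2 * (n \<bullet> x)) *\<^sub>R n + (2 * sin t * cos t) *\<^sub>R cross3 n x"
      using r by (simp add: vec_eq_iff field_simps power2_eq_square)
    also have "\<dots> = rot n (2 * t) x"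
      unfolding rot_def cos_double sin_double using sin_squared_eq[of t] by simp
    finally show ?thesis .
  qed
  then show thesis
    by (intro that[of n "2 * t"]) (use n t in auto)
qed

text \<open>
  The half turn about the bisector of \<open>x\<close> and \<open>z\<close>; if they are opposite, any axis orthogonal to them.
\<close>

lemma half_turn_transitive:
  assumes "norm x = norm z"
  obtains y where "norm y = 1" "half_turn y x = z"
proof (cases "x + z = 0")
  case True
  obtain y :: "real^3" where y: "norm y = 1" "y \<bullet> x = 0"
  proof -
    obtain a :: "real^3" where a: "a \<noteq> 0" "orthogonal x a"
      using orthogonal_to_vector_exists[of x] by auto
    then show thesis
      by (intro that[of "(1 / norm a) *\<^sub>R a"]) (auto simp: orthogonal_def inner_commute)
  qed
  then show thesis
    using True by (intro that[of y]) (auto simp: half_turn_def minus_unique)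
next
  case False
  define s where "s = norm (x + z)"
  have s: "s > 0" using False by (simp add: s_def)
  have ss: "s^2 = 2 * ((x + z) \<bullet> x)"
  proof -
    have "x \<bullet> x = z \<bullet> z" using assms by (simp add: norm_eq)
    then show ?thesis
      unfolding s_def power2_norm_eq_inner by (simp add: inner_add_left inner_add_right inner_commute)
  qed
  have "half_turn ((1 / s) *\<^sub>R (x + z)) x = (2 * ((x + z) \<bullet> x) / s^2) *\<^sub>R (x + z) - x"
    by (simp add: half_turn_def power2_eq_square)
  also have "\<dots> = z" using s unfolding ss[symmetric] by simp
  finally show thesis
    using s by (intro that[of "(1 / s) *\<^sub>R (x + z)"]) (auto simp: s_def)
qed

lemma sgn_measurable: "(sgn :: real^3 \<Rightarrow> real^3) \<in> borel_measurable borel"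
proof -
  have "(sgn :: real^3 \<Rightarrow> real^3) = (\<lambda>x. inverse (norm x) *\<^sub>R x)" by (rule ext) (simp add: sgn_div_norm)
  then show ?thesis by simp
qed

lemma sphere_measure_props [simp]: "sets sphere_measure = sets borel" "space sphere_measure = UNIV"
  by (simp_all add: sphere_measure_def)

abbreviation nn_sphere :: "(real^3 \<Rightarrow> ennreal) \<Rightarrow> ennreal" (binder "\<integral>\<^sub>S" 10)
  where "nn_sphere f \<equiv> nn_integral sphere_measure f"

lemma measurable_sphere_pair:
  assumes "f \<in> borel_measurable ((borel :: 'a::topological_space measure) \<Otimes>\<^sub>M (borel :: (real^3) measure))"
    and "sets M = sets (borel :: 'a measure)"
  shows "f \<in> borel_measurable (M \<Otimes>\<^sub>M sphere_measure)"
proof -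
  have eq: "sets (M \<Otimes>\<^sub>M sphere_measure) = sets ((borel :: 'a measure) \<Otimes>\<^sub>M (borel :: (real^3) measure))"
    using assms(2) by (intro sets_pair_measure_cong) simp_all
  show ?thesis unfolding measurable_cong_sets[OF eq refl] by (rule assms(1))
qed

lemma nn_integral_sphere_measure:
  assumes [measurable]: "g \<in> borel_measurable borel"
  shows "(\<integral>\<^sub>S\<omega>. g \<omega>) = (\<integral>\<^sub>+x. 3 * indicator (cball 0 1) x * g (sgn x))"
proof -
  note [measurable] = sgn_measurable
  have [measurable]: "cball (0::real^3) 1 \<in> sets borel" by simp
  show ?thesis
    unfolding sphere_measure_def
    by (subst nn_integral_distr) (simp_all add: nn_integral_density)
qed

lemma emeasure_sphere_measure: "emeasure sphere_measure UNIV = ennreal (4 * pi)"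
proof -
  have "emeasure sphere_measure UNIV = (\<integral>\<^sub>S\<omega>. 1)" by simp
  also have "\<dots> = (\<integral>\<^sub>+x::real^3. 3 * indicator (cball 0 1) x)"
    by (subst nn_integral_sphere_measure) simp_all
  also have "\<dots> = 3 * emeasure lborel (cball (0::real^3) 1)"
    by (rule nn_integral_cmult_indicator) simp
  also have "\<dots> = ennreal (4 * pi)"
    by (subst emeasure_cball) (simp_all add: unit_ball_vol_3 ennreal_mult[symmetric] flip: ennreal_numeral)
  finally show ?thesis .
qed

lemma finite_sphere_measure: "finite_measure sphere_measure"
  by (rule finite_measureI) (simp add: emeasure_sphere_measure)

lemma nn_integral_sphere_isometry:
  assumes L: "linear L" "\<And>x. norm (L x) = norm x" and [measurable]: "g \<in> borel_measurable borel"
  shows "(\<integral>\<^sub>S\<omega>. g (L \<omega>)) = (\<integral>\<^sub>S\<omega>. g \<omega>)"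
proof -
  note [measurable] = sgn_measurable
  have [measurable]: "cball (0::real^3) 1 \<in> sets borel" by simp
  have [measurable]: "L \<in> borel_measurable borel"
    by (intro borel_measurable_continuous_onI linear_continuous_on linear_conv_bounded_linear[THEN iffD1] L)
  have sg: "L (sgn x) = sgn (L x)" for x
    by (simp add: sgn_div_norm linear_cmul[OF L(1)] L(2))
  have ind: "(indicator (cball 0 1) x :: ennreal) = indicator (cball 0 1) (L x)" for x
    by (simp add: indicator_def L(2))
  have "(\<integral>\<^sub>S\<omega>. g (L \<omega>)) = (\<integral>\<^sub>+x. 3 * indicator (cball 0 1) x * g (L (sgn x)))"
    by (rule nn_integral_sphere_measure) measurable
  also have "\<dots> = (\<integral>\<^sub>+x. 3 * indicator (cball 0 1) (L x) * g (sgn (L x)))"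
    by (intro nn_integral_cong) (simp only: sg ind[symmetric])
  also have "\<dots> = (\<integral>\<^sub>+x. 3 * indicator (cball 0 1) x * g (sgn x))"
    by (rule nn_integral_isometry[OF L]) measurable
  also have "\<dots> = (\<integral>\<^sub>S\<omega>. g \<omega>)"
    by (rule nn_integral_sphere_measure[symmetric]) measurable
  finally show ?thesis .
qed

lemma AE_sphere_measure: "AE \<omega> in sphere_measure. norm \<omega> = 1"
proof (rule AE_I')
  have m: "{\<omega> :: real^3. norm \<omega> \<noteq> 1} \<in> sets borel" by measurable
  have "emeasure sphere_measure {\<omega>. norm \<omega> \<noteq> 1} = (\<integral>\<^sub>S\<omega>. indicator {\<omega>. norm \<omega> \<noteq> 1} \<omega>)"
    using m by simp
  also have "\<dots> = (\<integral>\<^sub>+x::real^3. 3 * indicator (cball 0 1) x * indicator {\<omega>. norm \<omega> \<noteq> 1} (sgn x))"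
    using m by (intro nn_integral_sphere_measure) simp
  also have "\<dots> = (\<integral>\<^sub>+x::real^3. 0)"
  proof (rule nn_integral_cong_AE)
    show "AE x::real^3 in lborel. 3 * indicator (cball 0 1) x * indicator {\<omega>. norm \<omega> \<noteq> 1} (sgn x) = (0::ennreal)"
      using AE_lborel_singleton[of "0::real^3"] by eventually_elim (simp add: norm_sgn)
  qed
  finally show "{\<omega>. norm \<omega> \<noteq> 1} \<in> null_sets sphere_measure"
    using m by (simp add: null_sets_def)
qed auto

lemma qrot_measurable: "(\<lambda>p. qrot (fst p) (snd p)) \<in> borel_measurable borel"
proof -
  have qv: "qvec q = q $ 2 *\<^sub>R axis 1 1 + q $ 3 *\<^sub>R axis 2 1 + q $ 4 *\<^sub>R axis 3 1" for q
    by (simp add: qvec_def vec_eq_iff forall_3 axis_def)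
  have "(\<lambda>p. qrot_num (fst p) (snd p)) \<in> borel_measurable borel"
    unfolding qrot_num_def qv
    by (intro borel_measurable_continuous_onI continuous_intros continuous_on_cross)
  moreover have "(\<lambda>p. norm (fst p)) \<in> borel_measurable (borel :: ((real^4) \<times> (real^3)) measure)"
    by (intro borel_measurable_continuous_onI continuous_intros)
  ultimately show ?thesis unfolding qrot_def by measurable
qed

definition quat_mass :: ennreal where
  "quat_mass = emeasure lborel (ball (0::real^4) 1)"

lemma quat_mass: "quat_mass \<noteq> 0" "quat_mass < top"
proof -
  have "quat_mass = ennreal (unit_ball_vol (real DIM(real^4)) * 1 ^ DIM(real^4))"
    unfolding quat_mass_def by (rule emeasure_ball) simp
  then have eq: "quat_mass = ennreal (unit_ball_vol 4)" by simp
  show "quat_mass \<noteq> 0" "quat_mass < top"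
    unfolding eq using unit_ball_vol_pos[of 4] by (simp_all add: less_imp_neq[symmetric])
qed


text \<open>
  The average \<open>F x\<close> of \<open>f\<close> over the rotated points \<open>qrot q x\<close> depends on the norm of \<open>x\<close> only: half turns are
  absorbed by the invariance of Lebesgue measure under \<open>qmul_pure\<close>. Hence \<open>F x\<close> equals its own average over the
  sphere through \<open>x\<close>, and after exchanging the integrals the rotation \<open>qrot q\<close> is absorbed by
  the invariance of the surface measure.
\<close>

theorem quaternion_average_eq_sphere_average:
  assumes f [measurable]: "f \<in> borel_measurable borel"
  shows "ennreal (4 * pi) * (\<integral>\<^sub>+q. indicator (ball 0 1) q * f (qrot q x))
    = quat_mass * (\<integral>\<^sub>S\<omega>. f (norm x *\<^sub>R \<omega>))"
proof -
  interpret S: finite_measure sphere_measure by (rule finite_sphere_measure)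
  interpret LS: pair_sigma_finite "lborel :: (real^4) measure" sphere_measure ..
  have [measurable]: "ball (0::real^4) 1 \<in> sets borel" by simp
  have qm: "(\<lambda>q. qrot (a q) (b q)) \<in> borel_measurable M"
    if "a \<in> borel_measurable M" "b \<in> borel_measurable M" for a :: "'a \<Rightarrow> real^4" and b and M :: "'a measure"
  proof -
    have "(\<lambda>q. (a q, b q)) \<in> borel_measurable M"
      using that by (simp add: borel_prod[symmetric])
    from measurable_compose[OF this qrot_measurable] show ?thesis by simp
  qed
  define F where "F z = (\<integral>\<^sub>+q. indicator (ball 0 1) q * f (qrot q z))" for z
  have F_half: "F (half_turn y z) = F z" if "norm y = 1" for y z
  proof -
    have "F (half_turn y z) = (\<integral>\<^sub>+q. indicator (ball 0 1) (qmul_pure y q) * f (qrot (qmul_pure y q) z))"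
      unfolding F_def by (intro nn_integral_cong) (simp add: qrot_qmul_pure that indicator_def norm_qmul_pure)
    also have "\<dots> = F z"
      unfolding F_def
    proof (rule nn_integral_isometry[OF linear_qmul_pure norm_qmul_pure[OF that]])
      have [measurable]: "(\<lambda>q. qrot q z) \<in> borel_measurable borel" by (rule qm) simp_all
      show "(\<lambda>q. indicator (ball 0 1) q * f (qrot q z)) \<in> borel_measurable borel" by measurable
    qed
    finally show ?thesis .
  qed
  have F_radial: "F z = F x" if "norm z = norm x" for z
    using half_turn_transitive[of x z] F_half[of _ x] that by metis
  have m: "(\<lambda>(q, \<omega>). indicator (ball 0 1) q * f (qrot q (norm x *\<^sub>R \<omega>))) \<in> borel_measurable (lborel \<Otimes>\<^sub>M sphere_measure)"
  proof -
    have [measurable]: "(\<lambda>p. qrot (fst p) (norm x *\<^sub>R snd p)) \<in> borel_measurable ((borel :: (real^4) measure) \<Otimes>\<^sub>M borel)"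
      by (rule qm) measurable
    have "(\<lambda>(q, \<omega>). indicator (ball 0 1) q * f (qrot q (norm x *\<^sub>R \<omega>))) \<in> borel_measurable ((borel :: (real^4) measure) \<Otimes>\<^sub>M borel)"
      unfolding case_prod_beta by measurable
    then show ?thesis by (rule measurable_sphere_pair) simp
  qed
  have "ennreal (4 * pi) * F x = (\<integral>\<^sub>S\<omega>. F x)"
    by (simp add: emeasure_sphere_measure mult.commute)
  also have "\<dots> = (\<integral>\<^sub>S\<omega>. F (norm x *\<^sub>R \<omega>))"
    by (rule nn_integral_cong_AE) (use AE_sphere_measure in eventually_elim, intro F_radial[symmetric], simp)
  also have "\<dots> = (\<integral>\<^sub>+q. \<integral>\<^sub>S\<omega>. indicator (ball 0 1) q * f (qrot q (norm x *\<^sub>R \<omega>)))"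
    unfolding F_def by (rule LS.Fubini'[OF m])
  also have "\<dots> = (\<integral>\<^sub>+q::real^4. (\<integral>\<^sub>S\<omega>. f (norm x *\<^sub>R \<omega>)) * indicator (ball 0 1) q)"
  proof (rule nn_integral_cong_AE)
    show "AE q::real^4 in lborel. (\<integral>\<^sub>S\<omega>. indicator (ball 0 1) q * f (qrot q (norm x *\<^sub>R \<omega>)))
        = (\<integral>\<^sub>S\<omega>. f (norm x *\<^sub>R \<omega>)) * indicator (ball 0 1) q"
      using AE_lborel_singleton[of "0::real^4"]
    proof eventually_elim
      case (elim q)
      then obtain n \<theta> where n: "norm n = 1" and q: "qrot q = rot n \<theta>"
        by (metis qrot_eq_rot)
      have "(\<integral>\<^sub>S\<omega>. f (norm x *\<^sub>R rot n \<theta> \<omega>)) = (\<integral>\<^sub>S\<omega>. f (norm x *\<^sub>R \<omega>))"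
        by (rule nn_integral_sphere_isometry[OF linear_rot norm_rot[OF n]]) measurable
      moreover have "rot n \<theta> (norm x *\<^sub>R \<omega>) = norm x *\<^sub>R rot n \<theta> \<omega>" for \<omega>
        by (rule linear_cmul[OF linear_rot])
      ultimately show ?case
        unfolding q by (cases "q \<in> ball 0 1") simp_all
    qed
  qed
  also have "\<dots> = (\<integral>\<^sub>S\<omega>. f (norm x *\<^sub>R \<omega>)) * quat_mass"
    unfolding quat_mass_def by (rule nn_integral_cmult_indicator) simp
  finally show ?thesis
    unfolding F_def by (simp only: mult.commute)
qed


text \<open>
  This transfers bounds that are uniform over rotations to averages over the spheres through \<open>x\<close>. The
  range of angles up to \<open>4 \<pi>\<close> reflects that quaternions cover the rotations twice.
\<close>

theorem sphere_average_le:
  assumes k: "k \<in> borel_measurable (borel \<Otimes>\<^sub>M borel)"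
    and bound: "\<And>n \<theta>. norm n = 1 \<Longrightarrow> 0 \<le> \<theta> \<Longrightarrow> \<theta> \<le> 4 * pi \<Longrightarrow> (\<integral>\<^sub>+x. k (x, rot n \<theta> x)) \<le> C"
  shows "(\<integral>\<^sub>+x. \<integral>\<^sub>S\<omega>. k (x, norm x *\<^sub>R \<omega>)) \<le> ennreal (4 * pi) * C"
proof -
  interpret S: finite_measure sphere_measure by (rule finite_sphere_measure)
  note [measurable] = k
  have [measurable]: "ball (0::real^4) 1 \<in> sets borel" by simp
  have kx: "(\<lambda>y. k (x, y)) \<in> borel_measurable borel" for x by measurable
  have m: "(\<lambda>(x, q). indicator (ball 0 1) q * k (x, qrot q x)) \<in> borel_measurable ((lborel :: (real^3) measure) \<Otimes>\<^sub>M (lborel :: (real^4) measure))"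
  proof -
    have "(\<lambda>p. (snd p, fst p)) \<in> borel_measurable ((lborel :: (real^3) measure) \<Otimes>\<^sub>M (lborel :: (real^4) measure))"
      by (simp add: borel_prod[symmetric])
    from measurable_compose[OF this qrot_measurable]
    have [measurable]: "(\<lambda>p. qrot (snd p) (fst p)) \<in> borel_measurable ((lborel :: (real^3) measure) \<Otimes>\<^sub>M (lborel :: (real^4) measure))"
      by simp
    show ?thesis unfolding case_prod_beta by measurable
  qed
  have m2: "(\<lambda>x. \<integral>\<^sub>S\<omega>. k (x, norm x *\<^sub>R \<omega>)) \<in> borel_measurable lborel"
  proof (rule S.borel_measurable_nn_integral)
    have "(\<lambda>(x, \<omega>). k (x, norm x *\<^sub>R \<omega>)) \<in> borel_measurable ((borel :: (real^3) measure) \<Otimes>\<^sub>M borel)"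
      unfolding case_prod_beta by measurable
    then show "(\<lambda>(x, \<omega>). k (x, norm x *\<^sub>R \<omega>)) \<in> borel_measurable (lborel \<Otimes>\<^sub>M sphere_measure)"
      by (rule measurable_sphere_pair) simp
  qed
  have "quat_mass * (\<integral>\<^sub>+x. \<integral>\<^sub>S\<omega>. k (x, norm x *\<^sub>R \<omega>))
      = (\<integral>\<^sub>+x. quat_mass * (\<integral>\<^sub>S\<omega>. k (x, norm x *\<^sub>R \<omega>)))"
    by (rule nn_integral_cmult[OF m2, symmetric])
  also have "\<dots> = (\<integral>\<^sub>+x. ennreal (4 * pi) * (\<integral>\<^sub>+q. indicator (ball 0 1) q * k (x, qrot q x)))"
    by (simp only: quaternion_average_eq_sphere_average[OF kx])
  also have "\<dots> = ennreal (4 * pi) * (\<integral>\<^sub>+x. \<integral>\<^sub>+q. indicator (ball 0 1) q * k (x, qrot q x))"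
    by (rule nn_integral_cmult, rule lborel.borel_measurable_nn_integral, rule m)
  finally have eq: "quat_mass * (\<integral>\<^sub>+x. \<integral>\<^sub>S\<omega>. k (x, norm x *\<^sub>R \<omega>))
      = ennreal (4 * pi) * (\<integral>\<^sub>+x. \<integral>\<^sub>+q. indicator (ball 0 1) q * k (x, qrot q x))" .
  have "(\<integral>\<^sub>+x. \<integral>\<^sub>+q. indicator (ball 0 1) q * k (x, qrot q x))
      = (\<integral>\<^sub>+q. \<integral>\<^sub>+x. indicator (ball 0 1) q * k (x, qrot q x))"
    by (rule lborel_pair.Fubini'[OF m, symmetric])
  also have "\<dots> \<le> (\<integral>\<^sub>+q::real^4. C * indicator (ball 0 1) q)"
  proof (rule nn_integral_mono_AE)
    show "AE q::real^4 in lborel. (\<integral>\<^sub>+x. indicator (ball 0 1) q * k (x, qrot q x)) \<le> C * indicator (ball 0 1) q"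
      using AE_lborel_singleton[of "0::real^4"]
    proof eventually_elim
      case (elim q)
      then obtain n \<theta> where n: "norm n = 1" "0 \<le> \<theta>" "\<theta> \<le> 4 * pi" "qrot q = rot n \<theta>"
        by (metis qrot_eq_rot)
      show ?case
        unfolding n(4) using bound[OF n(1-3)] by (cases "q \<in> ball 0 1") simp_all
    qed
  qed
  also have "\<dots> = C * quat_mass"
    unfolding quat_mass_def by (rule nn_integral_cmult_indicator) simp
  finally have le: "(\<integral>\<^sub>+x. \<integral>\<^sub>+q. indicator (ball 0 1) q * k (x, qrot q x)) \<le> C * quat_mass" .
  have "quat_mass * (\<integral>\<^sub>+x. \<integral>\<^sub>S\<omega>. k (x, norm x *\<^sub>R \<omega>))
      \<le> quat_mass * (ennreal (4 * pi) * C)"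
    unfolding eq using mult_left_mono[OF le, of "ennreal (4 * pi)"] by (simp only: mult_ac zero_le)
  then show ?thesis
    using quat_mass by (subst (asm) ennreal_mult_le_mult_iff) auto
qed

lemma measure_sphere_measure: "measure sphere_measure UNIV = 4 * pi"
  by (simp add: measure_def emeasure_sphere_measure)

lemma radial_proj_measurable:
  assumes [measurable]: "f \<in> borel_measurable borel"
  shows "radial_proj f \<in> borel_measurable borel"
proof -
  interpret S: finite_measure sphere_measure by (rule finite_sphere_measure)
  have "(\<lambda>(x :: real^3, \<omega>). f (norm x *\<^sub>R \<omega>)) \<in> borel_measurable ((borel :: (real^3) measure) \<Otimes>\<^sub>M borel)"
    unfolding case_prod_beta by measurable
  then have "(\<lambda>(x :: real^3, \<omega>). f (norm x *\<^sub>R \<omega>)) \<in> borel_measurable (borel \<Otimes>\<^sub>M sphere_measure)"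
    by (rule measurable_sphere_pair) simp
  from S.borel_measurable_lebesgue_integral[OF this] show ?thesis
    unfolding radial_proj_def[abs_def] by measurable
qed

lemma sphere_slice_measurable:
  assumes "f \<in> borel_measurable borel"
  shows "(\<lambda>\<omega>. f (c *\<^sub>R \<omega>)) \<in> borel_measurable sphere_measure"
proof -
  have "(\<lambda>\<omega>. f (c *\<^sub>R \<omega>)) \<in> borel_measurable borel" using assms by measurable
  then show ?thesis by (simp add: measurable_cong_sets[OF sphere_measure_props(1) refl])
qed

lemma nn_integral_slices_power2:
  assumes [measurable]: "d \<in> borel_measurable borel"
  shows "(\<integral>\<^sub>+x::real^3. \<integral>\<^sub>S\<omega>. ennreal ((cmod (d (norm x *\<^sub>R \<omega>)))^2))
    \<le> ennreal (4 * pi) * (\<integral>\<^sub>+x. ennreal ((cmod (d x))^2))"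
proof -
  have "(\<integral>\<^sub>+x::real^3. \<integral>\<^sub>S\<omega>. (\<lambda>p. ennreal ((cmod (d (snd p)))^2)) (x, norm x *\<^sub>R \<omega>))
    \<le> ennreal (4 * pi) * (\<integral>\<^sub>+x. ennreal ((cmod (d x))^2))"
  proof (rule sphere_average_le)
    show "(\<lambda>p. ennreal ((cmod (d (snd p)))^2)) \<in> borel_measurable ((borel :: (real^3) measure) \<Otimes>\<^sub>M borel)" by measurable
    fix n :: "real^3" and \<theta> :: real assume n: "norm n = 1"
    have "(\<integral>\<^sub>+x. ennreal ((cmod (d (rot n \<theta> x)))^2)) = (\<integral>\<^sub>+x. ennreal ((cmod (d x))^2))"
      by (rule nn_integral_isometry[OF linear_rot norm_rot[OF n]]) measurable
    then show "(\<integral>\<^sub>+x. ennreal ((cmod (d (snd (x, rot n \<theta> x))))^2)) \<le> (\<integral>\<^sub>+x. ennreal ((cmod (d x))^2))"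
      by simp
  qed
  then show ?thesis by simp
qed

lemma radial_proj_pointwise:
  assumes f: "f \<in> borel_measurable borel"
  shows "ennreal ((cmod (radial_proj f x))^2)
    \<le> ennreal (1 / (4 * pi)) * (\<integral>\<^sub>S\<omega>. ennreal ((cmod (f (norm x *\<^sub>R \<omega>)))^2))" (is "_ \<le> _ * ?I")
proof -
  note [measurable] = sphere_slice_measurable[OF f, of "norm x"]
  define I where "I = (LINT \<omega>|sphere_measure. f (norm x *\<^sub>R \<omega>))"
  have "ennreal (cmod I) \<le> (\<integral>\<^sub>S\<omega>. 1 * ennreal (cmod (f (norm x *\<^sub>R \<omega>))))"
    unfolding I_def using integral_norm_bound_ennreal[of sphere_measure "\<lambda>\<omega>. f (norm x *\<^sub>R \<omega>)"]
    by (cases "integrable sphere_measure (\<lambda>\<omega>. f (norm x *\<^sub>R \<omega>))") (simp_all add: not_integrable_integral_eq)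
  then have "(ennreal (cmod I))^2 \<le> (\<integral>\<^sub>S\<omega>. 1 * ennreal (cmod (f (norm x *\<^sub>R \<omega>))))^2"
    by (intro power_mono) auto
  also have "\<dots> \<le> (\<integral>\<^sub>S\<omega>. 1^2) * (\<integral>\<^sub>S\<omega>. (ennreal (cmod (f (norm x *\<^sub>R \<omega>))))^2)"
    by (rule Cauchy_Schwarz_nn_integral) measurable
  also have "\<dots> = ennreal (4 * pi) * ?I"
    by (simp add: emeasure_sphere_measure ennreal_power)
  finally have le: "(ennreal (cmod I))^2 \<le> ennreal (4 * pi) * ?I" .
  have "(cmod (radial_proj f x))^2 = (1 / (4 * pi))^2 * (cmod I)^2"
    by (simp add: radial_proj_def I_def[symmetric] norm_mult norm_divide power_mult_distrib power_divide)
  then have "ennreal ((cmod (radial_proj f x))^2) = ennreal ((1 / (4 * pi))^2) * (ennreal (cmod I))^2"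
    by (simp only: ennreal_power ennreal_mult zero_le_power2 norm_ge_zero)
  also have "\<dots> \<le> ennreal ((1 / (4 * pi))^2) * (ennreal (4 * pi) * ?I)"
    by (intro mult_left_mono le) simp
  also have "\<dots> = ennreal ((1 / (4 * pi))^2 * (4 * pi)) * ?I"
    by (simp add: ennreal_mult mult.assoc)
  also have "(1 / (4 * pi))^2 * (4 * pi) = 1 / (4 * pi)"
    by (simp add: power2_eq_square)
  finally show ?thesis .
qed

proposition radial_proj_L2:
  assumes f: "f \<in> borel_measurable borel"
  shows "(\<integral>\<^sub>+x. ennreal ((cmod (radial_proj f x))^2)) \<le> (\<integral>\<^sub>+x. ennreal ((cmod (f x))^2))"
proof -
  have "ennreal (4 * pi) * (\<integral>\<^sub>+x. ennreal ((cmod (radial_proj f x))^2))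
      = (\<integral>\<^sub>+x. ennreal (4 * pi) * ennreal ((cmod (radial_proj f x))^2))"
    using radial_proj_measurable[OF f] by (intro nn_integral_cmult[symmetric]) measurable
  also have "\<dots> \<le> (\<integral>\<^sub>+x::real^3. \<integral>\<^sub>S\<omega>. ennreal ((cmod (f (norm x *\<^sub>R \<omega>)))^2))"
  proof (rule nn_integral_mono)
    fix x :: "real^3"
    have "ennreal (4 * pi) * ennreal ((cmod (radial_proj f x))^2)
        \<le> ennreal (4 * pi) * (ennreal (1 / (4 * pi)) * (\<integral>\<^sub>S\<omega>. ennreal ((cmod (f (norm x *\<^sub>R \<omega>)))^2)))"
      by (intro mult_left_mono radial_proj_pointwise f) simp
    also have "\<dots> = ennreal (4 * pi * (1 / (4 * pi))) * (\<integral>\<^sub>S\<omega>. ennreal ((cmod (f (norm x *\<^sub>R \<omega>)))^2))"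
      by (subst ennreal_mult) (simp_all add: mult.assoc)
    finally show "ennreal (4 * pi) * ennreal ((cmod (radial_proj f x))^2)
        \<le> (\<integral>\<^sub>S\<omega>. ennreal ((cmod (f (norm x *\<^sub>R \<omega>)))^2))"
      by simp
  qed
  also have "\<dots> \<le> ennreal (4 * pi) * (\<integral>\<^sub>+x. ennreal ((cmod (f x))^2))"
    by (rule nn_integral_slices_power2[OF f])
  finally show ?thesis
    by (subst (asm) ennreal_mult_le_mult_iff) auto
qed

text \<open>
  The Bochner integral that defines the projection is additive only where both integrands are integrable on
  the sphere; for a square integrable function this holds on almost every sphere.
\<close>

lemma radial_proj_diff_AE:
  assumes u: "C1c u" and f: "square_integrable lborel f"
  shows "AE x in lborel. radial_proj (\<lambda>x. u x - f x) x = radial_proj u x - radial_proj f x"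
proof -
  interpret S: finite_measure sphere_measure by (rule finite_sphere_measure)
  have fm: "f \<in> borel_measurable borel" using f by (simp add: square_integrable_def)
  have "(\<integral>\<^sub>+x. ennreal ((cmod (f x))^2)) < top"
    unfolding nn_integral_norm_L2[OF f] by simp
  then have fin: "(\<integral>\<^sub>+x::real^3. \<integral>\<^sub>S\<omega>. ennreal ((cmod (f (norm x *\<^sub>R \<omega>)))^2)) \<noteq> \<infinity>"
    using le_less_trans[OF nn_integral_slices_power2[OF fm]] by (simp add: ennreal_mult_less_top less_top)
  have m: "(\<lambda>x :: real^3. \<integral>\<^sub>S\<omega>. ennreal ((cmod (f (norm x *\<^sub>R \<omega>)))^2)) \<in> borel_measurable lborel"
  proof (rule S.borel_measurable_nn_integral)
    have "(\<lambda>(x :: real^3, \<omega>). ennreal ((cmod (f (norm x *\<^sub>R \<omega>)))^2)) \<in> borel_measurable ((borel :: (real^3) measure) \<Otimes>\<^sub>M borel)"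
      unfolding case_prod_beta using fm by measurable
    then show "(\<lambda>(x :: real^3, \<omega>). ennreal ((cmod (f (norm x *\<^sub>R \<omega>)))^2)) \<in> borel_measurable (lborel \<Otimes>\<^sub>M sphere_measure)"
      by (rule measurable_sphere_pair) simp
  qed
  from nn_integral_noteq_infinite[OF m fin] show ?thesis
  proof eventually_elim
    case (elim x)
    have sq: "square_integrable sphere_measure (\<lambda>\<omega>. f (norm x *\<^sub>R \<omega>))"
    proof -
      obtain r where "(\<integral>\<^sub>S\<omega>. ennreal ((cmod (f (norm x *\<^sub>R \<omega>)))^2)) = ennreal r" "0 \<le> r"
        using elim by (cases "(\<integral>\<^sub>S\<omega>. ennreal ((cmod (f (norm x *\<^sub>R \<omega>)))^2))") auto
      then show ?thesis
        by (intro square_integrableI_nn_integral(1)[of _ _ "sqrt r"] sphere_slice_measurable fm) simp_all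
    qed
    have "square_integrable sphere_measure (\<lambda>\<omega>. 1)"
      by (simp add: square_integrable_def)
    from square_integrable_mult[OF sq this]
    have i1: "integrable sphere_measure (\<lambda>\<omega>. f (norm x *\<^sub>R \<omega>))" by simp
    have i2: "integrable sphere_measure (\<lambda>\<omega>. u (norm x *\<^sub>R \<omega>))"
    proof -
      obtain R where R: "\<And>x. norm x > R \<Longrightarrow> u x = 0" using C1c_support[OF u] by metis
      obtain B where "\<And>x. cmod (u x) \<le> B"
        using compact_support_bounded[OF C1_continuous[OF C1cD[OF u]] R] by metis
      then show ?thesis
        by (intro S.integrable_const_bound[of _ B] sphere_slice_measurable C1_measurable C1cD u) simp_all
    qed
    show ?case
      using i1 i2 by (simp add: radial_proj_def right_diff_distrib)
  qed
qed

text \<open>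
  Convexity of the sixth power, as the tangent line at \<open>m\<close> lying below the graph; integrating it gives
  Jensen's inequality.
\<close>

lemma tangent_power6:
  fixes s m :: real
  assumes "0 \<le> s" "0 \<le> m"
  shows "m^6 + 6 * m^5 * (s - m) \<le> s^6"
proof -
  have "s^6 - (m^6 + 6 * m^5 * (s - m))
      = (s - m)^2 * (s^4 + 2 * s^3 * m + 3 * s^2 * m^2 + 4 * s * m^3 + 5 * m^4)"
    by algebra
  also have "\<dots> \<ge> 0"
    using assms by (intro mult_nonneg_nonneg add_nonneg_nonneg) simp_all
  finally show ?thesis by simp
qed

lemma radial_proj_perp_pointwise:
  assumes u: "C1c u"
  shows "ennreal (4 * pi) * ennreal ((cmod (radial_proj_perp u x))^6)
    \<le> (\<integral>\<^sub>S\<omega>. ennreal ((cmod (u x - u (norm x *\<^sub>R \<omega>)))^6))"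
proof -
  interpret S: finite_measure sphere_measure by (rule finite_sphere_measure)
  note [measurable] = sphere_slice_measurable[OF C1_measurable[OF C1cD[OF u]], of "norm x"]
  obtain R where R: "\<And>x. norm x > R \<Longrightarrow> u x = 0" using C1c_support[OF u] by metis
  obtain B where B: "\<And>x. cmod (u x) \<le> B"
    using compact_support_bounded[OF C1_continuous[OF C1cD[OF u]] R] by metis
  define g where "g \<omega> = u x - u (norm x *\<^sub>R \<omega>)" for \<omega>
  have [measurable]: "g \<in> borel_measurable sphere_measure" unfolding g_def by measurable
  have gB: "cmod (g \<omega>) \<le> 2 * B" for \<omega>
    using norm_triangle_ineq4[of "u x" "u (norm x *\<^sub>R \<omega>)"] B[of x] B[of "norm x *\<^sub>R \<omega>"] by (simp add: g_def)
  have ig: "integrable sphere_measure g"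
    by (intro S.integrable_const_bound[of _ "2 * B"]) (simp_all add: gB)
  have ih: "integrable sphere_measure (\<lambda>\<omega>. cmod (g \<omega>))"
    using ig by simp
  have ih6: "integrable sphere_measure (\<lambda>\<omega>. (cmod (g \<omega>))^6)"
  proof (rule S.integrable_const_bound[of _ "(2 * B)^6"])
    show "AE \<omega> in sphere_measure. norm ((cmod (g \<omega>))^6) \<le> (2 * B)^6"
      using power_mono[OF gB norm_ge_zero, of _ 6] by (simp del: power_mult_distrib)
  qed measurable
  define m where "m = (1 / (4 * pi)) * (LINT \<omega>|sphere_measure. cmod (g \<omega>))"
  have m0: "0 \<le> m" by (simp add: m_def)
  have "integrable sphere_measure (\<lambda>\<omega>. u (norm x *\<^sub>R \<omega>))"
    by (intro S.integrable_const_bound[of _ B]) (simp_all add: B)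
  then have "(LINT \<omega>|sphere_measure. g \<omega>) = complex_of_real (4 * pi) * u x - (LINT \<omega>|sphere_measure. u (norm x *\<^sub>R \<omega>))"
    unfolding g_def by (simp add: measure_sphere_measure scaleR_conv_of_real)
  then have "radial_proj_perp u x = complex_of_real (1 / (4 * pi)) * (LINT \<omega>|sphere_measure. g \<omega>)"
    by (simp add: radial_proj_perp_def radial_proj_def right_diff_distrib)
  then have "cmod (radial_proj_perp u x) = (1 / (4 * pi)) * cmod (LINT \<omega>|sphere_measure. g \<omega>)"
    by (simp add: norm_mult norm_divide)
  also have "\<dots> \<le> m"
    unfolding m_def by (intro mult_left_mono integral_norm_bound) simp
  finally have "(cmod (radial_proj_perp u x))^6 \<le> m^6"
    by (intro power_mono) auto
  then have "4 * pi * (cmod (radial_proj_perp u x))^6 \<le> 4 * pi * m^6"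
    by simp
  also have "\<dots> = (LINT \<omega>|sphere_measure. m^6 + 6 * m^5 * (cmod (g \<omega>) - m))"
  proof -
    have "(LINT \<omega>|sphere_measure. cmod (g \<omega>)) = 4 * pi * m" by (simp add: m_def)
    then show ?thesis using ih by (simp add: measure_sphere_measure)
  qed
  also have "\<dots> \<le> (LINT \<omega>|sphere_measure. (cmod (g \<omega>))^6)"
    using ih ih6 m0 by (intro integral_mono) (auto intro!: tangent_power6)
  finally have "ennreal (4 * pi * (cmod (radial_proj_perp u x))^6) \<le> ennreal (LINT \<omega>|sphere_measure. (cmod (g \<omega>))^6)"
    by (rule ennreal_leI)
  also have "\<dots> = (\<integral>\<^sub>S\<omega>. ennreal ((cmod (g \<omega>))^6))"
    by (rule nn_integral_eq_integral[symmetric]) (simp_all add: ih6)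
  finally show ?thesis
    by (simp add: g_def ennreal_mult)
qed

text \<open>
  \<open>P\<^sup>\<bottom> u\<close> is the mean of \<open>u x - u y\<close> over the points \<open>y\<close> of the sphere through \<open>x\<close>. By Jensen's inequality
  and \<open>sphere_average_le\<close> it suffices to bound \<open>u - u \<circ> R\<close> in \<open>L\<^sup>6\<close> for each rotation \<open>R\<close>.
\<close>

theorem radial_proj_perp_L6:
  assumes u: "C1c u"
  shows "(\<integral>\<^sub>+x. ennreal ((cmod (radial_proj_perp u x))^6))
    \<le> 4096 * (ennreal (8 + (4 * pi)^2) * energy u)^3"
    (is "_ \<le> ?C")
proof -
  note C = C1cD[OF u]
  note um [measurable] = C1_measurable[OF C]
  have pm: "radial_proj_perp u \<in> borel_measurable borel"
    unfolding radial_proj_perp_def[abs_def] using radial_proj_measurable[OF um] by measurable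
  have "ennreal (4 * pi) * (\<integral>\<^sub>+x. ennreal ((cmod (radial_proj_perp u x))^6))
      = (\<integral>\<^sub>+x. ennreal (4 * pi) * ennreal ((cmod (radial_proj_perp u x))^6))"
    using pm by (intro nn_integral_cmult[symmetric]) measurable
  also have "\<dots> \<le> (\<integral>\<^sub>+x::real^3. \<integral>\<^sub>S\<omega>. (\<lambda>p. ennreal ((cmod (u (fst p) - u (snd p)))^6)) (x, norm x *\<^sub>R \<omega>))"
    unfolding fst_conv snd_conv by (intro nn_integral_mono radial_proj_perp_pointwise u)
  also have "\<dots> \<le> ennreal (4 * pi) * ?C"
  proof (rule sphere_average_le)
    show "(\<lambda>p. ennreal ((cmod (u (fst p) - u (snd p)))^6)) \<in> borel_measurable (borel \<Otimes>\<^sub>M borel)" by measurable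
    fix n :: "real^3" and \<theta> :: real assume n: "norm n = 1" "0 \<le> \<theta>" "\<theta> \<le> 4 * pi"
    define w where "w x = u (rot n \<theta> x) - u x" for x
    have w: "C1c w"
      unfolding w_def using C1c_lin[OF C1c_comp_isometry[OF u linear_rot norm_rot[OF n(1)]] u, where c="-1"] by simp
    have "(\<integral>\<^sub>+x. ennreal ((cmod (u (fst (x, rot n \<theta> x)) - u (snd (x, rot n \<theta> x))))^6)) = (\<integral>\<^sub>+x. ennreal ((cmod (w x))^6))"
      by (simp add: w_def norm_minus_commute)
    also have "\<dots> \<le> 4096 * (\<integral>\<^sub>+x. ennreal (\<Sum>i\<in>UNIV. (cmod (pderiv3 i w x))^2))^3"
      by (rule Sobolev_L6[OF w])
    also have "\<dots> \<le> 4096 * (ennreal (8 + \<theta>^2) * energy u)^3"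
      unfolding w_def[abs_def] by (intro mult_left_mono power_mono rotation_difference_gradient C n) auto
    also have "\<dots> \<le> ?C"
      using power_mono[OF n(3,2), of 2]
      by (intro mult_left_mono power_mono mult_right_mono ennreal_leI) auto
    finally show "(\<integral>\<^sub>+x. ennreal ((cmod (u (fst (x, rot n \<theta> x)) - u (snd (x, rot n \<theta> x))))^6)) \<le> ?C" .
  qed
  finally show ?thesis
    by (subst (asm) ennreal_mult_le_mult_iff) auto
qed

section \<open>Density of test functions\<close>

text \<open>
  The standard function that vanishes to infinite order at \<open>0\<close>. The factor \<open>t\<^sup>-\<^sup>k\<close> makes the family closed under
  differentiation, so that smoothness follows by induction.
\<close>

definition flat :: "nat \<Rightarrow> real \<Rightarrow> real \<Rightarrow> real" where
  "flat k c t = (if t > 0 then exp (- c / t) / t ^ k else 0)"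

lemma flat_tendsto_0:
  assumes "c > 0"
  shows "((\<lambda>t. flat k c t) \<longlongrightarrow> 0) (at 0)"
proof -
  have "filterlim (\<lambda>t. c * inverse t) at_top (at_right 0)"
    using assms by (intro filterlim_tendsto_pos_mult_at_top[OF tendsto_const _ filterlim_inverse_at_top_right])
  from filterlim_compose[OF tendsto_power_div_exp_0[of k] this]
  have "((\<lambda>t. (c * inverse t)^k / exp (c * inverse t) * (1 / c^k)) \<longlongrightarrow> 0 * (1 / c^k)) (at_right 0)"
    by (intro tendsto_mult tendsto_const)
  then have lim: "((\<lambda>t. (c * inverse t)^k / exp (c * inverse t) * (1 / c^k)) \<longlongrightarrow> 0) (at_right 0)"
    by simp
  have "eventually (\<lambda>t::real. t > 0) (at_right 0)"
    by (rule eventually_at_right_less)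
  then have "eventually (\<lambda>t. (c * inverse t)^k / exp (c * inverse t) * (1 / c^k) = flat k c t) (at_right 0)"
    by eventually_elim (use assms in \<open>simp add: flat_def exp_minus power_mult_distrib field_simps\<close>)
  from Lim_transform_eventually[OF lim this] have right: "((\<lambda>t. flat k c t) \<longlongrightarrow> 0) (at_right 0)" .
  have "eventually (\<lambda>t::real. t < 0) (at_left 0)"
    by (simp add: eventually_at_filter)
  then have "eventually (\<lambda>t. 0 = flat k c t) (at_left 0)"
    by eventually_elim (simp add: flat_def)
  from Lim_transform_eventually[OF tendsto_const this] have left: "((\<lambda>t. flat k c t) \<longlongrightarrow> 0) (at_left 0)" .
  show ?thesis using left right by (rule filterlim_split_at)
qed

lemma flat_has_derivative:
  assumes "c > 0"
  shows "(flat k c has_real_derivative (c * flat (k + 2) c t - real k * flat (k + 1) c t)) (at t)"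
proof -
  consider "t > 0" | "t < 0" | "t = 0" by linarith
  then show ?thesis
  proof cases
    case 1
    have "((\<lambda>t. exp (- c / t) / t ^ k) has_real_derivative (c * flat (k + 2) c t - real k * flat (k + 1) c t)) (at t)"
    proof (cases k)
      case 0
      then show ?thesis
        using 1 by (auto intro!: derivative_eq_intros simp: flat_def power2_eq_square)
    next
      case (Suc j)
      then show ?thesis
        using 1 by (auto intro!: derivative_eq_intros simp: flat_def power2_eq_square field_simps)
          (cases j, simp_all)
    qed
    then show ?thesis
      by (rule has_field_derivative_transform_within_open[of _ _ _ "{0<..}"]) (use 1 in \<open>auto simp: flat_def\<close>)
  next
    case 2
    have "((\<lambda>t. 0) has_real_derivative (c * flat (k + 2) c t - real k * flat (k + 1) c t)) (at t)"
      using 2 by (simp add: flat_def)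
    then show ?thesis
      by (rule has_field_derivative_transform_within_open[of _ _ _ "{..<0}"]) (use 2 in \<open>auto simp: flat_def\<close>)
  next
    case 3
    have "(\<lambda>h. (flat k c (0 + h) - flat k c 0) / h) = flat (k + 1) c"
      by (auto simp: flat_def fun_eq_iff)
    then have "(flat k c has_real_derivative 0) (at 0)"
      unfolding DERIV_def using flat_tendsto_0[OF assms, of "k + 1"] by simp
    then show ?thesis by (simp add: 3 flat_def)
  qed
qed

text \<open>
  An algebra of functions that is closed under partial derivatives and consists of differentiable functions;
  hence all its elements are smooth.
\<close>

inductive_set flat_algebra :: "(real^3 \<Rightarrow> complex) set" where
  const: "(\<lambda>x. a) \<in> flat_algebra"
| flat: "c > 0 \<Longrightarrow> (\<lambda>x. complex_of_real (flat k c (s * x $ i + b))) \<in> flat_algebra"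
| add: "f \<in> flat_algebra \<Longrightarrow> g \<in> flat_algebra \<Longrightarrow> (\<lambda>x. f x + g x) \<in> flat_algebra"
| mult: "f \<in> flat_algebra \<Longrightarrow> g \<in> flat_algebra \<Longrightarrow> (\<lambda>x. f x * g x) \<in> flat_algebra"

lemma flat_algebra_derivative:
  "f \<in> flat_algebra \<Longrightarrow> (\<forall>x. f differentiable at x) \<and> (\<forall>j. pderiv3 j f \<in> flat_algebra)"
proof (induction rule: flat_algebra.induct)
  case (const a)
  have "pderiv3 j (\<lambda>x. a) = (\<lambda>x. 0)" for j
    by (rule ext, rule pderiv3_eqI) (rule has_derivative_const)
  then show ?case by (auto intro: flat_algebra.const)
next
  case (flat c k s i b)
  let ?d = "\<lambda>x::real^3. c * flat (k + 2) c (s * x $ i + b) - real k * flat (k + 1) c (s * x $ i + b)"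
  have "((\<lambda>x::real^3. s * x $ i + b) has_derivative (\<lambda>h. s * h $ i)) (at x)" for x
    by (auto intro!: derivative_eq_intros bounded_linear_imp_has_derivative bounded_linear_vec_nth)
  from has_derivative_compose[OF this flat_has_derivative[OF flat, unfolded has_field_derivative_def]]
  have "((\<lambda>x::real^3. flat k c (s * x $ i + b)) has_derivative (\<lambda>h. ?d x * (s * h $ i))) (at x)" for x .
  from bounded_linear.has_derivative[OF bounded_linear_of_real this]
  have D: "((\<lambda>x::real^3. complex_of_real (flat k c (s * x $ i + b))) has_derivative (\<lambda>h. complex_of_real (?d x * (s * h $ i)))) (at x)" for x .
  have p: "pderiv3 j (\<lambda>x. complex_of_real (flat k c (s * x $ i + b)))
      = (\<lambda>x. complex_of_real (c * s * axis j 1 $ i) * complex_of_real (flat (k + 2) c (s * x $ i + b))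
           + complex_of_real (- real k * s * axis j 1 $ i) * complex_of_real (flat (k + 1) c (s * x $ i + b)))" for j
    by (rule ext, unfold pderiv3_eqI[OF D]) (simp add: algebra_simps)
  have "pderiv3 j (\<lambda>x. complex_of_real (flat k c (s * x $ i + b))) \<in> flat_algebra" for j
    unfolding p by (intro flat_algebra.add flat_algebra.mult[OF flat_algebra.const] flat_algebra.flat flat)
  then show ?case using D by (auto simp: differentiable_def)
next
  case (add f g)
  then have D: "((\<lambda>x. f x + g x) has_derivative (\<lambda>h. ddir f x h + ddir g x h)) (at x)" for x
    by (intro has_derivative_add has_derivative_ddir) auto
  have "pderiv3 j (\<lambda>x. f x + g x) = (\<lambda>x. pderiv3 j f x + pderiv3 j g x)" for j
    by (rule ext) (simp add: pderiv3_eqI[OF D] ddir_axis)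
  then show ?case using add D by (auto simp: differentiable_def intro!: flat_algebra.add)
next
  case (mult f g)
  then have D: "((\<lambda>x. f x * g x) has_derivative (\<lambda>h. f x * ddir g x h + ddir f x h * g x)) (at x)" for x
    by (intro has_derivative_mult has_derivative_ddir) auto
  have "pderiv3 j (\<lambda>x. f x * g x) = (\<lambda>x. f x * pderiv3 j g x + pderiv3 j f x * g x)" for j
    by (rule ext) (simp add: pderiv3_eqI[OF D] ddir_axis)
  then show ?case using mult D by (auto simp: differentiable_def intro!: flat_algebra.add flat_algebra.mult)
qed

lemma flat_algebra_smooth:
  assumes "f \<in> flat_algebra"
  shows "smooth3 f"
proof -
  have "iter_pderiv3 is f \<in> flat_algebra" for "is"
    by (induction "is") (simp_all add: assms flat_algebra_derivative)
  then show ?thesis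
    using flat_algebra_derivative unfolding smooth3_def
    by (auto simp: differentiable_on_def intro: differentiable_at_withinI)
qed

text \<open>
  As \<open>c\<close> decreases to \<open>0\<close> these functions increase to the indicator of the box.
\<close>

definition bump :: "real^3 \<Rightarrow> real^3 \<Rightarrow> real \<Rightarrow> real^3 \<Rightarrow> real" where
  "bump a b c x = (\<Prod>i\<in>UNIV. flat 0 c (x $ i - a $ i) * flat 0 c (b $ i - x $ i))"

lemma bump_test_fun:
  assumes "c > 0"
  shows "test_fun (\<lambda>x. complex_of_real (bump a b c x))"
proof -
  have f: "(\<lambda>x. complex_of_real (flat 0 c (x $ i - a $ i)) * complex_of_real (flat 0 c (b $ i - x $ i))) \<in> flat_algebra" for i
    using flat_algebra.mult[OF flat_algebra.flat[OF assms, of 0 1 i "- a $ i"] flat_algebra.flat[OF assms, of 0 "-1" i "b $ i"]]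
    by (simp add: algebra_simps)
  have eq: "(\<lambda>x. complex_of_real (bump a b c x))
      = (\<lambda>x. (complex_of_real (flat 0 c (x $ 1 - a $ 1)) * complex_of_real (flat 0 c (b $ 1 - x $ 1)))
          * ((complex_of_real (flat 0 c (x $ 2 - a $ 2)) * complex_of_real (flat 0 c (b $ 2 - x $ 2)))
          * (complex_of_real (flat 0 c (x $ 3 - a $ 3)) * complex_of_real (flat 0 c (b $ 3 - x $ 3)))))"
    unfolding bump_def UNIV_3 by (simp add: fun_eq_iff)
  have "smooth3 (\<lambda>x. complex_of_real (bump a b c x))"
    unfolding eq by (intro flat_algebra_smooth flat_algebra.mult[OF f flat_algebra.mult[OF f f]])
  moreover have "{x. complex_of_real (bump a b c x) \<noteq> 0} \<subseteq> cbox a b"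
    by (auto simp: bump_def flat_def mem_box_cart split: if_splits) (meson less_imp_le)+
  then have "compact (closure {x. complex_of_real (bump a b c x) \<noteq> 0})"
    by (simp add: compact_closure bounded_subset[OF bounded_cbox])
  ultimately show ?thesis by (simp add: test_fun_def)
qed

lemma flat_0_bounds: "c > 0 \<Longrightarrow> 0 \<le> flat 0 c t" "c > 0 \<Longrightarrow> flat 0 c t \<le> 1"
  by (simp_all add: flat_def)

lemma bump_le_indicator:
  assumes "c > 0"
  shows "\<bar>bump a b c x\<bar> \<le> indicator (box a b) x"
proof (cases "x \<in> box a b")
  case True
  have "0 \<le> bump a b c x" "bump a b c x \<le> 1"
    unfolding bump_def using assms
    by (auto intro!: prod_nonneg prod_le_1 mult_nonneg_nonneg mult_le_one simp: flat_0_bounds)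
  then show ?thesis using True by simp
next
  case False
  then have "\<exists>i. flat 0 c (x $ i - a $ i) * flat 0 c (b $ i - x $ i) = 0"
    by (auto simp: mem_box_cart flat_def)
  then have "bump a b c x = 0" by (auto simp: bump_def)
  then show ?thesis by simp
qed

lemma bump_tendsto_indicator: "(\<lambda>n. bump a b (1 / real (Suc n)) x) \<longlonglongrightarrow> indicator (box a b) x"
proof (cases "x \<in> box a b")
  case True
  have lim: "(\<lambda>n. flat 0 (1 / real (Suc n)) t) \<longlonglongrightarrow> 1" if "t > 0" for t
  proof -
    have "(\<lambda>n. 1 / real (Suc n)) \<longlonglongrightarrow> 0" by (rule LIMSEQ_Suc[OF lim_1_over_n])
    then have "(\<lambda>n. exp (- (1 / real (Suc n)) / t)) \<longlonglongrightarrow> exp (- 0 / t)"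
      using that by (intro tendsto_intros) auto
    then show ?thesis using that by (simp add: flat_def)
  qed
  have "(\<lambda>n. bump a b (1 / real (Suc n)) x) \<longlonglongrightarrow> (\<Prod>i\<in>(UNIV::3 set). 1 * 1)"
    unfolding bump_def using True by (intro tendsto_prod tendsto_mult lim) (auto simp: mem_box_cart)
  then show ?thesis using True by simp
next
  case False
  have "bump a b (1 / real (Suc n)) x = 0" for n
    using bump_le_indicator[of "1 / real (Suc n)" a b x] False by simp
  then show ?thesis using False by simp
qed

text \<open>
  The positive and the negative part of \<open>h\<close> are densities of measures that agree on boxes, and boxes generate the
  Borel sets.
\<close>

lemma AE_zero_if_box_integrals_zero:
  fixes h :: "real^3 \<Rightarrow> real"
  assumes h [measurable]: "h \<in> borel_measurable borel"
    and int: "\<And>a b. integrable lborel (\<lambda>x. indicator (box a b) x * h x)"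
    and zero: "\<And>a b. (LINT x|lborel. indicator (box a b) x * h x) = 0"
  shows "AE x in lborel. h x = 0"
proof -
  define P where "P x = ennreal (max 0 (h x))" for x
  define M where "M x = ennreal (max 0 (- h x))" for x
  have [measurable]: "P \<in> borel_measurable borel" "M \<in> borel_measurable borel"
    unfolding P_def M_def by measurable
  have eq: "emeasure (density lborel P) (box a b) = emeasure (density lborel M) (box a b)"
    and fin: "emeasure (density lborel P) (box a b) \<noteq> \<infinity>" for a b
  proof -
    have ip: "integrable lborel (\<lambda>x. max 0 (indicator (box a b) x * h x))"
      and im: "integrable lborel (\<lambda>x. max 0 (- (indicator (box a b) x * h x)))"
      using int[of a b] by (auto intro!: integrable_max)
    have p: "emeasure (density lborel P) (box a b) = ennreal (LINT x|lborel. max 0 (indicator (box a b) x * h x))"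
    proof -
      have "emeasure (density lborel P) (box a b) = (\<integral>\<^sub>+x. ennreal (max 0 (indicator (box a b) x * h x)))"
        by (subst emeasure_density) (auto intro!: nn_integral_cong simp: P_def indicator_def)
      then show ?thesis by (simp add: nn_integral_eq_integral[OF ip])
    qed
    have m: "emeasure (density lborel M) (box a b) = ennreal (LINT x|lborel. max 0 (- (indicator (box a b) x * h x)))"
    proof -
      have "emeasure (density lborel M) (box a b) = (\<integral>\<^sub>+x. ennreal (max 0 (- (indicator (box a b) x * h x))))"
        by (subst emeasure_density) (auto intro!: nn_integral_cong simp: M_def indicator_def)
      then show ?thesis by (simp add: nn_integral_eq_integral[OF im])
    qed
    have "(LINT x|lborel. max 0 (indicator (box a b) x * h x)) - (LINT x|lborel. max 0 (- (indicator (box a b) x * h x)))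
        = (LINT x|lborel. max 0 (indicator (box a b) x * h x) - max 0 (- (indicator (box a b) x * h x)))"
      using ip im by simp
    also have "\<dots> = (LINT x|lborel. indicator (box a b) x * h x)"
      by (intro Bochner_Integration.integral_cong) (auto simp: max_def)
    finally have "(LINT x|lborel. max 0 (indicator (box a b) x * h x)) = (LINT x|lborel. max 0 (- (indicator (box a b) x * h x)))"
      using zero by simp
    then show "emeasure (density lborel P) (box a b) = emeasure (density lborel M) (box a b)"
      by (simp add: p m)
    show "emeasure (density lborel P) (box a b) \<noteq> \<infinity>" by (simp add: p)
  qed
  have "density lborel P = density lborel M"
  proof (rule measure_eqI_generator_eq[where E="range (\<lambda>(a, b). box a b)" and \<Omega>=UNIV
        and A="\<lambda>n::nat. box (- (real n *\<^sub>R One)) (real n *\<^sub>R One)"])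
    show "Int_stable (range (\<lambda>(a, b). box a b :: (real^3) set))"
      by (auto simp: Int_stable_def box_Int_box)
    show "(\<Union>i::nat. box (- (real i *\<^sub>R One)) (real i *\<^sub>R One)) = (UNIV :: (real^3) set)"
      by (rule UN_box_eq_UNIV)
  qed (use eq fin in \<open>auto simp: borel_eq_box\<close>)
  then have "AE x in lborel. P x = M x"
    by (subst (asm) sigma_finite_measure.density_unique_iff[OF sigma_finite_lborel]) auto
  then show ?thesis
    by eventually_elim (auto simp: P_def M_def max_def split: if_splits)
qed

text \<open>
  Dominated convergence along bump functions shows that \<open>g\<close> has integral \<open>0\<close> over every box. Only local integrability
  is demanded, since this is applied to square integrable functions multiplied by \<open>|x|\<^sup>2\<close>.
\<close>

theorem AE_zero_if_orthogonal_to_test_fun: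
  assumes g [measurable]: "g \<in> borel_measurable borel"
    and int: "\<And>a b. integrable lborel (\<lambda>x. indicator (box a b) x *\<^sub>R g x)"
    and orth: "\<And>\<psi>. test_fun \<psi> \<Longrightarrow> (LINT x|lborel. g x * cnj (\<psi> x)) = 0"
  shows "AE x in lborel. g x = 0"
proof -
  have flat_m [measurable]: "flat 0 c \<in> borel_measurable borel" for c
    unfolding flat_def[abs_def] by measurable
  have bump_m [measurable]: "bump a b c \<in> borel_measurable borel" for a b c
    unfolding bump_def[abs_def] by measurable
  have zero: "(LINT x|lborel. indicator (box a b) x *\<^sub>R g x) = 0" for a b
  proof -
    have "(\<lambda>n. LINT x|lborel. g x * cnj (complex_of_real (bump a b (1 / real (Suc n)) x)))
        \<longlonglongrightarrow> (LINT x|lborel. indicator (box a b) x *\<^sub>R g x)"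
    proof (rule integral_dominated_convergence)
      show "integrable lborel (\<lambda>x. cmod (indicator (box a b) x *\<^sub>R g x))"
        by (rule integrable_norm[OF int])
      show "AE x in lborel. (\<lambda>n. g x * cnj (complex_of_real (bump a b (1 / real (Suc n)) x))) \<longlonglongrightarrow> indicator (box a b) x *\<^sub>R g x"
      proof (rule always_eventually, rule allI)
        fix x
        have "(\<lambda>n. g x * complex_of_real (bump a b (1 / real (Suc n)) x)) \<longlonglongrightarrow> g x * complex_of_real (indicator (box a b) x)"
          by (intro tendsto_intros bump_tendsto_indicator)
        then show "(\<lambda>n. g x * cnj (complex_of_real (bump a b (1 / real (Suc n)) x))) \<longlonglongrightarrow> indicator (box a b) x *\<^sub>R g x"
          by (simp add: scaleR_conv_of_real mult.commute)
      qed
      show "AE x in lborel. cmod (g x * cnj (complex_of_real (bump a b (1 / real (Suc n)) x))) \<le> cmod (indicator (box a b) x *\<^sub>R g x)" for n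
      proof (rule always_eventually, rule allI)
        fix x
        show "cmod (g x * cnj (complex_of_real (bump a b (1 / real (Suc n)) x))) \<le> cmod (indicator (box a b) x *\<^sub>R g x)"
          using mult_right_mono[OF bump_le_indicator[of "1 / real (Suc n)" a b x], of "cmod (g x)"]
          by (simp add: norm_mult mult.commute)
      qed
    qed measurable
    moreover have "(LINT x|lborel. g x * cnj (complex_of_real (bump a b (1 / real (Suc n)) x))) = 0" for n
      by (intro orth bump_test_fun) simp
    ultimately show ?thesis
      by (simp add: LIMSEQ_const_iff)
  qed
  have "AE x in lborel. Re (g x) = 0"
  proof (rule AE_zero_if_box_integrals_zero)
    show "integrable lborel (\<lambda>x. indicator (box a b) x * Re (g x))" for a b
      using integrable_Re[OF int[of a b]] by simp
    show "(LINT x|lborel. indicator (box a b) x * Re (g x)) = 0" for a b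
      using integral_Re[OF int[of a b]] zero[of a b] by simp
  qed measurable
  moreover have "AE x in lborel. Im (g x) = 0"
  proof (rule AE_zero_if_box_integrals_zero)
    show "integrable lborel (\<lambda>x. indicator (box a b) x * Im (g x))" for a b
      using integrable_Im[OF int[of a b]] by simp
    show "(LINT x|lborel. indicator (box a b) x * Im (g x)) = 0" for a b
      using integral_Im[OF int[of a b]] zero[of a b] by simp
  qed measurable
  ultimately show ?thesis
    by eventually_elim (simp add: complex_eq_iff)
qed

lemma square_integrable_box:
  fixes g :: "real^3 \<Rightarrow> complex"
  assumes "square_integrable lborel g"
  shows "integrable lborel (\<lambda>x. indicator (box a b) x *\<^sub>R g x)"
proof -
  have "square_integrable lborel (\<lambda>x :: real^3. complex_of_real (indicator (box a b) x))"
    unfolding square_integrable_def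
  proof
    have "integrable lborel (indicator (box a b) :: real^3 \<Rightarrow> real)"
      by (rule integrable_real_indicator) (use emeasure_lborel_box_finite[of a b] in simp_all)
    moreover have "(\<lambda>x::real^3. (cmod (complex_of_real (indicator (box a b) x)))^2) = indicator (box a b)"
      by (auto simp: indicator_def)
    ultimately show "integrable lborel (\<lambda>x::real^3. (cmod (complex_of_real (indicator (box a b) x)))^2)" by simp
  qed measurable
  from square_integrable_mult[OF this assms] show ?thesis
    by (simp add: scaleR_conv_of_real)
qed

section \<open>The closed form and its operator\<close>

lemma smooth3_differentiable: "smooth3 f \<Longrightarrow> iter_pderiv3 is f differentiable at x"
  unfolding smooth3_def by (metis UNIV_I at_within_open_NO_MATCH differentiable_on_def open_UNIV)

lemma smooth3_C1:
  assumes "smooth3 f"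
  shows "C1 f"
  unfolding C1_def
proof (intro conjI allI)
  show "f differentiable at x" for x
    using smooth3_differentiable[OF assms, of "[]" x] by simp
  show "continuous_on UNIV (pderiv3 i f)" for i
    using smooth3_differentiable[OF assms, of "[i]"]
    by (auto intro!: continuous_at_imp_continuous_on differentiable_imp_continuous_within)
qed

lemma test_fun_C1c: "test_fun f \<Longrightarrow> C1c f"
  unfolding test_fun_def C1c_def
  by (metis bounded_subset closure_subset compact_imp_bounded smooth3_C1)

lemma smooth3_lin:
  assumes "smooth3 f" "smooth3 g"
  shows "smooth3 (\<lambda>x. f x + c * g x)"
proof -
  have "iter_pderiv3 is (\<lambda>x. f x + c * g x) = (\<lambda>x. iter_pderiv3 is f x + c * iter_pderiv3 is g x)" for "is"
  proof (induction "is")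
    case (Cons i "is")
    have "((\<lambda>x. iter_pderiv3 is f x + c * iter_pderiv3 is g x) has_derivative
        (\<lambda>h. ddir (iter_pderiv3 is f) x h + c * ddir (iter_pderiv3 is g) x h)) (at x)" for x
      by (intro has_derivative_add has_derivative_mult_right has_derivative_ddir smooth3_differentiable assms)
    from pderiv3_eqI[OF this] show ?case
      by (simp add: Cons.IH ddir_axis fun_eq_iff)
  qed simp
  moreover have "(\<lambda>x. iter_pderiv3 is f x + c * iter_pderiv3 is g x) differentiable_on UNIV" for "is"
    using assms unfolding smooth3_def by (intro differentiable_on_add differentiable_on_mult differentiable_on_const) auto
  ultimately show ?thesis by (simp add: smooth3_def)
qed

lemma test_fun_lin:
  assumes "test_fun f" "test_fun g"
  shows "test_fun (\<lambda>x. f x + c * g x)"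
proof -
  have "bounded {x. f x + c * g x \<noteq> 0}"
    using C1c_lin[OF test_fun_C1c test_fun_C1c, OF assms, of c] by (simp add: C1c_def)
  then show ?thesis
    using assms smooth3_lin by (auto simp: test_fun_def compact_closure)
qed

lemma test_fun_zero: "test_fun (\<lambda>x. 0)"
proof -
  have "(\<lambda>x. 0) \<in> flat_algebra" by (rule flat_algebra.const)
  then show ?thesis by (simp add: test_fun_def flat_algebra_smooth)
qed

text \<open>
  The fifth power of decay is ample: balls of radius \<open>n\<close> have volume of order \<open>n\<^sup>3\<close>.
\<close>

lemma schwartz_square_integrable:
  assumes "schwartz f"
  shows "square_integrable lborel f"
proof -
  have "smooth3 f" using assms by (simp add: schwartz_def)
  then have [measurable]: "f \<in> borel_measurable borel" by (intro C1_measurable smooth3_C1)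
  obtain B0 where B0: "\<And>x. cmod (f x) \<le> B0"
    using assms[unfolded schwartz_def, THEN conjunct2, rule_format, of 0 "[]"] by auto
  obtain B5 where B5: "\<And>x. (1 + norm x)^5 * cmod (f x) \<le> B5"
    using assms[unfolded schwartz_def, THEN conjunct2, rule_format, of 5 "[]"] by auto
  have B0_nonneg: "0 \<le> B0" using B0[of 0] norm_ge_zero order_trans by blast
  have B5_nonneg: "0 \<le> B5" using order_trans[OF norm_ge_zero[of "f 0"], of B5] B5[of 0] by simp
  have le: "ennreal ((cmod (f x))^2) \<le> (\<Sum>n. ennreal (B0 * B5 / real (Suc n)^5) * indicator (cball 0 (real (Suc n))) x)" for x
  proof -
    define n where "n = nat \<lfloor>norm x\<rfloor>"
    have n: "real n \<le> norm x" "norm x \<le> real (Suc n)"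
      unfolding n_def using norm_ge_zero[of x] by linarith+
    have "real (Suc n)^5 * cmod (f x) \<le> (1 + norm x)^5 * cmod (f x)"
      using n by (intro mult_right_mono power_mono) auto
    then have "real (Suc n)^5 * cmod (f x) \<le> B5" using B5[of x] by linarith
    then have "cmod (f x) \<le> B5 / real (Suc n)^5"
      by (simp add: pos_le_divide_eq mult.commute)
    then have "cmod (f x) * cmod (f x) \<le> B0 * (B5 / real (Suc n)^5)"
      by (intro mult_mono B0 B0_nonneg) auto
    then have "ennreal ((cmod (f x))^2) \<le> ennreal (B0 * B5 / real (Suc n)^5) * indicator (cball 0 (real (Suc n))) x"
      using n by (simp add: power2_eq_square ennreal_leI)
    also have "\<dots> = (\<Sum>j\<in>{n}. ennreal (B0 * B5 / real (Suc j)^5) * indicator (cball 0 (real (Suc j))) x)"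
      by (subst sum.insert) simp_all
    also have "\<dots> \<le> (\<Sum>j. ennreal (B0 * B5 / real (Suc j)^5) * indicator (cball 0 (real (Suc j))) x)"
      by (rule sum_le_suminf) auto
    finally show ?thesis .
  qed
  have fin: "(\<integral>\<^sub>+x. ennreal ((cmod (f x))^2)) < \<infinity>"
  proof (rule nn_integral_finite_if_ball_series[OF le])
    have "B0 * B5 / real (Suc n)^5 * real (Suc n)^3 = (B0 * B5) * inverse (real (Suc n)^2)" for n
    proof -
      have "real (Suc n)^5 = real (Suc n)^3 * real (Suc n)^2" by (simp add: power_add[symmetric])
      then show ?thesis by (simp add: divide_simps del: of_nat_Suc)
    qed
    then show "summable (\<lambda>n. B0 * B5 / real (Suc n)^5 * real (Suc n)^3)"
      using inverse_power_summable[of 2, where 'a=real]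
      by (simp only:) (intro summable_mult, subst summable_Suc_iff[of "\<lambda>n. inverse (real n ^ 2)"], simp)
  qed (use B0_nonneg B5_nonneg in simp_all)
  have "integrable lborel (\<lambda>x. (cmod (f x))^2)"
    by (rule integrableI_bounded) (use fin in simp_all)
  then show ?thesis by (simp add: square_integrable_def)
qed

definition inner_Q :: "(real^3 \<Rightarrow> complex) \<Rightarrow> (real^3 \<Rightarrow> complex) \<Rightarrow> complex" where
  "inner_Q u v = inner_L2 lborel u v + Qform u v"

lemma T_lin: "C1 u \<Longrightarrow> C1 v \<Longrightarrow> T i (\<lambda>x. u x + c * v x) = (\<lambda>x. T i u x + c * T i v x)"
  by (rule ext) (simp add: T_def pderiv3_lin distrib_left mult.left_commute)

lemma T_diff: "C1 u \<Longrightarrow> C1 v \<Longrightarrow> T i (\<lambda>x. u x - v x) = (\<lambda>x. T i u x - T i v x)"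
  using T_lin[of u v i "-1"] by simp

lemma test_fun_square_integrable: "test_fun u \<Longrightarrow> square_integrable lborel u"
  by (intro C1c_square_integrable test_fun_C1c)

lemma test_fun_square_integrable_T: "test_fun u \<Longrightarrow> square_integrable lborel (T i u)"
  by (intro C1c_square_integrable_T test_fun_C1c)

lemma test_fun_diff: "test_fun u \<Longrightarrow> test_fun v \<Longrightarrow> test_fun (\<lambda>x. u x - v x)"
  using test_fun_lin[of u v "-1"] by simp

lemma Qform_test_fun: "test_fun u \<Longrightarrow> test_fun v \<Longrightarrow> Qform u v = (\<Sum>i\<in>UNIV. inner_L2 lborel (T i u) (T i v))"
  by (intro Qform_eq_T test_fun_C1c)

lemma inner_L2_power2: "inner_L2 M u u = complex_of_real ((norm_L2 M u)^2)"
  by (simp add: inner_L2_self norm_L2_def del: of_real_power)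

lemma Qform_self: "test_fun u \<Longrightarrow> Qform u u = complex_of_real (\<Sum>i\<in>UNIV. (norm_L2 lborel (T i u))^2)"
  by (simp add: Qform_test_fun inner_L2_power2 del: of_real_power)

lemma semi_inner_product_test_L2: "semi_inner_product {u. test_fun u} (inner_L2 lborel)"
proof
  show "{u. test_fun u} \<noteq> {}" using test_fun_zero by blast
qed (auto intro: test_fun_lin L2_lin_left L2_hermitian test_fun_square_integrable simp: inner_L2_power2 simp del: of_real_power)

lemma semi_inner_product_test_Q: "semi_inner_product {u. test_fun u} inner_Q"
proof
  show "{u. test_fun u} \<noteq> {}" using test_fun_zero by blast
  show "inner_Q (\<lambda>x. u x + c * v x) w = inner_Q u w + c * inner_Q v w"
    if "u \<in> {u. test_fun u}" "v \<in> {u. test_fun u}" "w \<in> {u. test_fun u}" for u v w c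
    using that
    by (simp add: inner_Q_def Qform_test_fun test_fun_lin T_lin C1cD test_fun_C1c L2_lin_left
        test_fun_square_integrable test_fun_square_integrable_T sum.distrib sum_distrib_left algebra_simps)
  show "inner_Q v u = cnj (inner_Q u v)" if "u \<in> {u. test_fun u}" "v \<in> {u. test_fun u}" for u v
  proof -
    have "inner_L2 lborel v u = cnj (inner_L2 lborel u v)"
      using that by (intro L2_hermitian test_fun_square_integrable) simp_all
    moreover have "inner_L2 lborel (T i v) (T i u) = cnj (inner_L2 lborel (T i u) (T i v))" for i
      using that by (intro L2_hermitian test_fun_square_integrable_T) simp_all
    ultimately show ?thesis
      using that by (simp add: inner_Q_def Qform_test_fun)
  qed
  show "0 \<le> Re (inner_Q u u)" if "u \<in> {u. test_fun u}" for u
    using that by (simp add: inner_Q_def Qform_self inner_L2_power2 sum_nonneg del: of_real_power of_real_sum)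
qed (auto intro: test_fun_lin)

lemma N_test_Q: "semi_inner_product.N inner_Q u = Qnorm u"
  by (simp add: semi_inner_product.N_def[OF semi_inner_product_test_Q] inner_Q_def Qnorm_def inner_L2_power2 Lp_norm_2 del: of_real_power)

lemma norm_le_Qnorm:
  assumes "test_fun u"
  shows "norm_L2 lborel u \<le> Qnorm u" "norm_L2 lborel (T i u) \<le> Qnorm u"
proof -
  have Q: "Qnorm u = sqrt ((norm_L2 lborel u)^2 + (\<Sum>i\<in>UNIV. (norm_L2 lborel (T i u))^2))"
    using assms by (simp add: Qnorm_def Lp_norm_2 Qform_self del: of_real_power of_real_sum)
  have "(norm_L2 lborel (T i u))^2 \<le> (\<Sum>i\<in>UNIV. (norm_L2 lborel (T i u))^2)"
    by (rule member_le_sum) auto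
  then show "norm_L2 lborel (T i u) \<le> Qnorm u"
    unfolding Q by (intro real_le_rsqrt) (simp add: add_increasing)
  show "norm_L2 lborel u \<le> Qnorm u"
    unfolding Q by (intro real_le_rsqrt) (simp add: sum_nonneg)
qed

text \<open>
  The values of the closure of \<open>T\<close>, component by component.
\<close>

definition is_T_limit :: "(nat \<Rightarrow> real^3 \<Rightarrow> complex) \<Rightarrow> (3 \<Rightarrow> real^3 \<Rightarrow> complex) \<Rightarrow> bool" where
  "is_T_limit us g \<longleftrightarrow> (\<forall>i. square_integrable lborel (g i) \<and> (\<lambda>n. norm_L2 lborel (\<lambda>x. T i (us n) x - g i x)) \<longlonglongrightarrow> 0)"

lemma Q_approxD:
  assumes "Q_approx us u"
  shows "test_fun (us n)" "square_integrable lborel u" "(\<lambda>n. norm_L2 lborel (\<lambda>x. us n x - u x)) \<longlonglongrightarrow> 0"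
  using assms by (simp_all add: Q_approx_def in_Lp_2 Lp_norm_2)

lemma Q_approx_T_limit:
  assumes "Q_approx us u"
  obtains g where "is_T_limit us g"
proof -
  note test = Q_approxD(1)[OF assms]
  have "\<exists>g. square_integrable lborel g \<and> (\<lambda>n. norm_L2 lborel (\<lambda>x. T i (us n) x - g x)) \<longlonglongrightarrow> 0" for i
  proof -
    obtain g where "square_integrable lborel g" "(\<lambda>n. norm_L2 lborel (\<lambda>x. T i (us n) x - g x)) \<longlonglongrightarrow> 0"
    proof (rule L2_complete[of lborel "\<lambda>n. T i (us n)"])
      show "square_integrable lborel (T i (us n))" for n
        by (rule test_fun_square_integrable_T[OF test])
      fix e :: real assume "e > 0"
      then obtain K where K: "\<And>m n. m \<ge> K \<Longrightarrow> n \<ge> K \<Longrightarrow> Qnorm (\<lambda>x. us m x - us n x) < e"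
        using assms unfolding Q_approx_def by metis
      have "norm_L2 lborel (\<lambda>x. T i (us m) x - T i (us n) x) < e" if "m \<ge> K" "n \<ge> K" for m n
        using le_less_trans[OF norm_le_Qnorm(2)[OF test_fun_diff[OF test test]] K[OF that], of i]
        by (simp add: T_diff C1cD test_fun_C1c test)
      then show "\<exists>K. \<forall>m\<ge>K. \<forall>n\<ge>K. norm_L2 lborel (\<lambda>x. T i (us m) x - T i (us n) x) < e" by blast
    qed
    then show ?thesis by blast
  qed
  then have "\<exists>g. is_T_limit us g"
    unfolding is_T_limit_def by (rule choice[OF allI])
  then show thesis using that by blast
qed

text \<open>
  The formal adjoint of \<open>T\<close> applied to \<open>|x|\<^sup>2 \<psi>\<close>. The factor \<open>|x|\<^sup>2\<close> keeps the result bounded near the origin.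
\<close>

definition T_adjoint :: "3 \<Rightarrow> (real^3 \<Rightarrow> complex) \<Rightarrow> real^3 \<Rightarrow> complex" where
  "T_adjoint i \<psi> x = - pderiv3 i (\<lambda>x. complex_of_real ((norm x)^2) * \<psi> x) x + complex_of_real (x $ i / 2) * \<psi> x"

lemma T_adjoint:
  assumes u: "C1c u" and \<psi>: "C1c \<psi>"
  shows "inner_L2 lborel (T i u) (\<lambda>x. complex_of_real ((norm x)^2) * \<psi> x) = inner_L2 lborel u (T_adjoint i \<psi>)"
    and "square_integrable lborel (T_adjoint i \<psi>)"
proof -
  define \<phi> where "\<phi> x = complex_of_real ((norm x)^2) * \<psi> x" for x
  have \<phi>: "C1c \<phi>" unfolding \<phi>_def by (rule C1c_mult[OF C1_norm_power2 \<psi>])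
  obtain R where R: "\<And>x. norm x > R \<Longrightarrow> \<psi> x = 0" using C1c_support[OF \<psi>] by metis
  have s: "square_integrable lborel (\<lambda>x. complex_of_real (x $ i / 2) * \<psi> x)"
    by (rule compact_support_square_integrable[of _ R])
      (intro continuous_intros C1_continuous C1cD \<psi>, simp_all add: R)
  have adj: "T_adjoint i \<psi> = (\<lambda>x. complex_of_real (x $ i / 2) * \<psi> x + (-1) * pderiv3 i \<phi> x)"
    by (rule ext) (simp add: T_adjoint_def \<phi>_def[abs_def])
  show sq: "square_integrable lborel (T_adjoint i \<psi>)"
    unfolding adj by (rule square_integrable_lin[OF s C1c_square_integrable_pderiv3[OF \<phi>]])
  have w: "C1c (\<lambda>x. u x * cnj (\<phi> x))" by (intro C1c_mult C1c_cnj C1cD u \<phi>)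
  have dw: "pderiv3 i (\<lambda>x. u x * cnj (\<phi> x)) x = u x * cnj (pderiv3 i \<phi> x) + pderiv3 i u x * cnj (\<phi> x)" for x
    by (simp add: pderiv3_mult pderiv3_cnj C1_cnj C1cD u \<phi>)
  have pw: "T i u x * cnj (\<phi> x) = pderiv3 i (\<lambda>x. u x * cnj (\<phi> x)) x + u x * cnj (T_adjoint i \<psi> x)" for x
  proof -
    have "complex_of_real (x $ i / (2 * (norm x)^2)) * cnj (\<phi> x) = complex_of_real (x $ i / 2) * cnj (\<psi> x)"
      by (cases "x = 0") (simp_all add: \<phi>_def)
    then have "complex_of_real (x $ i / (2 * (norm x)^2)) * u x * cnj (\<phi> x) = u x * (complex_of_real (x $ i / 2) * cnj (\<psi> x))"
      by (simp only: mult.assoc mult.left_commute)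
    then show ?thesis
      unfolding dw adj T_def by (simp only: distrib_right distrib_left complex_cnj_add complex_cnj_mult) simp
  qed
  have "inner_L2 lborel (T i u) \<phi> = (LINT x|lborel. pderiv3 i (\<lambda>x. u x * cnj (\<phi> x)) x + u x * cnj (T_adjoint i \<psi> x))"
    by (simp add: inner_L2_def pw)
  also have "\<dots> = (LINT x|lborel. pderiv3 i (\<lambda>x. u x * cnj (\<phi> x)) x) + (LINT x|lborel. u x * cnj (T_adjoint i \<psi> x))"
    by (intro Bochner_Integration.integral_add C1c_integrable_pderiv3 w square_integrable_inner C1c_square_integrable u sq)
  also have "\<dots> = inner_L2 lborel u (T_adjoint i \<psi>)"
    by (simp add: integral_pderiv3_eq_0[OF w] inner_L2_def)
  finally show "inner_L2 lborel (T i u) (\<lambda>x. complex_of_real ((norm x)^2) * \<psi> x) = inner_L2 lborel u (T_adjoint i \<psi>)"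
    unfolding \<phi>_def[abs_def] .
qed

lemma L2_inner_tendsto_left:
  assumes "\<And>n. square_integrable M (us n)" "square_integrable M u" "(\<lambda>n. norm_L2 M (\<lambda>x. us n x - u x)) \<longlonglongrightarrow> 0"
    "square_integrable M v"
  shows "(\<lambda>n. inner_L2 M (us n) v) \<longlonglongrightarrow> inner_L2 M u v"
  by (rule L2_inner_tendsto[where vs="\<lambda>_. v"]) (use assms in \<open>simp_all add: norm_L2_def\<close>)

lemma L2_inner_tendsto_right:
  assumes "\<And>n. square_integrable M (us n)" "square_integrable M u" "(\<lambda>n. norm_L2 M (\<lambda>x. us n x - u x)) \<longlonglongrightarrow> 0"
    "square_integrable M v"
  shows "(\<lambda>n. inner_L2 M v (us n)) \<longlonglongrightarrow> inner_L2 M v u"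
  by (rule L2_inner_tendsto[where us="\<lambda>_. v"]) (use assms in \<open>simp_all add: norm_L2_def\<close>)

lemma inner_T_limit:
  assumes "Q_approx us u" "is_T_limit us g" "test_fun \<psi>"
  shows "inner_L2 lborel (g i) (\<lambda>x. complex_of_real ((norm x)^2) * \<psi> x) = inner_L2 lborel u (T_adjoint i \<psi>)"
proof -
  have \<psi>: "C1c \<psi>" by (rule test_fun_C1c) fact
  have \<phi>: "square_integrable lborel (\<lambda>x. complex_of_real ((norm x)^2) * \<psi> x)"
    by (rule C1c_square_integrable[OF C1c_mult[OF C1_norm_power2 \<psi>]])
  note test = Q_approxD(1)[OF assms(1)]
  have "(\<lambda>n. inner_L2 lborel (T i (us n)) (\<lambda>x. complex_of_real ((norm x)^2) * \<psi> x))
      \<longlonglongrightarrow> inner_L2 lborel (g i) (\<lambda>x. complex_of_real ((norm x)^2) * \<psi> x)"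
    using assms(2) by (intro L2_inner_tendsto_left test_fun_square_integrable_T test \<phi>) (auto simp: is_T_limit_def)
  moreover have "(\<lambda>n. inner_L2 lborel (us n) (T_adjoint i \<psi>)) \<longlonglongrightarrow> inner_L2 lborel u (T_adjoint i \<psi>)"
    by (intro L2_inner_tendsto_left test_fun_square_integrable test Q_approxD[OF assms(1)] T_adjoint(2)[OF \<psi> \<psi>])
  ultimately show ?thesis
    unfolding T_adjoint(1)[OF test_fun_C1c[OF test] \<psi>] by (rule LIMSEQ_unique)
qed

text \<open>
  Closability: pairing with \<open>|x|\<^sup>2 \<psi>\<close> and moving \<open>T\<close> to the other side expresses the limit through \<open>u\<close> alone, and
  the functions \<open>|x|\<^sup>2 \<psi>\<close> are sufficiently many because the origin is a null set.
\<close>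

proposition T_limit_unique:
  assumes "Q_approx us u" "is_T_limit us g" "Q_approx us' u" "is_T_limit us' g'"
  shows "AE x in lborel. g i x = g' i x"
proof -
  have sq: "square_integrable lborel (g i)" "square_integrable lborel (g' i)"
    using assms by (simp_all add: is_T_limit_def)
  define d where "d x = g i x - g' i x" for x
  have d: "square_integrable lborel d" unfolding d_def by (intro square_integrable_diff sq)
  have dm [measurable]: "d \<in> borel_measurable borel" using d by (simp add: square_integrable_def)
  have "AE x in lborel. complex_of_real ((norm x)^2) * d x = 0"
  proof (rule AE_zero_if_orthogonal_to_test_fun)
    show "integrable lborel (\<lambda>x. indicator (box a b) x *\<^sub>R (complex_of_real ((norm x)^2) * d x))" for a b :: "real^3"
    proof -
      have "bounded ((\<lambda>x::real^3. (norm x)^2) ` cbox a b)"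
        by (intro compact_imp_bounded compact_continuous_image continuous_intros) simp
      then obtain B where B: "B > 0" "\<And>x. x \<in> cbox a b \<Longrightarrow> (norm x)^2 \<le> B"
        by (auto simp: bounded_pos)
      show ?thesis
      proof (rule Bochner_Integration.integrable_bound)
        show "integrable lborel (\<lambda>x. B *\<^sub>R (indicator (box a b) x *\<^sub>R d x))"
          by (intro integrable_scaleR_right square_integrable_box d)
        show "AE x in lborel. norm (indicator (box a b) x *\<^sub>R (complex_of_real ((norm x)^2) * d x))
            \<le> norm (B *\<^sub>R (indicator (box a b) x *\<^sub>R d x))"
        proof (rule always_eventually, rule allI)
          fix x
          show "norm (indicator (box a b) x *\<^sub>R (complex_of_real ((norm x)^2) * d x))
            \<le> norm (B *\<^sub>R (indicator (box a b) x *\<^sub>R d x))"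
            using B box_subset_cbox[of a b]
            by (cases "x \<in> box a b") (auto simp: norm_mult norm_power intro!: mult_right_mono)
        qed
      qed measurable
    qed
    fix \<psi> assume \<psi>: "test_fun \<psi>"
    define \<phi> where "\<phi> x = complex_of_real ((norm x)^2) * \<psi> x" for x
    have \<phi>: "square_integrable lborel \<phi>"
      unfolding \<phi>_def by (rule C1c_square_integrable[OF C1c_mult[OF C1_norm_power2 test_fun_C1c[OF \<psi>]]])
    have "inner_L2 lborel (g i) \<phi> = inner_L2 lborel (g' i) \<phi>"
      unfolding \<phi>_def using inner_T_limit[OF assms(1,2) \<psi>] inner_T_limit[OF assms(3,4) \<psi>] by simp
    moreover have "inner_L2 lborel d \<phi> = inner_L2 lborel (g i) \<phi> - inner_L2 lborel (g' i) \<phi>"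
      using L2_lin_left[OF sq \<phi>, of "-1"] by (simp add: d_def[abs_def])
    ultimately have "inner_L2 lborel d \<phi> = 0" by simp
    then show "(LINT x|lborel. complex_of_real ((norm x)^2) * d x * cnj (\<psi> x)) = 0"
      by (simp add: inner_L2_def \<phi>_def mult.assoc mult.left_commute)
  qed measurable
  with AE_lborel_singleton[of 0] show ?thesis
    by eventually_elim (simp add: d_def)
qed

lemma Qbar_eq:
  assumes "Q_approx us u" "is_T_limit us g" "Q_approx vs v" "is_T_limit vs h"
  shows "Qbar u v = (\<Sum>i\<in>UNIV. inner_L2 lborel (g i) (h i))"
proof -
  have conv: "(\<lambda>n. Qform (us' n) (vs' n)) \<longlonglongrightarrow> (\<Sum>i\<in>UNIV. inner_L2 lborel (g i) (h i))"
    if us': "Q_approx us' u" and vs': "Q_approx vs' v" for us' vs'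
  proof -
    obtain g' h' where g': "is_T_limit us' g'" and h': "is_T_limit vs' h'"
      using Q_approx_T_limit[OF us'] Q_approx_T_limit[OF vs'] by metis
    have "inner_L2 lborel (g' i) (h' i) = inner_L2 lborel (g i) (h i)" for i
      unfolding inner_L2_def
    proof (rule Bochner_Integration.integral_cong_AE)
      have "square_integrable lborel (g i)" "square_integrable lborel (h i)"
        "square_integrable lborel (g' i)" "square_integrable lborel (h' i)"
        using assms g' h' by (simp_all add: is_T_limit_def)
      then show "(\<lambda>x. g i x * cnj (h i x)) \<in> borel_measurable lborel" "(\<lambda>x. g' i x * cnj (h' i x)) \<in> borel_measurable lborel"
        by (simp_all only: borel_measurable_integrable[OF square_integrable_inner])
      show "AE x in lborel. g' i x * cnj (h' i x) = g i x * cnj (h i x)"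
        using T_limit_unique[OF us' g' assms(1,2), of i] T_limit_unique[OF vs' h' assms(3,4), of i]
        by eventually_elim simp
    qed
    moreover have "(\<lambda>n. \<Sum>i\<in>UNIV. inner_L2 lborel (T i (us' n)) (T i (vs' n))) \<longlonglongrightarrow> (\<Sum>i\<in>UNIV. inner_L2 lborel (g' i) (h' i))"
      using g' h' unfolding is_T_limit_def
      by (intro tendsto_sum L2_inner_tendsto test_fun_square_integrable_T Q_approxD(1)[OF us'] Q_approxD(1)[OF vs']) auto
    ultimately show ?thesis
      by (simp add: Qform_test_fun Q_approxD(1)[OF us'] Q_approxD(1)[OF vs'])
  qed
  show ?thesis
    unfolding Qbar_def
  proof (rule the_equality)
    show "\<forall>us vs. Q_approx us u \<longrightarrow> Q_approx vs v \<longrightarrow> (\<lambda>n. Qform (us n) (vs n)) \<longlonglongrightarrow> (\<Sum>i\<in>UNIV. inner_L2 lborel (g i) (h i))"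
      using conv by blast
    show "q = (\<Sum>i\<in>UNIV. inner_L2 lborel (g i) (h i))"
      if "\<forall>us vs. Q_approx us u \<longrightarrow> Q_approx vs v \<longrightarrow> (\<lambda>n. Qform (us n) (vs n)) \<longlonglongrightarrow> q" for q
      using that assms(1,3) conv[OF assms(1,3)] LIMSEQ_unique by blast
  qed
qed

lemma Qnorm_0: "Qnorm (\<lambda>x. 0) = 0"
  using semi_inner_product.N_power2[OF semi_inner_product_test_Q, of "\<lambda>x. 0"] test_fun_zero
  by (simp add: Qnorm_def Lp_norm_def Qform_self T_def pderiv3_def norm_L2_def)

lemma Q_approx_const: "test_fun v \<Longrightarrow> Q_approx (\<lambda>_. v) v"
  by (simp add: Q_approx_def Qnorm_0 in_Lp_2 test_fun_square_integrable Lp_norm_2 norm_L2_def)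

lemma is_T_limit_const: "test_fun v \<Longrightarrow> is_T_limit (\<lambda>_. v) (\<lambda>i. T i v)"
  by (simp add: is_T_limit_def test_fun_square_integrable_T norm_L2_def)

lemma Qbar_test:
  "Q_approx us u \<Longrightarrow> is_T_limit us g \<Longrightarrow> test_fun v \<Longrightarrow> Qbar u v = (\<Sum>i\<in>UNIV. inner_L2 lborel (g i) (T i v))"
  by (rule Qbar_eq[OF _ _ Q_approx_const is_T_limit_const])

text \<open>
  Both sides are continuous along approximating sequences of \<open>v\<close>.
\<close>

lemma Qbar_eq_inner_extend:
  assumes u: "u \<in> Qbar_dom" and k: "square_integrable lborel k"
    and eq: "\<And>w. test_fun w \<Longrightarrow> Qbar u w = inner_L2 lborel k w" and v: "v \<in> Qbar_dom"
  shows "Qbar u v = inner_L2 lborel k v"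
proof -
  obtain us where us: "Q_approx us u" using u by (auto simp: Qbar_dom_def)
  obtain vs where vs: "Q_approx vs v" using v by (auto simp: Qbar_dom_def)
  obtain g where g: "is_T_limit us g" using Q_approx_T_limit[OF us] by metis
  obtain h where h: "is_T_limit vs h" using Q_approx_T_limit[OF vs] by metis
  note test = Q_approxD(1)[OF vs]
  have "(\<lambda>n. \<Sum>i\<in>UNIV. inner_L2 lborel (g i) (T i (vs n))) \<longlonglongrightarrow> (\<Sum>i\<in>UNIV. inner_L2 lborel (g i) (h i))"
    using g h unfolding is_T_limit_def
    by (intro tendsto_sum L2_inner_tendsto_right test_fun_square_integrable_T test) auto
  then have "(\<lambda>n. inner_L2 lborel k (vs n)) \<longlonglongrightarrow> Qbar u v"
    by (simp only: Qbar_eq[OF us g vs h] eq[OF test, symmetric] Qbar_test[OF us g test])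
  moreover have "(\<lambda>n. inner_L2 lborel k (vs n)) \<longlonglongrightarrow> inner_L2 lborel k v"
    by (intro L2_inner_tendsto_right test_fun_square_integrable test Q_approxD[OF vs] k)
  ultimately show ?thesis by (rule LIMSEQ_unique)
qed

lemma Qbar_dom_test: "test_fun v \<Longrightarrow> v \<in> Qbar_dom"
  unfolding Qbar_dom_def using Q_approx_const by blast

lemma inner_L2_unique:
  assumes "square_integrable lborel k" "square_integrable lborel k'"
    and "\<And>w. test_fun w \<Longrightarrow> inner_L2 lborel k w = inner_L2 lborel k' w"
  shows "AE x in lborel. k x = k' x"
proof -
  have d: "square_integrable lborel (\<lambda>x. k x - k' x)" by (intro square_integrable_diff assms)
  have "AE x in lborel. k x - k' x = 0"
  proof (rule AE_zero_if_orthogonal_to_test_fun)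
    show "(\<lambda>x. k x - k' x) \<in> borel_measurable borel" using d by (simp add: square_integrable_def)
    show "integrable lborel (\<lambda>x. indicator (box a b) x *\<^sub>R (k x - k' x))" for a b :: "real^3"
      by (rule square_integrable_box[OF d])
    fix \<psi> assume "test_fun \<psi>"
    with assms L2_lin_left[OF assms(1,2) test_fun_square_integrable, of \<psi> "-1"]
    show "(LINT x|lborel. (k x - k' x) * cnj (\<psi> x)) = 0"
      by (simp add: inner_L2_def)
  qed
  then show ?thesis by eventually_elim simp
qed

text \<open>
  The functional \<open>v \<mapsto> Qbar u v\<close> is bounded in the \<open>L\<^sup>2\<close> norm by the definition of the domain, so its weak
  representers, taken with respect to the \<open>L\<^sup>2\<close> product on test functions, converge in \<open>L\<^sup>2\<close>.
\<close>

lemma H_dom_representer: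
  assumes u: "u \<in> H_dom"
  obtains k where "square_integrable lborel k" "\<And>v. v \<in> Qbar_dom \<Longrightarrow> Qbar u v = inner_L2 lborel k v"
proof -
  have uQ: "u \<in> Qbar_dom" using u by (simp add: H_dom_def)
  then obtain us where us: "Q_approx us u" by (auto simp: Qbar_dom_def)
  obtain g where g: "is_T_limit us g" using Q_approx_T_limit[OF us] by metis
  have gsq: "square_integrable lborel (g i)" for i using g by (simp add: is_T_limit_def)
  obtain C where C: "\<And>v. v \<in> Qbar_dom \<Longrightarrow> cmod (Qbar u v) \<le> C * norm_L2 lborel v"
    using u by (auto simp: H_dom_def Lp_norm_2)
  have anti: "Qbar u (\<lambda>x. v x + c * w x) = Qbar u v + cnj c * Qbar u w"
    if "v \<in> {u. test_fun u}" "w \<in> {u. test_fun u}" for v w c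
    using that
    by (simp add: Qbar_test[OF us g] test_fun_lin T_lin C1cD test_fun_C1c L2_lin_right
        test_fun_square_integrable_T gsq sum.distrib sum_distrib_left)
  have bound: "cmod (Qbar u v) \<le> C * semi_inner_product.N (inner_L2 lborel) v" if "v \<in> {u. test_fun u}" for v
    using that C[OF Qbar_dom_test] by (simp add: N_L2)
  obtain ks where ks: "\<And>n. ks n \<in> {u. test_fun u}"
    and cauchy: "\<And>e. e > 0 \<Longrightarrow> \<exists>K. \<forall>m\<ge>K. \<forall>n\<ge>K. semi_inner_product.N (inner_L2 lborel) (\<lambda>x. ks m x - ks n x) < e"
    and conv: "\<And>w. w \<in> {u. test_fun u} \<Longrightarrow> (\<lambda>n. inner_L2 lborel (ks n) w) \<longlonglongrightarrow> Qbar u w"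
    using semi_inner_product.weak_representer[OF semi_inner_product_test_L2, of "Qbar u" C] anti bound by blast
  have sq: "square_integrable lborel (ks n)" for n using ks test_fun_square_integrable by simp
  obtain k where k: "square_integrable lborel k" "(\<lambda>n. norm_L2 lborel (\<lambda>x. ks n x - k x)) \<longlonglongrightarrow> 0"
    by (rule L2_complete[OF sq cauchy[unfolded N_L2]])
  have "Qbar u w = inner_L2 lborel k w" if "test_fun w" for w
    using LIMSEQ_unique[OF conv L2_inner_tendsto_left[OF sq k test_fun_square_integrable[OF that]]] that by simp
  then show thesis
    using that k(1) Qbar_eq_inner_extend[OF uQ k(1)] by blast
qed

lemma H_op_spec:
  assumes "u \<in> H_dom"
  shows "square_integrable lborel (H_op u)" "\<And>v. v \<in> Qbar_dom \<Longrightarrow> Qbar u v = inner_L2 lborel (H_op u) v"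
proof -
  obtain k where "square_integrable lborel k" "\<And>v. v \<in> Qbar_dom \<Longrightarrow> Qbar u v = inner_L2 lborel k v"
    by (rule H_dom_representer[OF assms]) blast
  then have "\<exists>g. in_Lp 2 g \<and> (\<forall>v\<in>Qbar_dom. Qbar u v = L2_inner g v)"
    unfolding in_Lp_2 L2_inner_eq by blast
  from someI_ex[OF this, folded H_op_def]
  show "square_integrable lborel (H_op u)" "\<And>v. v \<in> Qbar_dom \<Longrightarrow> Qbar u v = inner_L2 lborel (H_op u) v"
    unfolding in_Lp_2 L2_inner_eq by auto
qed

text \<open>
  Weak representers of \<open>v \<mapsto> \<langle>f, v\<rangle>\<close> with respect to \<open>Q + \<langle>\<cdot>, \<cdot>\<rangle>\<close> form an approximating sequence
  in the sense of the closed form, and their limit solves the equation weakly.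
\<close>

proposition H_plus_1_surjective:
  assumes f: "square_integrable lborel f"
  obtains u where "u \<in> H_dom" "AE x in lborel. H_op u x + u x = f x"
proof -
  have anti: "inner_L2 lborel f (\<lambda>x. v x + c * w x) = inner_L2 lborel f v + cnj c * inner_L2 lborel f w"
    if "v \<in> {u. test_fun u}" "w \<in> {u. test_fun u}" for v w c
    using that by (simp add: L2_lin_right test_fun_square_integrable f)
  have bound: "cmod (inner_L2 lborel f v) \<le> norm_L2 lborel f * semi_inner_product.N inner_Q v"
    if "v \<in> {u. test_fun u}" for v
  proof -
    have "cmod (inner_L2 lborel f v) \<le> norm_L2 lborel f * norm_L2 lborel v"
      using that by (intro L2_Cauchy_Schwarz f test_fun_square_integrable) simp
    also have "\<dots> \<le> norm_L2 lborel f * Qnorm v"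
      using that by (intro mult_left_mono norm_le_Qnorm) (simp_all add: norm_L2_def)
    finally show ?thesis by (simp add: N_test_Q)
  qed
  obtain us where us: "\<And>n. us n \<in> {u. test_fun u}"
    and cauchy: "\<And>e. e > 0 \<Longrightarrow> \<exists>K. \<forall>m\<ge>K. \<forall>n\<ge>K. semi_inner_product.N inner_Q (\<lambda>x. us m x - us n x) < e"
    and conv: "\<And>w. w \<in> {u. test_fun u} \<Longrightarrow> (\<lambda>n. inner_Q (us n) w) \<longlonglongrightarrow> inner_L2 lborel f w"
    using semi_inner_product.weak_representer[OF semi_inner_product_test_Q, of "inner_L2 lborel f" "norm_L2 lborel f"] anti bound by blast
  have test: "test_fun (us n)" for n using us by simp
  have sq: "square_integrable lborel (us n)" for n by (rule test_fun_square_integrable[OF test])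
  have cauchy2: "\<exists>K. \<forall>m\<ge>K. \<forall>n\<ge>K. norm_L2 lborel (\<lambda>x. us m x - us n x) < e" if "e > 0" for e
    using cauchy[OF that] norm_le_Qnorm(1)[OF test_fun_diff[OF test test]] unfolding N_test_Q by (meson le_less_trans)
  obtain u where u: "square_integrable lborel u" "(\<lambda>n. norm_L2 lborel (\<lambda>x. us n x - u x)) \<longlonglongrightarrow> 0"
    by (rule L2_complete[OF sq cauchy2])
  have ap: "Q_approx us u"
    using test cauchy u by (simp add: Q_approx_def N_test_Q in_Lp_2 Lp_norm_2)
  have uQ: "u \<in> Qbar_dom" using ap by (auto simp: Qbar_dom_def)
  obtain g where g: "is_T_limit us g" using Q_approx_T_limit[OF ap] by metis
  have fu: "square_integrable lborel (\<lambda>x. f x - u x)" by (intro square_integrable_diff f u)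
  have eq: "Qbar u w = inner_L2 lborel (\<lambda>x. f x - u x) w" if w: "test_fun w" for w
  proof -
    have wsq: "square_integrable lborel w" by (rule test_fun_square_integrable[OF w])
    have "(\<lambda>n. \<Sum>i\<in>UNIV. inner_L2 lborel (T i (us n)) (T i w)) \<longlonglongrightarrow> (\<Sum>i\<in>UNIV. inner_L2 lborel (g i) (T i w))"
      using g unfolding is_T_limit_def
      by (intro tendsto_sum L2_inner_tendsto_left test_fun_square_integrable_T test w) auto
    then have "(\<lambda>n. inner_L2 lborel (us n) w + (\<Sum>i\<in>UNIV. inner_L2 lborel (T i (us n)) (T i w))) \<longlonglongrightarrow> inner_L2 lborel u w + Qbar u w"
      unfolding Qbar_test[OF ap g w] by (intro tendsto_add L2_inner_tendsto_left sq u wsq)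
    then have "(\<lambda>n. inner_Q (us n) w) \<longlonglongrightarrow> inner_L2 lborel u w + Qbar u w"
      by (simp add: inner_Q_def Qform_test_fun test w)
    then have "inner_L2 lborel u w + Qbar u w = inner_L2 lborel f w"
      using conv[of w] w LIMSEQ_unique by blast
    moreover have "inner_L2 lborel f w = inner_L2 lborel u w + inner_L2 lborel (\<lambda>x. f x - u x) w"
      using L2_lin_left[OF f u(1) wsq, of "-1"] by simp
    ultimately show ?thesis by (metis add_left_cancel)
  qed
  have ext: "Qbar u v = inner_L2 lborel (\<lambda>x. f x - u x) v" if "v \<in> Qbar_dom" for v
    by (rule Qbar_eq_inner_extend[OF uQ fu eq that])
  have uH: "u \<in> H_dom"
    unfolding H_dom_def
  proof (intro CollectI conjI uQ exI ballI)
    fix v assume v: "v \<in> Qbar_dom"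
    then have "square_integrable lborel v" by (auto simp: Qbar_dom_def Q_approx_def in_Lp_2)
    then show "cmod (Qbar u v) \<le> norm_L2 lborel (\<lambda>x. f x - u x) * Lp_norm 2 v"
      unfolding ext[OF v] Lp_norm_2 by (rule L2_Cauchy_Schwarz[OF fu])
  qed
  have "AE x in lborel. H_op u x = f x - u x"
    by (rule inner_L2_unique[OF H_op_spec(1)[OF uH] fu])
      (simp add: H_op_spec(2)[OF uH, symmetric] Qbar_dom_test eq)
  then have "AE x in lborel. H_op u x + u x = f x" by eventually_elim simp
  with uH that show thesis by blast
qed

lemma H_plus_1_inv:
  assumes "square_integrable lborel f"
  shows "H_plus_1_inv f \<in> H_dom" "AE x in lborel. H_op (H_plus_1_inv f) x + H_plus_1_inv f x = f x"
proof -
  have "\<exists>u. u \<in> H_dom \<and> (AE x in lborel. H_op u x + u x = f x)"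
    using H_plus_1_surjective[OF assms] by blast
  from someI_ex[OF this, folded H_plus_1_inv_def]
  show "H_plus_1_inv f \<in> H_dom" "AE x in lborel. H_op (H_plus_1_inv f) x + H_plus_1_inv f x = f x"
    by auto
qed

text \<open>
  Testing the equation with its solution \<open>u\<close> gives \<open>Q(u, u) = Re \<langle>f, u\<rangle> - \<parallel>u\<parallel>\<^sup>2\<close>, which is at most
  \<open>\<parallel>f\<parallel> \<parallel>u\<parallel> - \<parallel>u\<parallel>\<^sup>2\<close>; complete the square.
\<close>

lemma resolvent_energy:
  assumes f: "square_integrable lborel f" and uH: "u \<in> H_dom" and eq: "AE x in lborel. H_op u x + u x = f x"
    and us: "Q_approx us u" and g: "is_T_limit us g"
  shows "(\<Sum>i\<in>UNIV. (norm_L2 lborel (g i))^2) \<le> (norm_L2 lborel f)^2 / 4"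
proof -
  have u: "square_integrable lborel u" by (rule Q_approxD[OF us])
  have uQ: "u \<in> Qbar_dom" using us by (auto simp: Qbar_dom_def)
  have "complex_of_real (\<Sum>i\<in>UNIV. (norm_L2 lborel (g i))^2) = Qbar u u"
    by (simp add: Qbar_eq[OF us g us g] inner_L2_power2)
  also have "\<dots> = inner_L2 lborel (H_op u) u" by (rule H_op_spec(2)[OF uH uQ])
  also have "\<dots> = inner_L2 lborel (\<lambda>x. f x - u x) u"
    unfolding inner_L2_def
  proof (rule Bochner_Integration.integral_cong_AE)
    show "(\<lambda>x. H_op u x * cnj (u x)) \<in> borel_measurable lborel"
      by (rule borel_measurable_integrable[OF square_integrable_inner[OF H_op_spec(1)[OF uH] u]])
    show "(\<lambda>x. (f x - u x) * cnj (u x)) \<in> borel_measurable lborel"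
      by (rule borel_measurable_integrable[OF square_integrable_inner[OF square_integrable_diff[OF f u] u]])
    show "AE x in lborel. H_op u x * cnj (u x) = (f x - u x) * cnj (u x)"
      using eq by eventually_elim (simp add: eq_diff_eq)
  qed
  also have "\<dots> = inner_L2 lborel f u - complex_of_real ((norm_L2 lborel u)^2)"
    using L2_lin_left[OF f u u, of "-1"] by (simp add: inner_L2_power2)
  finally have e: "complex_of_real (\<Sum>i\<in>UNIV. (norm_L2 lborel (g i))^2) = inner_L2 lborel f u - complex_of_real ((norm_L2 lborel u)^2)" .
  have "(\<Sum>i\<in>UNIV. (norm_L2 lborel (g i))^2) = Re (inner_L2 lborel f u) - (norm_L2 lborel u)^2"
    using arg_cong[OF e, of Re] by (simp del: of_real_power of_real_sum)
  also have "\<dots> \<le> norm_L2 lborel f * norm_L2 lborel u - (norm_L2 lborel u)^2"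
    using L2_Cauchy_Schwarz[OF f u] complex_Re_le_cmod[of "inner_L2 lborel f u"] by linarith
  also have "\<dots> \<le> (norm_L2 lborel f)^2 / 4"
    using zero_le_power2[of "norm_L2 lborel f / 2 - norm_L2 lborel u"] by (simp add: power2_diff power_divide)
  finally show ?thesis .
qed

section \<open>The bound in \<open>L\<^sup>6\<close>\<close>

lemma nn_integral_energy_density:
  assumes "test_fun u"
  shows "energy u = ennreal (\<Sum>i\<in>UNIV. (norm_L2 lborel (T i u))^2)"
proof -
  have [measurable]: "T i u \<in> borel_measurable borel" for i
    by (intro T_measurable C1cD test_fun_C1c assms)
  have "energy u = (\<integral>\<^sub>+x. (\<Sum>i\<in>UNIV. ennreal ((cmod (T i u x))^2)))"
    by (simp add: energy_density_def)
  also have "\<dots> = (\<Sum>i\<in>UNIV. \<integral>\<^sub>+x. ennreal ((cmod (T i u x))^2))"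
    by (rule nn_integral_sum) measurable
  also have "\<dots> = ennreal (\<Sum>i\<in>UNIV. (norm_L2 lborel (T i u))^2)"
    by (simp add: nn_integral_norm_L2 test_fun_square_integrable_T assms)
  finally show ?thesis .
qed

lemma radial_proj_perp_measurable:
  "f \<in> borel_measurable borel \<Longrightarrow> radial_proj_perp f \<in> borel_measurable borel"
  unfolding radial_proj_perp_def[abs_def] using radial_proj_measurable[of f] by (intro borel_measurable_diff)

lemma radial_proj_perp_L2:
  assumes [measurable]: "f \<in> borel_measurable borel"
  shows "(\<integral>\<^sub>+x. ennreal ((cmod (radial_proj_perp f x))^2)) \<le> 4 * (\<integral>\<^sub>+x. ennreal ((cmod (f x))^2))"
proof -
  note [measurable] = radial_proj_measurable[OF assms]
  have "(\<integral>\<^sub>+x. ennreal ((cmod (radial_proj_perp f x))^2))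
      \<le> (\<integral>\<^sub>+x. 2 * ennreal ((cmod (f x))^2) + 2 * ennreal ((cmod (radial_proj f x))^2))"
  proof (rule nn_integral_mono)
    fix x
    have "(cmod (radial_proj_perp f x))^2 \<le> 2 * (cmod (f x))^2 + 2 * (cmod (radial_proj f x))^2"
      using cmod_add_power2_le[of "f x" "- radial_proj f x"] by (simp add: radial_proj_perp_def)
    then have "ennreal ((cmod (radial_proj_perp f x))^2) \<le> ennreal (2 * (cmod (f x))^2 + 2 * (cmod (radial_proj f x))^2)"
      by (rule ennreal_leI)
    then show "ennreal ((cmod (radial_proj_perp f x))^2) \<le> 2 * ennreal ((cmod (f x))^2) + 2 * ennreal ((cmod (radial_proj f x))^2)"
      by (simp add: ennreal_plus ennreal_mult)
  qed
  also have "\<dots> = 2 * (\<integral>\<^sub>+x. ennreal ((cmod (f x))^2)) + 2 * (\<integral>\<^sub>+x. ennreal ((cmod (radial_proj f x))^2))"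
    by (simp add: nn_integral_add nn_integral_cmult)
  also have "\<dots> \<le> 2 * (\<integral>\<^sub>+x. ennreal ((cmod (f x))^2)) + 2 * (\<integral>\<^sub>+x. ennreal ((cmod (f x))^2))"
    by (intro add_left_mono mult_left_mono radial_proj_L2 assms) simp
  also have "\<dots> = (2 + 2) * (\<integral>\<^sub>+x. ennreal ((cmod (f x))^2))"
    by (simp only: distrib_right)
  finally show ?thesis by simp
qed

lemma radial_proj_perp_AE_subseq:
  assumes us: "Q_approx us u"
  obtains r where "strict_mono r" "AE x in lborel. (\<lambda>n. radial_proj_perp (us (r n)) x) \<longlonglongrightarrow> radial_proj_perp u x"
proof -
  note test = Q_approxD(1)[OF us] and u = Q_approxD(2)[OF us]
  define d where "d n x = us n x - u x" for n x
  have d: "square_integrable lborel (d n)" for n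
    unfolding d_def by (intro square_integrable_diff test_fun_square_integrable test u)
  have dm: "d n \<in> borel_measurable borel" for n using d[of n] by (simp add: square_integrable_def)
  note [measurable] = radial_proj_perp_measurable[OF dm]
  have le: "(\<integral>\<^sub>+x. ennreal ((cmod (radial_proj_perp (d n) x))^2)) \<le> ennreal (4 * (norm_L2 lborel (d n))^2)" for n
    using radial_proj_perp_L2[OF dm[of n]] unfolding nn_integral_norm_L2[OF d] by (simp add: ennreal_mult)
  have int: "integrable lborel (\<lambda>x. (cmod (radial_proj_perp (d n) x))^2)" for n
  proof (rule integrableI_bounded)
    show "(\<integral>\<^sub>+x. ennreal (norm ((cmod (radial_proj_perp (d n) x))^2))) < \<infinity>"
      using le_less_trans[OF le ennreal_less_top, of n] by simp
  qed measurable
  have bound: "(LINT x|lborel. norm ((cmod (radial_proj_perp (d n) x))^2)) \<le> 4 * (norm_L2 lborel (d n))^2" for n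
  proof -
    have "ennreal (LINT x|lborel. (cmod (radial_proj_perp (d n) x))^2) \<le> ennreal (4 * (norm_L2 lborel (d n))^2)"
      using le[of n] nn_integral_eq_integral[OF int[of n]] by simp
    then show ?thesis by simp
  qed
  have "(\<lambda>n. 4 * (norm_L2 lborel (d n))^2) \<longlonglongrightarrow> 4 * 0^2"
    unfolding d_def by (intro tendsto_intros Q_approxD(3)[OF us])
  then have lim: "(\<lambda>n. 4 * (norm_L2 lborel (d n))^2) \<longlonglongrightarrow> 0" by simp
  have "(\<lambda>n. LINT x|lborel. norm ((cmod (radial_proj_perp (d n) x))^2)) \<longlonglongrightarrow> 0"
    by (rule Lim_null_comparison[OF _ lim]) (use bound in \<open>auto intro: always_eventually\<close>)
  from tendsto_L1_AE_subseq[OF int this] obtain r where r: "strict_mono r"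
    and ae: "AE x in lborel. (\<lambda>n. (cmod (radial_proj_perp (d (r n)) x))^2) \<longlonglongrightarrow> 0" by auto
  have "AE x in lborel. \<forall>n. radial_proj (d n) x = radial_proj (us n) x - radial_proj u x"
    unfolding AE_all_countable d_def by (intro allI radial_proj_diff_AE test_fun_C1c test u)
  with ae have "AE x in lborel. (\<lambda>n. radial_proj_perp (us (r n)) x) \<longlonglongrightarrow> radial_proj_perp u x"
  proof eventually_elim
    case (elim x)
    have "radial_proj_perp (d n) x = radial_proj_perp (us n) x - radial_proj_perp u x" for n
      using elim(2) by (simp add: radial_proj_perp_def d_def)
    with elim(1) have "(\<lambda>n. (cmod (radial_proj_perp (us (r n)) x - radial_proj_perp u x))^2) \<longlonglongrightarrow> 0"
      by simp
    from tendsto_real_sqrt[OF this] have "(\<lambda>n. radial_proj_perp (us (r n)) x - radial_proj_perp u x) \<longlonglongrightarrow> 0"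
      unfolding real_sqrt_zero real_sqrt_abs abs_norm_cancel by (rule tendsto_norm_zero_cancel)
    then show ?case by (rule LIM_zero_cancel)
  qed
  with r that show thesis by blast
qed

text \<open>
  Along a subsequence of the approximating test functions the projections converge almost everywhere, and the energies
  converge to that of \<open>u\<close>, so Fatou's lemma applies.
\<close>

proposition radial_proj_perp_L6_limit:
  assumes us: "Q_approx us u" and g: "is_T_limit us g"
  shows "(\<integral>\<^sub>+x. ennreal ((cmod (radial_proj_perp u x))^6))
    \<le> ennreal (4096 * ((8 + (4 * pi)^2) * (\<Sum>i\<in>UNIV. (norm_L2 lborel (g i))^2))^3)"
proof -
  note test = Q_approxD(1)[OF us]
  define E where "E n = (\<Sum>i\<in>UNIV. (norm_L2 lborel (T i (us n)))^2)" for n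
  have E0: "0 \<le> E n" for n by (simp add: E_def sum_nonneg)
  obtain r where r: "strict_mono r" and ae: "AE x in lborel. (\<lambda>n. radial_proj_perp (us (r n)) x) \<longlonglongrightarrow> radial_proj_perp u x"
    by (rule radial_proj_perp_AE_subseq[OF us])
  have gsq: "square_integrable lborel (g i)" for i using g by (simp add: is_T_limit_def)
  have "(\<lambda>n. norm_L2 lborel (T i (us n))) \<longlonglongrightarrow> norm_L2 lborel (g i)" for i
  proof -
    have "(\<lambda>n. inner_L2 lborel (T i (us n)) (T i (us n))) \<longlonglongrightarrow> inner_L2 lborel (g i) (g i)"
      using g unfolding is_T_limit_def by (intro L2_inner_tendsto test_fun_square_integrable_T test) auto
    from tendsto_Re[OF this] have "(\<lambda>n. (norm_L2 lborel (T i (us n)))^2) \<longlonglongrightarrow> (norm_L2 lborel (g i))^2"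
      by (simp add: inner_L2_power2 del: of_real_power)
    from tendsto_real_sqrt[OF this] show ?thesis by (simp add: norm_L2_def)
  qed
  then have "E \<longlonglongrightarrow> (\<Sum>i\<in>UNIV. (norm_L2 lborel (g i))^2)"
    unfolding E_def by (intro tendsto_intros)
  then have "(\<lambda>n. E (r n)) \<longlonglongrightarrow> (\<Sum>i\<in>UNIV. (norm_L2 lborel (g i))^2)"
    using LIMSEQ_subseq_LIMSEQ[OF _ r] by (auto simp: o_def)
  then have lim: "(\<lambda>n. ennreal (4096 * ((8 + (4 * pi)^2) * E (r n))^3)) \<longlonglongrightarrow> ennreal (4096 * ((8 + (4 * pi)^2) * (\<Sum>i\<in>UNIV. (norm_L2 lborel (g i))^2))^3)"
    by (intro tendsto_ennrealI tendsto_intros)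
  show ?thesis
  proof (rule nn_integral_le_of_AE_tendsto[OF _ _ _ lim])
    show "(\<lambda>x. ennreal ((cmod (radial_proj_perp (us (r k)) x))^6)) \<in> borel_measurable lborel" for k
      using radial_proj_perp_measurable[OF C1_measurable[OF C1cD[OF test_fun_C1c[OF test]]]] by measurable
    show "AE x in lborel. (\<lambda>k. ennreal ((cmod (radial_proj_perp (us (r k)) x))^6)) \<longlonglongrightarrow> ennreal ((cmod (radial_proj_perp u x))^6)"
      using ae by eventually_elim (intro tendsto_intros)
    show "(\<integral>\<^sub>+x. ennreal ((cmod (radial_proj_perp (us (r k)) x))^6)) \<le> ennreal (4096 * ((8 + (4 * pi)^2) * E (r k))^3)" for k
    proof -
      have "(\<integral>\<^sub>+x. ennreal ((cmod (radial_proj_perp (us (r k)) x))^6))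
          \<le> 4096 * (ennreal (8 + (4 * pi)^2) * ennreal (E (r k)))^3"
        using radial_proj_perp_L6[OF test_fun_C1c[OF test]] unfolding nn_integral_energy_density[OF test] E_def .
      also have "\<dots> = ennreal (4096 * ((8 + (4 * pi)^2) * E (r k))^3)"
        using E0[of "r k"] by (simp add: ennreal_mult ennreal_power[symmetric] add_nonneg_nonneg)
      finally show ?thesis .
    qed
  qed
qed

theorem corollary2p2:
  shows "\<exists>C::real. \<forall>f :: real^3 \<Rightarrow> complex. schwartz f \<longrightarrow>
           in_Lp 6 (radial_proj_perp (H_plus_1_inv f)) \<and>
           Lp_norm 6 (radial_proj_perp (H_plus_1_inv f)) \<le> C * Lp_norm 2 f"
proof -
\<comment> \<open>With the energy bound \<open>F^2 / 4\<close>, the factor \<open>4096 = 4^6\<close> of the Sobolev inequality becomes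
  \<open>64 = 2^6\<close>; hence the constant \<open>2 * sqrt c\<close>.\<close>
  define c where "c = 8 + (4 * pi)^2"
  have c: "0 \<le> c" by (simp add: c_def)
  have "in_Lp 6 (radial_proj_perp (H_plus_1_inv f)) \<and>
      Lp_norm 6 (radial_proj_perp (H_plus_1_inv f)) \<le> (2 * sqrt c) * Lp_norm 2 f" if "schwartz f" for f
  proof -
    have f: "square_integrable lborel f" by (rule schwartz_square_integrable[OF that])
    define u where "u = H_plus_1_inv f"
    have uH: "u \<in> H_dom" and eq: "AE x in lborel. H_op u x + u x = f x"
      unfolding u_def by (rule H_plus_1_inv[OF f])+
    then obtain us where us: "Q_approx us u" by (auto simp: H_dom_def Qbar_dom_def)
    obtain g where g: "is_T_limit us g" using Q_approx_T_limit[OF us] by metis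
    define F where "F = norm_L2 lborel f"
    have F: "0 \<le> F" by (simp add: F_def norm_L2_def)
    define h where "h = radial_proj_perp u"
    have hm [measurable]: "h \<in> borel_measurable borel"
      unfolding h_def using Q_approxD(2)[OF us] by (intro radial_proj_perp_measurable) (simp add: square_integrable_def)
    have "(\<integral>\<^sub>+x. ennreal ((cmod (h x))^6))
        \<le> ennreal (4096 * (c * (\<Sum>i\<in>UNIV. (norm_L2 lborel (g i))^2))^3)"
      unfolding h_def c_def by (rule radial_proj_perp_L6_limit[OF us g])
    also have "\<dots> \<le> ennreal (4096 * (c * (F^2 / 4))^3)"
      using resolvent_energy[OF f uH eq us g] c
      by (intro ennreal_leI mult_left_mono power_mono) (auto simp: F_def sum_nonneg)
    also have "4096 * (c * (F^2 / 4))^3 = (2 * sqrt c * F)^6"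
    proof -
      have "(sqrt c)^6 = ((sqrt c)^2)^3" by (simp only: power_mult[symmetric]) simp
      then have "(sqrt c)^6 = c^3" using c by simp
      then show ?thesis by (simp add: power_mult_distrib power_divide flip: power_mult)
    qed
    finally have le: "(\<integral>\<^sub>+x. ennreal ((cmod (h x))^6)) \<le> ennreal ((2 * sqrt c * F)^6)" .
    have int: "integrable lborel (\<lambda>x. (cmod (h x))^6)"
    proof (rule integrableI_bounded)
      show "(\<integral>\<^sub>+x. ennreal (norm ((cmod (h x))^6))) < \<infinity>"
        using le_less_trans[OF le ennreal_less_top] by simp
    qed measurable
    have "ennreal (LINT x|lborel. (cmod (h x))^6) \<le> ennreal ((2 * sqrt c * F)^6)"
      using le nn_integral_eq_integral[OF int] by simp
    then have le': "(LINT x|lborel. (cmod (h x))^6) \<le> (2 * sqrt c * F)^6"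
      using F c by (simp add: ennreal_le_iff)
    have p: "cmod (h x) powr 6 = (cmod (h x))^6" for x
      by simp
    have "Lp_norm 6 h = (LINT x|lborel. (cmod (h x))^6) powr (1 / 6)"
      by (simp add: Lp_norm_def)
    also have "\<dots> \<le> ((2 * sqrt c * F)^6) powr (1 / 6)"
      by (rule powr_mono2[OF _ _ le']) (auto intro!: integral_nonneg)
    also have "\<dots> = 2 * sqrt c * F"
    proof (cases "2 * sqrt c * F = 0")
      case False
      then have pos: "0 < 2 * sqrt c * F" using F c by (simp add: less_le)
      have "(2 * sqrt c * F)^6 = (2 * sqrt c * F) powr 6"
        using powr_realpow[OF pos, of 6] by (simp only: of_nat_numeral)
      then have "((2 * sqrt c * F)^6) powr (1 / 6) = (2 * sqrt c * F) powr (6 * (1 / 6))"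
        by (simp only: powr_powr)
      then show ?thesis using pos by simp
    qed auto
    finally have "Lp_norm 6 h \<le> 2 * sqrt c * F" .
    moreover have "in_Lp 6 h" using int by (simp add: in_Lp_def)
    ultimately show ?thesis
      by (simp add: h_def u_def F_def Lp_norm_2)
  qed
  then show ?thesis by blast
qed

end
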